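(* Let $X=(X_1,\dots,X_d)\in M_n(\mathbb C)^d$ be a row contraction, i.e. $\|\sum_{i=1}^d X_iX_i^*\|<1$, and let $Y=(Y_{i,j})_{i,j=1}^{s,t}$ be an $s\times t$ block matrix with blocks $Y_{i,j}\in M_n(\mathbb C)$. There exists an $s\times t$ matrix $f=(f_{ij})$ of functions in $H^\infty(\mathcal B^d)$ such that $\|f\|_\infty\le 1$ and $f(X)=Y$ (i.e. $f_{ij}(X)=Y_{i,j}$ for all $i,j$) if and only if $$P_X\otimes I_s-(I_n\otimes Y)(P_X\otimes I_t)(I_n\otimes Y^* )\succeq 0 .$$
   Context: Row ball: $\mathcal B^d=\bigsqcup_{m\ge1}\mathcal B^d_m$, where $\mathcal B^d_m$ is the set of $d$-tuples of complex $m\times m$ matrices $X$ with $\|\sum X_iX_i^*\|<1$. An nc function $f:\mathcal B^d\to\bigsqcup_m M_m(\mathbb C)$ is a graded function (mapping $\mathcal B^d_m$ into $M_m(\mathbb C)$) with $f(X\oplus Y)=f(X)\oplus f(Y)$ and $f(S^{-1}XS)=S^{-1}f(X)S$ whenever $S$ is invertible and $X,S^{-1}XS\in\mathcal B^d$ (operations on tuples are coordinatewise). $H^\infty(\mathcal B^d)$ is the set of nc functions with $\sup_{X\in\mathcal B^d}\|f(X)\|<\infty$. For an $s\times t$ matrix $f=(f_{ij})$ of such functions, $\|f\|_\infty=\sup_{X\in\mathcal B^d}\|(f_{ij}(X))_{i,j}\|$, the norm being the operator norm of the block matrix. $\otimes$ is the Kronecker product. $\mathrm{vec}:M_n(\mathbb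 C)\to\mathbb C^{n^2}$ stacks columns. $\psi:M_{n^2}(\mathbb C)\to M_{n^2}(\mathbb C)$, $A\mapsto A^\psi$, is the linear map with $[C\otimes D]^\psi=\mathrm{vec}(D)\,\mathrm{vec}(C)^T$ for $C,D\in M_n(\mathbb C)$. $\overline{X_i}$ is the entrywise conjugate. For a row contraction $X$ the elementary Pick matrix is $P_X=\big[(I_n\otimes I_n-\sum_{i=1}^d\overline{X_i}\otimes X_i)^{-1}\big]^\psi$ (the inverse exists). Tensor convention: in the displayed inequality, acting on $\mathbb C^n\otimes\mathbb C^n\otimes\mathbb C^s$, the block matrix $Y$ is identified with $\sum_{i,j}Y_{i,j}\otimes \mathcal E_{ij}\in M_n(\mathbb C)\otimes M_{s\times t}(\mathbb C)$, where $\mathcal E_{ij}$ are the $s\times t$ matrix units. Thus $I_n\otimes Y$ is $\sum_{i,j}I_n\otimes Y_{i,j}\otimes\mathcal E_{ij}$. *)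

theory Defs
  imports
    "Jordan_Normal_Form.Matrix"
    "Jordan_Normal_Form.Gauss_Jordan_Elimination"
    "Jordan_Normal_Form.Schur_Decomposition"
    "HOL-Library.Extended_Real"
begin

section \<open>Complex matrices\<close>

definition l2_norm :: "complex vec \<Rightarrow> real" where
  "l2_norm v = sqrt (\<Sum>i<dim_vec v. (cmod (v $ i))\<^sup>2)"

definition op_norm :: "complex mat \<Rightarrow> real" where
  "op_norm A = (SUP v\<in>{v \<in> carrier_vec (dim_col A). l2_norm v \<le> 1}. l2_norm (A *\<^sub>v v))"

text \<open>The order on \<^typ>\<open>complex\<close> is that of \<^theory>\<open>HOL-Library.Complex_Order\<close>:
  \<^term>\<open>0 \<le> z\<close> says that \<^term>\<open>z\<close> is real and nonnegative. Hence the
  quadratic form being nonnegative includes that \<^term>\<open>A\<close> is Hermitian.\<close>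

definition psd :: "complex mat \<Rightarrow> bool" where
  "psd A \<longleftrightarrow> dim_row A = dim_col A \<and>
     (\<forall>v\<in>carrier_vec (dim_row A). 0 \<le> (A *\<^sub>v v) \<bullet>c v)"

text \<open>Meaningful for invertible matrices only.\<close>

definition mat_inv :: "complex mat \<Rightarrow> complex mat" where
  "mat_inv A = the (mat_inverse A)"

definition mat_list_sum :: "nat \<Rightarrow> nat \<Rightarrow> complex mat list \<Rightarrow> complex mat" where
  "mat_list_sum nr nc As = foldr (+) As (0\<^sub>m nr nc)"

definition direct_sum :: "complex mat \<Rightarrow> complex mat \<Rightarrow> complex mat" where
  "direct_sum A B = four_block_mat A (0\<^sub>m (dim_row A) (dim_col B)) (0\<^sub>m (dim_row B) (dim_col A)) B"

definition kron :: "complex mat \<Rightarrow> complex mat \<Rightarrow> complex mat" where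
  "kron A B = mat (dim_row A * dim_row B) (dim_col A * dim_col B)
     (\<lambda>(i, j). A $$ (i div dim_row B, j div dim_col B) * B $$ (i mod dim_row B, j mod dim_col B))"

definition matrix_unit :: "nat \<Rightarrow> nat \<Rightarrow> nat \<Rightarrow> nat \<Rightarrow> complex mat" where
  "matrix_unit s t i j = mat s t (\<lambda>(a, b). if a = i \<and> b = j then 1 else 0)"


section \<open>Block matrices\<close>

text \<open>A block matrix with blocks of size \<^term>\<open>n\<close> is a matrix of matrices. It is read as a
  complex matrix in two ways, which differ by a permutation of the coordinates: as the array of
  its blocks, and as the tensor \<open>\<Sum> Y\<^sub>i\<^sub>j \<otimes> E\<^sub>i\<^sub>j\<close>.\<close>

definition block_matrix :: "nat \<Rightarrow> complex mat mat \<Rightarrow> complex mat" where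
  "block_matrix n Y = mat (dim_row Y * n) (dim_col Y * n)
     (\<lambda>(p, q). Y $$ (p div n, q div n) $$ (p mod n, q mod n))"

definition block_tensor :: "nat \<Rightarrow> complex mat mat \<Rightarrow> complex mat" where
  "block_tensor n Y = mat_list_sum (n * dim_row Y) (n * dim_col Y)
     [kron (Y $$ (i, j)) (matrix_unit (dim_row Y) (dim_col Y) i j).
        i \<leftarrow> [0..<dim_row Y], j \<leftarrow> [0..<dim_col Y]]"


section \<open>The row ball and nc functions\<close>

definition row_ball_level :: "nat \<Rightarrow> nat \<Rightarrow> complex mat list set" where
  "row_ball_level d m = {X. length X = d \<and> set X \<subseteq> carrier_mat m m \<and>
     op_norm (mat_list_sum m m (map (\<lambda>A. A * mat_adjoint A) X)) < 1}"

text \<open>For \<^term>\<open>d \<ge> 1\<close> the levels are disjoint, as the size is determined by the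
  first entry of the tuple.\<close>

definition row_ball :: "nat \<Rightarrow> complex mat list set" where
  "row_ball d = (\<Union>m\<in>{1..}. row_ball_level d m)"

text \<open>Functions on the row ball are total functions on tuples; their values outside
  of the row ball are irrelevant.\<close>

definition nc_function :: "nat \<Rightarrow> (complex mat list \<Rightarrow> complex mat) \<Rightarrow> bool" where
  "nc_function d f \<longleftrightarrow>
     (\<forall>m\<ge>1. \<forall>X\<in>row_ball_level d m. f X \<in> carrier_mat m m) \<and>
     (\<forall>X\<in>row_ball d. \<forall>Y\<in>row_ball d. f (map2 direct_sum X Y) = direct_sum (f X) (f Y)) \<and>
     (\<forall>m\<ge>1. \<forall>X\<in>row_ball_level d m. \<forall>S\<in>carrier_mat m m. invertible_mat S \<longrightarrow>
        map (\<lambda>A. mat_inv S * A * S) X \<in> row_ball d \<longrightarrow>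
        f (map (\<lambda>A. mat_inv S * A * S) X) = mat_inv S * f X * S)"

definition H_infinity :: "nat \<Rightarrow> (complex mat list \<Rightarrow> complex mat) set" where
  "H_infinity d = {f. nc_function d f \<and> (SUP X\<in>row_ball d. ereal (op_norm (f X))) < \<infinity>}"

definition H_infinity_norm :: "nat \<Rightarrow> (complex mat list \<Rightarrow> complex mat) mat \<Rightarrow> ereal" where
  "H_infinity_norm d F = (SUP m\<in>{1..}. SUP X\<in>row_ball_level d m.
     ereal (op_norm (block_matrix m (map_mat (\<lambda>f. f X) F))))"


section \<open>The elementary Pick matrix\<close>

definition vectorize :: "complex mat \<Rightarrow> complex vec" where
  "vectorize A = vec (dim_row A * dim_col A) (\<lambda>k. A $$ (k mod dim_row A, k div dim_row A))"

definition outer :: "complex vec \<Rightarrow> complex vec \<Rightarrow> complex mat" where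
  "outer u v = mat (dim_vec u) (dim_vec v) (\<lambda>(p, q). u $ p * v $ q)"

text \<open>The map \<open>\<psi>\<close> is linear with \<open>\<psi> (C \<otimes> D) = vec D (vec C)\<^sup>T\<close>. As the entry of
  \<open>C \<otimes> D\<close> at \<open>(i * n + k, j * n + l)\<close> is \<open>C\<^sub>i\<^sub>j D\<^sub>k\<^sub>l\<close>, which is the entry of
  \<open>vec D (vec C)\<^sup>T\<close> at \<open>(l * n + k, j * n + i)\<close>, it permutes the entries as follows. The lemmas
  below confirm the defining properties and that they determine the map.\<close>

definition psi :: "nat \<Rightarrow> complex mat \<Rightarrow> complex mat" where
  "psi n A = mat (n * n) (n * n)
     (\<lambda>(p, q). A $$ ((q mod n) * n + p mod n, (q div n) * n + p div n))"

lemma digit_less: "a < n \<Longrightarrow> b < n \<Longrightarrow> a * n + b < n * (n::nat)"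
proof -
  assume a: "a < n" and b: "b < n"
  have "a * n + b < (a + 1) * n" using b by simp
  also have "\<dots> \<le> n * n" using a by (intro mult_right_mono) auto
  finally show ?thesis .
qed

lemma digits_of:
  assumes "p < n * (n::nat)"
  shows "0 < n" "p div n < n" "p mod n < n"
proof -
  show n: "0 < n" using assms by (cases n) auto
  show "p div n < n" using assms by (simp add: less_mult_imp_div_less)
  show "p mod n < n" using n by simp
qed

lemma psi_carrier: "psi n A \<in> carrier_mat (n * n) (n * n)"
  by (simp add: psi_def)

lemma psi_add:
  assumes "A \<in> carrier_mat (n * n) (n * n)" "B \<in> carrier_mat (n * n) (n * n)"
  shows "psi n (A + B) = psi n A + psi n B"
  using assms by (intro eq_matI) (auto simp: psi_def digit_less digits_of)

lemma psi_smult: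
  assumes "A \<in> carrier_mat (n * n) (n * n)"
  shows "psi n (c \<cdot>\<^sub>m A) = c \<cdot>\<^sub>m psi n A"
  using assms by (intro eq_matI) (auto simp: psi_def digit_less digits_of)

lemma psi_kron:
  assumes "C \<in> carrier_mat n n" "D \<in> carrier_mat n n"
  shows "psi n (kron C D) = outer (vectorize D) (vectorize C)"
  using assms
  by (intro eq_matI)
     (auto simp: psi_def kron_def outer_def vectorize_def digit_less digits_of)

lemma psi_unique:
  assumes carrier: "\<And>A. A \<in> carrier_mat (n * n) (n * n) \<Longrightarrow> \<phi> A \<in> carrier_mat (n * n) (n * n)"
    and add: "\<And>A B. A \<in> carrier_mat (n * n) (n * n) \<Longrightarrow> B \<in> carrier_mat (n * n) (n * n) \<Longrightarrow>
      \<phi> (A + B) = \<phi> A + \<phi> B"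
    and smult: "\<And>A c. A \<in> carrier_mat (n * n) (n * n) \<Longrightarrow> \<phi> (c \<cdot>\<^sub>m A) = c \<cdot>\<^sub>m \<phi> A"
    and tensor: "\<And>C D. C \<in> carrier_mat n n \<Longrightarrow> D \<in> carrier_mat n n \<Longrightarrow>
      \<phi> (kron C D) = outer (vectorize D) (vectorize C)"
    and A: "A \<in> carrier_mat (n * n) (n * n)"
  shows "\<phi> A = psi n A"
proof -
  let ?N = "n * n"
  let ?C = "carrier_mat ?N ?N :: complex mat set"
  define R where "R S = mat ?N ?N (\<lambda>ij. if ij \<in> S then A $$ ij else 0)" for S
  have R: "R S \<in> ?C" for S by (simp add: R_def)
  have zero: "\<phi> (0\<^sub>m ?N ?N) = psi n (0\<^sub>m ?N ?N)"
  proof -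
    have "0\<^sub>m ?N ?N = 0 \<cdot>\<^sub>m (0\<^sub>m ?N ?N :: complex mat)" by (intro eq_matI) auto
    then have "\<phi> (0\<^sub>m ?N ?N) = 0 \<cdot>\<^sub>m \<phi> (0\<^sub>m ?N ?N)" using smult[of "0\<^sub>m ?N ?N" 0] by simp
    also have "\<dots> = 0\<^sub>m ?N ?N" using carrier[of "0\<^sub>m ?N ?N"] by (intro eq_matI) auto
    also have "\<dots> = psi n (0\<^sub>m ?N ?N)"
      by (intro eq_matI) (auto simp: psi_def digit_less digits_of)
    finally show ?thesis .
  qed
  have "\<phi> (R S) = psi n (R S)" if "finite S" "S \<subseteq> {..<?N} \<times> {..<?N}" for S
    using that
  proof (induction S rule: finite_induct)
    case empty
    have "R {} = 0\<^sub>m ?N ?N" by (intro eq_matI) (auto simp: R_def)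
    then show ?case using zero by simp
  next
    case (insert x S)
    obtain a b where x: "x = (a, b)" by fastforce
    have ab: "a < ?N" "b < ?N" using insert.prems x by auto
    let ?E = "matrix_unit n n (a div n) (b div n)" and ?F = "matrix_unit n n (a mod n) (b mod n)"
    have EF: "?E \<in> carrier_mat n n" "?F \<in> carrier_mat n n" by (auto simp: matrix_unit_def)
    have K: "kron ?E ?F \<in> ?C" by (simp add: kron_def matrix_unit_def)
    have eq: "i div n = a div n \<and> i mod n = a mod n \<longleftrightarrow> i = a" for i a :: nat
      by (metis div_mult_mod_eq)
    have unit: "kron ?E ?F $$ (i, j) = (if (i, j) = (a, b) then 1 else 0)"
      if "i < ?N" "j < ?N" for i j
      using that ab eq[of i a] eq[of j b]
      by (auto simp: kron_def matrix_unit_def digits_of)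
    have split: "R (insert x S) = A $$ (a, b) \<cdot>\<^sub>m kron ?E ?F + R S"
      using K unit insert.hyps x
      by (intro eq_matI) (auto simp: R_def)
    have "\<phi> (R (insert x S)) = A $$ (a, b) \<cdot>\<^sub>m \<phi> (kron ?E ?F) + \<phi> (R S)"
      unfolding split using K R[of S] by (simp add: add smult)
    also have "\<dots> = A $$ (a, b) \<cdot>\<^sub>m psi n (kron ?E ?F) + psi n (R S)"
      using insert EF by (simp add: tensor psi_kron)
    also have "\<dots> = psi n (R (insert x S))"
      unfolding split using K R[of S] by (simp add: psi_add psi_smult)
    finally show ?case .
  qed
  then have "\<phi> (R ({..<?N} \<times> {..<?N})) = psi n (R ({..<?N} \<times> {..<?N}))" by simp
  moreover have "R ({..<?N} \<times> {..<?N}) = A" using A by (intro eq_matI) (auto simp: R_def)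
  ultimately show ?thesis by simp
qed

definition pick_matrix :: "nat \<Rightarrow> complex mat list \<Rightarrow> complex mat" where
  "pick_matrix n X = psi n (mat_inv (kron (1\<^sub>m n) (1\<^sub>m n) -
     mat_list_sum (n * n) (n * n) (map (\<lambda>A. kron (map_mat cnj A) A) X)))"

end

theory Submission
  imports Defs
begin

text \<open>
  Reshaping \<open>(I - \<Sum> X\<^sub>i\<^sup>- \<otimes> X\<^sub>i)\<^sup>-\<^sup>1\<close>, with \<open>X\<^sub>i\<^sup>-\<close> the entrywise conjugate, turns the two equations
  that define the inverse into two Stein equations for the Pick matrix,
  \<open>P - \<Sum> (I \<otimes> X\<^sub>i) P (I \<otimes> X\<^sub>i)\<^sup>* = v v\<^sup>*\<close> and
  \<open>P - \<Sum> (X\<^sub>i\<^sup>T \<otimes> I) P (X\<^sub>i\<^sup>T \<otimes> I)\<^sup>* = v v\<^sup>*\<close> with \<open>v = vec I\<close>.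

  Necessity: by the first equation, if \<open>P + \<epsilon> I = S S\<^sup>*\<close> then the tuple
  \<open>S\<^sup>-\<^sup>1 (I \<otimes> X\<^sub>i) S\<close> is a strict row contraction. There \<open>f\<close> is contractive and, being an nc
  function, has the value \<open>S\<^sup>-\<^sup>1 (I \<otimes> Y) S\<close>. Conjugate with \<open>S\<close> and let \<open>\<epsilon>\<close> tend to \<open>0\<close>.

  Sufficiency is a lurking isometry argument. Factor the positive matrix of the condition as
  \<open>Q Q\<^sup>*\<close> and put \<open>U = v \<otimes> I\<close>, \<open>W = (I \<otimes> Y) (v \<otimes> I)\<close>, \<open>R\<^sub>i = (X\<^sub>i\<^sup>T \<otimes> I) Q\<close>.
  As \<open>X\<^sub>i\<^sup>T \<otimes> I\<close> commutes with \<open>I \<otimes> Y\<close>, the second equation gives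
  \<open>U U\<^sup>* + \<Sum> R\<^sub>i R\<^sub>i\<^sup>* = W W\<^sup>* + Q Q\<^sup>*\<close>, so that \<open>[W Q] = [U R\<^sub>1 \<dots> R\<^sub>d] V\<close> for a contraction \<open>V\<close>.
  The transfer function of \<open>V\<close> is a contractive nc function, and a reshaping of this equation
  says that its value at \<open>X\<close> is \<open>Y\<close>.
\<close>

section \<open>Adjoints and positive semidefinite matrices\<close>

text \<open>The right-hand side v v* of the first Stein equation is only nonnegative, and the
  strictness that the row ball demands is bought from the perturbation: the tuple has a margin c <
  1, so the perturbation contributes at least \<open>e * (1 - c)\<close> to the Stein defect.

  Positivity is proved by certificates, identities that exhibit a matrix as a sum of Gram matrices
  and congruences, in place of spectral theory. Square roots come from a congruence to a 0/1
  diagonal matrix; uniqueness and positivity for Stein equations come from iterating an order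
  inequality, in place of summing a series.

  In the sufficiency part, equality of Gram matrices gives only a partial isometry, between spaces
  of possibly different dimension. Its defect is recorded in an extra column G for which [V G] is a
  coisometry. That is enough for contractivity of the transfer function, and all spaces stay finite
  dimensional.\<close>

abbreviation adj :: "complex mat \<Rightarrow> complex mat" where
  "adj \<equiv> mat_adjoint"

abbreviation scalar_mat :: "real \<Rightarrow> nat \<Rightarrow> complex mat" where
  "scalar_mat c n \<equiv> complex_of_real c \<cdot>\<^sub>m 1\<^sub>m n"

lemma dim_adj [simp]: "dim_row (adj A) = dim_col A" "dim_col (adj A) = dim_row A"
  by (simp_all add: mat_adjoint_def)

lemma index_adj [simp]:
  "i < dim_col A \<Longrightarrow> j < dim_row A \<Longrightarrow> adj A $$ (i, j) = cnj (A $$ (j, i))"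
  by (simp add: mat_adjoint_def mat_of_rows_index)

lemma adj_carrier [simp]: "A \<in> carrier_mat n m \<Longrightarrow> adj A \<in> carrier_mat m n"
  by auto

lemma index_mult_sum:
  fixes A B :: "complex mat"
  assumes "i < dim_row A" "j < dim_col B" "dim_col A = dim_row B"
  shows "(A * B) $$ (i, j) = (\<Sum>k<dim_row B. A $$ (i, k) * B $$ (k, j))"
  using assms by (simp add: scalar_prod_def atLeast0LessThan)

lemma adj_adj [simp]: "adj (adj A) = A"
  by (intro eq_matI) auto

lemma adj_mult: "dim_col A = dim_row B \<Longrightarrow> adj (A * B) = adj B * adj A"
  by (intro eq_matI)
     (auto simp: index_mult_sum mult.commute simp del: index_mult_mat(1) intro!: sum.cong)

lemma adj_add: "dim_row A = dim_row B \<Longrightarrow> dim_col A = dim_col B \<Longrightarrow> adj (A + B) = adj A + adj B"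
  by (intro eq_matI) auto

lemma adj_minus: "dim_row A = dim_row B \<Longrightarrow> dim_col A = dim_col B \<Longrightarrow> adj (A - B) = adj A - adj B"
  by (intro eq_matI) auto

lemma adj_smult [simp]: "adj (k \<cdot>\<^sub>m A) = cnj k \<cdot>\<^sub>m adj A"
  by (intro eq_matI) auto

lemma adj_one [simp]: "adj (1\<^sub>m n) = 1\<^sub>m n"
  by (intro eq_matI) auto

lemma adj_zero [simp]: "adj (0\<^sub>m n m) = 0\<^sub>m m n"
  by (intro eq_matI) auto

lemma mat_assoc:
  fixes A B C :: "complex mat"
  shows "dim_col A = dim_row B \<Longrightarrow> dim_col B = dim_row C \<Longrightarrow> A * B * C = A * (B * C)"
  by (rule assoc_mult_mat[of A "dim_row A" "dim_col A" B "dim_col B" C "dim_col C"]) auto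

lemma mat_distrib:
  fixes A B C :: "complex mat"
  shows "dim_row A = dim_row B \<Longrightarrow> dim_col A = dim_col B \<Longrightarrow> dim_col A = dim_row C \<Longrightarrow>
      (A + B) * C = A * C + B * C"
    and "dim_row A = dim_row B \<Longrightarrow> dim_col A = dim_col B \<Longrightarrow> dim_col C = dim_row A \<Longrightarrow>
      C * (A + B) = C * A + C * B"
    and "dim_row A = dim_row B \<Longrightarrow> dim_col A = dim_col B \<Longrightarrow> dim_col A = dim_row C \<Longrightarrow>
      (A - B) * C = A * C - B * C"
    and "dim_row A = dim_row B \<Longrightarrow> dim_col A = dim_col B \<Longrightarrow> dim_col C = dim_row A \<Longrightarrow>
      C * (A - B) = C * A - C * B"
  by (intro eq_matI;
      auto simp: index_mult_sum algebra_simps sum.distrib sum_subtractf simp del: index_mult_mat(1))+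

lemma mat_smult:
  fixes A B :: "complex mat"
  shows "dim_col A = dim_row B \<Longrightarrow> (k \<cdot>\<^sub>m A) * B = k \<cdot>\<^sub>m (A * B)"
    and "dim_col A = dim_row B \<Longrightarrow> A * (k \<cdot>\<^sub>m B) = k \<cdot>\<^sub>m (A * B)"
  by (intro eq_matI;
      auto simp: index_mult_sum algebra_simps sum_distrib_left simp del: index_mult_mat(1))+

lemma mat_units:
  fixes A :: "complex mat"
  shows "n = dim_row A \<Longrightarrow> 1\<^sub>m n * A = A" "n = dim_col A \<Longrightarrow> A * 1\<^sub>m n = A"
  by (auto intro!: left_mult_one_mat' right_mult_one_mat')

lemmas mat_algebra = mat_assoc mat_distrib mat_smult mat_units adj_mult adj_add adj_minus

text \<open>Products are normalised by association to the right, where a known product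
  \<open>A * B\<close> is no longer a subterm of \<open>A * (B * M)\<close>. In this form its
  equation still rewrites there.\<close>

lemma mult_cong_right:
  fixes A B C :: "complex mat"
  assumes "A * B = C" "dim_col A = dim_row B" "dim_col B = dim_row M"
  shows "A * (B * M) = C * M"
  using assms mat_assoc[of A B M] by simp

section \<open>Quadratic forms and the positive semidefinite cone\<close>

lemma cscalar_mult_adj:
  assumes "w \<in> carrier_vec (dim_col B)" "v \<in> carrier_vec (dim_row B)"
  shows "(B *\<^sub>v w) \<bullet>c v = w \<bullet>c (adj B *\<^sub>v v)"
proof -
  have "(B *\<^sub>v w) \<bullet>c v = (\<Sum>i<dim_row B. \<Sum>j<dim_col B. B $$ (i, j) * w $ j * cnj (v $ i))"
    using assms by (simp add: scalar_prod_def atLeast0LessThan sum_distrib_right)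
  also have "\<dots> = (\<Sum>j<dim_col B. \<Sum>i<dim_row B. B $$ (i, j) * w $ j * cnj (v $ i))"
    by (rule sum.swap)
  also have "\<dots> = w \<bullet>c (adj B *\<^sub>v v)"
    using assms by (simp add: scalar_prod_def atLeast0LessThan sum_distrib_left mult_ac)
  finally show ?thesis .
qed

lemma psd_iff_sum:
  assumes "A \<in> carrier_mat n n"
  shows "psd A \<longleftrightarrow> (\<forall>x. 0 \<le> (\<Sum>i<n. \<Sum>j<n. A $$ (i, j) * x j * cnj (x i)))"
proof -
  have eq: "(A *\<^sub>v v) \<bullet>c v = (\<Sum>i<n. \<Sum>j<n. A $$ (i, j) * v $ j * cnj (v $ i))"
    if "v \<in> carrier_vec n" for v
    using assms that by (simp add: scalar_prod_def atLeast0LessThan sum_distrib_right)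
  have "psd A \<longleftrightarrow> (\<forall>v\<in>carrier_vec n. 0 \<le> (A *\<^sub>v v) \<bullet>c v)"
    using assms by (simp add: psd_def)
  also have "\<dots> \<longleftrightarrow> (\<forall>x. 0 \<le> (\<Sum>i<n. \<Sum>j<n. A $$ (i, j) * x j * cnj (x i)))"
  proof (intro iffI allI ballI)
    fix x :: "nat \<Rightarrow> complex"
    assume "\<forall>v\<in>carrier_vec n. 0 \<le> (A *\<^sub>v v) \<bullet>c v"
    then have "0 \<le> (A *\<^sub>v vec n x) \<bullet>c vec n x" by auto
    then show "0 \<le> (\<Sum>i<n. \<Sum>j<n. A $$ (i, j) * x j * cnj (x i))" by (simp add: eq)
  qed (auto simp: eq)
  finally show ?thesis .
qed

lemma psd_congruence:
  assumes "psd A" "dim_col B = dim_row A"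
  shows "psd (B * A * adj B)"
proof -
  obtain n m where A: "A \<in> carrier_mat n n" and B: "B \<in> carrier_mat m n"
    using assms by (metis carrier_matI psd_def)
  have "0 \<le> (B * A * adj B *\<^sub>v v) \<bullet>c v" if v: "v \<in> carrier_vec m" for v
  proof -
    let ?w = "adj B *\<^sub>v v"
    have w: "?w \<in> carrier_vec n" by (rule mult_mat_vec_carrier[OF adj_carrier[OF B] v])
    have "B * A * adj B *\<^sub>v v = (B * A) *\<^sub>v ?w"
      by (rule assoc_mult_mat_vec[OF mult_carrier_mat[OF B A] adj_carrier[OF B] v])
    also have "\<dots> = B *\<^sub>v (A *\<^sub>v ?w)" by (rule assoc_mult_mat_vec[OF B A w])
    finally have "(B * A * adj B *\<^sub>v v) \<bullet>c v = (B *\<^sub>v (A *\<^sub>v ?w)) \<bullet>c v" by (rule arg_cong)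
    also have "\<dots> = (A *\<^sub>v ?w) \<bullet>c ?w"
      using B v mult_mat_vec_carrier[OF A w] by (intro cscalar_mult_adj) auto
    finally show ?thesis using assms(1) A w by (simp add: psd_def)
  qed
  then show ?thesis using B by (simp add: psd_def)
qed

lemma psd_one: "psd (1\<^sub>m n)"
  by (auto simp: psd_def)

lemma psd_gram: "psd (B * adj B)"
  using psd_congruence[OF psd_one, of B "dim_col B"] by (simp add: mat_units)

lemma psd_add:
  assumes "A \<in> carrier_mat n n" "B \<in> carrier_mat n n" "psd A" "psd B"
  shows "psd (A + B)"
proof -
  have "(\<Sum>i<n. \<Sum>j<n. (A + B) $$ (i, j) * x j * cnj (x i)) =
     (\<Sum>i<n. \<Sum>j<n. A $$ (i, j) * x j * cnj (x i)) + (\<Sum>i<n. \<Sum>j<n. B $$ (i, j) * x j * cnj (x i))" for x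
    using assms by (simp add: sum.distrib algebra_simps)
  then show ?thesis
    using assms psd_iff_sum[of A n] psd_iff_sum[of B n] psd_iff_sum[of "A + B" n] by simp
qed

lemma psd_smult:
  assumes "A \<in> carrier_mat n n" "psd A" "0 \<le> (c::real)"
  shows "psd (complex_of_real c \<cdot>\<^sub>m A)"
proof -
  have "(\<Sum>i<n. \<Sum>j<n. (complex_of_real c \<cdot>\<^sub>m A) $$ (i, j) * x j * cnj (x i)) =
     complex_of_real c * (\<Sum>i<n. \<Sum>j<n. A $$ (i, j) * x j * cnj (x i))" for x
    using assms(1) by (simp add: mult.assoc sum_distrib_left)
  moreover have "0 \<le> complex_of_real c" using assms(3) by (simp add: less_eq_complex_def)
  ultimately show ?thesis
    using assms psd_iff_sum[of A n] psd_iff_sum[of "complex_of_real c \<cdot>\<^sub>m A" n]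
    by (simp del: index_smult_mat)
qed

text \<open>For a fixed vector the form is affine in \<open>e\<close>, so this is closedness of the
  order under limits. As \<open>0 \<le> z\<close> for complex \<open>z\<close> includes that
  \<open>z\<close> is real, real and imaginary parts pass to the limit separately.\<close>

lemma psd_limit:
  assumes A: "A \<in> carrier_mat n n" and B: "B \<in> carrier_mat n n"
    and e: "\<And>e::real. e > 0 \<Longrightarrow> psd (A + complex_of_real e \<cdot>\<^sub>m B)"
  shows "psd A"
  unfolding psd_iff_sum[OF A]
proof
  fix x :: "nat \<Rightarrow> complex"
  let ?q = "\<lambda>A. \<Sum>i<n. \<Sum>j<n. A $$ (i, j) * x j * cnj (x i)"
  have *: "0 \<le> ?q A + complex_of_real e * ?q B" if "e > 0" for e
  proof -
    have "?q (A + complex_of_real e \<cdot>\<^sub>m B) = ?q A + complex_of_real e * ?q B"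
      using A B by (simp add: sum.distrib algebra_simps sum_distrib_left)
    moreover have "0 \<le> ?q (A + complex_of_real e \<cdot>\<^sub>m B)"
      using e[OF that] B psd_iff_sum[of "A + complex_of_real e \<cdot>\<^sub>m B" n]
      by (simp del: index_add_mat)
    ultimately show ?thesis by simp
  qed
  have lim: "((\<lambda>e. ?q A + complex_of_real e * ?q B) \<longlongrightarrow> ?q A + complex_of_real 0 * ?q B) (at_right 0)"
    by (intro tendsto_intros)
  have ev: "\<forall>\<^sub>F e in at_right 0. 0 \<le> ?q A + complex_of_real e * ?q B"
    using * by (auto simp: eventually_at_right_less intro: eventually_at_rightI[of 0 1])
  have "0 \<le> Re (?q A + complex_of_real 0 * ?q B)"
    by (rule tendsto_lowerbound[OF tendsto_Re[OF lim]])
       (use ev in \<open>auto simp: less_eq_complex_def elim: eventually_mono\<close>)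
  moreover have "0 = Im (?q A + complex_of_real 0 * ?q B)"
    by (rule tendsto_unique[OF _ _ tendsto_Im[OF lim]])
       (use ev in \<open>auto simp: less_eq_complex_def intro!: tendsto_eventually elim: eventually_mono\<close>)
  ultimately show "0 \<le> ?q A" by (simp add: less_eq_complex_def)
qed

section \<open>Entries of a positive semidefinite matrix\<close>

lemma psd_two_entries:
  assumes A: "A \<in> carrier_mat n n" and "psd A" and ij: "i < n" "j < n" "i \<noteq> j"
  shows "0 \<le> A $$ (i, i) * a * cnj a + A $$ (i, j) * b * cnj a +
    (A $$ (j, i) * a * cnj b + A $$ (j, j) * b * cnj b)"
proof -
  define x where "x = (\<lambda>k. if k = i then a else if k = j then b else 0)"
  have two: "(\<Sum>k<n. f k * g (x k)) = f i * g a + f j * g b" if "g 0 = 0"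
    for f g :: "_ \<Rightarrow> complex"
  proof -
    have "(\<Sum>k<n. f k * g (x k)) = (\<Sum>k\<in>{i, j}. f k * g (x k))"
      using ij that by (intro sum.mono_neutral_right) (auto simp: x_def)
    then show ?thesis using ij by (simp add: x_def)
  qed
  have "0 \<le> (\<Sum>i<n. (\<Sum>j<n. A $$ (i, j) * x j) * cnj (x i))"
    using assms(2) psd_iff_sum[OF A] by (simp add: sum_distrib_right)
  also have "(\<Sum>i<n. (\<Sum>j<n. A $$ (i, j) * x j) * cnj (x i)) =
      (\<Sum>j<n. A $$ (i, j) * x j) * cnj a + (\<Sum>k<n. A $$ (j, k) * x k) * cnj b"
    using two[of cnj "\<lambda>i. \<Sum>j<n. A $$ (i, j) * x j"] by simp
  also have "\<dots> = (A $$ (i, i) * a + A $$ (i, j) * b) * cnj a + (A $$ (j, i) * a + A $$ (j, j) * b) * cnj b"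
    using two[of "\<lambda>x. x" "\<lambda>k. A $$ (i, k)"] two[of "\<lambda>x. x" "\<lambda>k. A $$ (j, k)"] by simp
  finally show ?thesis by (simp add: algebra_simps)
qed

lemma psd_diagonal:
  assumes A: "A \<in> carrier_mat n n" and "psd A" and i: "i < n"
  shows "0 \<le> A $$ (i, i)"
proof -
  define x :: "nat \<Rightarrow> complex" where "x = (\<lambda>k. if k = i then 1 else 0)"
  have "0 \<le> (\<Sum>i<n. (\<Sum>j<n. A $$ (i, j) * x j) * cnj (x i))"
    using assms(2) psd_iff_sum[OF A] by (simp add: sum_distrib_right)
  also have "\<dots> = A $$ (i, i)"
    using i by (simp add: x_def if_distrib sum.If_cases cong: if_cong)
  finally show ?thesis .
qed

lemma psd_hermitian_entry:
  assumes "A \<in> carrier_mat n n" "psd A" "i < n" "j < n"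
  shows "A $$ (j, i) = cnj (A $$ (i, j))"
proof (cases "i = j")
  case True
  then show ?thesis using psd_diagonal[OF assms(1-3)]
    by (auto simp: less_eq_complex_def complex_eq_iff)
next
  case False
  note two = psd_two_entries[OF assms False]
  \<comment> \<open>Reality of the form at e_i + e_j determines the imaginary part of
    \<open>A $$ (j, i)\<close>, and reality at e_i + \<i> e_j its real part.\<close>
  show ?thesis
    using two[of 1 1] two[of 1 \<i>] psd_diagonal[OF assms(1-3)] psd_diagonal[OF assms(1,2,4)]
    by (auto simp: less_eq_complex_def complex_eq_iff)
qed

lemma psd_hermitian:
  assumes "psd A"
  shows "adj A = A"
proof -
  obtain n where A: "A \<in> carrier_mat n n" using assms by (metis carrier_matI psd_def)
  then show ?thesis by (intro eq_matI) (auto simp: psd_hermitian_entry[OF A assms, symmetric])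
qed

lemma psd_zero_diagonal:
  assumes A: "A \<in> carrier_mat n n" and psd: "psd A" and ij: "i < n" "j < n"
    and zero: "A $$ (i, i) = 0"
  shows "A $$ (i, j) = 0"
proof (cases "i = j")
  case False
  let ?z = "A $$ (i, j)" and ?d = "Re (A $$ (j, j))"
  have herm: "A $$ (j, i) = cnj ?z" by (rule psd_hermitian_entry[OF A psd ij])
  have jj: "A $$ (j, j) = complex_of_real ?d"
    using psd_diagonal[OF A psd ij(2)] by (auto simp: less_eq_complex_def complex_eq_iff)
  have "0 \<le> - 2 * r * (cmod ?z)\<^sup>2 + ?d" for r :: real
  proof -
    have "0 \<le> Re (A $$ (i, i) * (- r * ?z) * cnj (- r * ?z) + ?z * 1 * cnj (- r * ?z) +
      (A $$ (j, i) * (- r * ?z) * cnj 1 + A $$ (j, j) * 1 * cnj 1))"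
      using psd_two_entries[OF A psd ij False, of "- r * ?z" 1] by (auto simp: less_eq_complex_def)
    also have "\<dots> = - 2 * r * (cmod ?z)\<^sup>2 + ?d"
      unfolding zero herm cmod_power2 by (simp add: power2_eq_square algebra_simps)
    finally show ?thesis .
  qed
  \<comment> \<open>The form is affine in \<open>r\<close>, with negative slope unless
    \<open>?z\<close> vanishes; this \<open>r\<close> makes its value -1.\<close>
  from this[of "(?d + 1) / (2 * (cmod ?z)\<^sup>2)"] show ?thesis
    by (cases "?z = 0") (auto simp: field_simps)
qed (use zero in simp)

lemma psd_antisym:
  assumes A: "A \<in> carrier_mat n n" and "psd A" "psd (- A)"
  shows "A = 0\<^sub>m n n"
proof (intro eq_matI)
  have mA: "- A \<in> carrier_mat n n" using A by auto
  have diag: "A $$ (i, i) = 0" if "i < n" for i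
    using psd_diagonal[OF A assms(2) that] psd_diagonal[OF mA assms(3) that] A that by auto
  fix i j assume "i < dim_row (0\<^sub>m n n :: complex mat)" "j < dim_col (0\<^sub>m n n :: complex mat)"
  then show "A $$ (i, j) = 0\<^sub>m n n $$ (i, j)"
    using psd_zero_diagonal[OF A assms(2) _ _ diag] by simp
qed (use A in auto)

text \<open>The adjoint of a contraction is a contraction: D = I - \<open>adj A * A\<close> equals D
  \<open>adj D\<close> + \<open>adj A\<close> (I - \<open>A * adj A\<close>) A, a sum of two
  positive matrices.\<close>

lemma psd_coisometry:
  assumes "psd (1\<^sub>m n - A * adj A)" "A \<in> carrier_mat n m"
  shows "psd (1\<^sub>m m - adj A * A)"
proof -
  have [simp]: "dim_row A = n" "dim_col A = m" using assms(2) by auto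
  let ?D = "1\<^sub>m m - adj A * A"
  have eq: "?D * adj ?D + adj A * (1\<^sub>m n - A * adj A) * adj (adj A) = ?D"
    by (simp add: mat_algebra) (intro eq_matI; auto)
  have "psd (?D * adj ?D + adj A * (1\<^sub>m n - A * adj A) * adj (adj A))"
    by (rule psd_add[of _ m]) (use psd_gram psd_congruence[OF assms(1), of "adj A"] in auto)
  then show ?thesis unfolding eq .
qed
section \<open>Congruence diagonalisation\<close>

definition bordered :: "complex \<Rightarrow> complex mat \<Rightarrow> complex mat" where
  "bordered e B = mat (Suc (dim_row B)) (Suc (dim_col B)) (\<lambda>(i, j).
     if i = 0 then (if j = 0 then e else 0) else if j = 0 then 0 else B $$ (i - 1, j - 1))"

lemma bordered_carrier: "B \<in> carrier_mat n m \<Longrightarrow> bordered e B \<in> carrier_mat (Suc n) (Suc m)"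
  by (auto simp: bordered_def)

lemma bordered_mult:
  assumes "dim_col A = dim_row B"
  shows "bordered e A * bordered f B = bordered (e * f) (A * B)"
proof (intro eq_matI)
  fix i j assume "i < dim_row (bordered (e * f) (A * B))" "j < dim_col (bordered (e * f) (A * B))"
  then show "(bordered e A * bordered f B) $$ (i, j) = bordered (e * f) (A * B) $$ (i, j)"
    using assms
    by (cases i; cases j)
       (auto simp: bordered_def index_mult_sum sum.lessThan_Suc_shift simp del: index_mult_mat(1) sum.lessThan_Suc)
qed (auto simp: bordered_def)

lemma bordered_adj: "adj (bordered e B) = bordered (cnj e) (adj B)"
  by (intro eq_matI) (auto simp: bordered_def)

lemma bordered_one: "bordered 1 (1\<^sub>m n) = 1\<^sub>m (Suc n)"
  by (intro eq_matI) (auto simp: bordered_def)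

text \<open>The substitute for the spectral theorem. The 0/1 matrix \<open>E\<close> is a
  projection, so \<open>S * E\<close> is a factor of \<open>A\<close>, and degeneracy of
  \<open>A\<close> shows as a zero on the diagonal of \<open>E\<close>. The inverse \<open>T\<close>
  of \<open>S\<close> is carried along as data.\<close>

definition congruence_diagonalisable :: "nat \<Rightarrow> complex mat \<Rightarrow> bool" where
  "congruence_diagonalisable n A \<longleftrightarrow> (\<exists>S T E. S \<in> carrier_mat n n \<and> T \<in> carrier_mat n n \<and>
     E \<in> carrier_mat n n \<and> S * T = 1\<^sub>m n \<and> T * S = 1\<^sub>m n \<and> A = S * E * adj S \<and>
     (\<forall>i<n. \<forall>j<n. E $$ (i, j) = 0 \<or> i = j \<and> E $$ (i, j) = 1))"

lemma congruence_diagonalisableI: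
  assumes "S \<in> carrier_mat n n" "T \<in> carrier_mat n n" "E \<in> carrier_mat n n"
    "S * T = 1\<^sub>m n" "T * S = 1\<^sub>m n" "A = S * E * adj S"
    "\<forall>i<n. \<forall>j<n. E $$ (i, j) = 0 \<or> i = j \<and> E $$ (i, j) = 1"
  shows "congruence_diagonalisable n A"
  unfolding congruence_diagonalisable_def using assms
  by (intro exI[of _ S] exI[of _ T] exI[of _ E] conjI)

lemma congruence_diagonalisable_congruence:
  assumes A: "A \<in> carrier_mat n n" and LK: "L \<in> carrier_mat n n" "K \<in> carrier_mat n n"
    and inv: "L * K = 1\<^sub>m n" "K * L = 1\<^sub>m n" and diag: "congruence_diagonalisable n (K * A * adj K)"
  shows "congruence_diagonalisable n A"
proof -
  obtain S T E where c: "S \<in> carrier_mat n n" "T \<in> carrier_mat n n" "E \<in> carrier_mat n n"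
    and ST: "S * T = 1\<^sub>m n" "T * S = 1\<^sub>m n" and eq: "K * A * adj K = S * E * adj S"
    and E: "\<forall>i<n. \<forall>j<n. E $$ (i, j) = 0 \<or> i = j \<and> E $$ (i, j) = 1"
    using diag unfolding congruence_diagonalisable_def by blast
  have [simp]: "dim_row A = n" "dim_col A = n" "dim_row L = n" "dim_col L = n" "dim_row K = n"
    "dim_col K = n" "dim_row S = n" "dim_col S = n" "dim_row T = n" "dim_col T = n"
    "dim_row E = n" "dim_col E = n" using A LK c by auto
  have adj_inv: "adj K * adj L = 1\<^sub>m n" using inv(1) by (simp flip: adj_mult)
  have "L * S * (T * K) = 1\<^sub>m n"
    by (simp add: mat_assoc mult_cong_right[OF ST(1)] mat_units inv)
  moreover have "T * K * (L * S) = 1\<^sub>m n"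
    by (simp add: mat_assoc mult_cong_right[OF inv(2)] mat_units ST)
  moreover have "A = L * S * E * adj (L * S)"
  proof -
    have "L * S * E * adj (L * S) = L * (S * E * adj S) * adj L"
      by (simp add: adj_mult mat_assoc)
    also have "\<dots> = L * (K * A * adj K) * adj L" by (simp add: eq)
    also have "\<dots> = A"
      by (simp add: mat_assoc adj_inv mat_units mult_cong_right[OF inv(1)])
    finally show ?thesis by simp
  qed
  moreover have "L * S \<in> carrier_mat n n" "T * K \<in> carrier_mat n n" using c LK by auto
  ultimately show ?thesis using E c(3)
    by (intro congruence_diagonalisableI[of "L * S" _ "T * K" E])
qed

lemma congruence_diagonalisable_bordered:
  assumes "congruence_diagonalisable n A" "e = 0 \<or> e = 1"
  shows "congruence_diagonalisable (Suc n) (bordered e A)"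
proof -
  obtain S T E where c: "S \<in> carrier_mat n n" "T \<in> carrier_mat n n" "E \<in> carrier_mat n n"
    and ST: "S * T = 1\<^sub>m n" "T * S = 1\<^sub>m n" and eq: "A = S * E * adj S"
    and E: "\<forall>i<n. \<forall>j<n. E $$ (i, j) = 0 \<or> i = j \<and> E $$ (i, j) = 1"
    using assms(1) unfolding congruence_diagonalisable_def by blast
  have [simp]: "dim_row S = n" "dim_col S = n" "dim_row T = n" "dim_col T = n"
    "dim_row E = n" "dim_col E = n" using c by auto
  let ?E = "bordered e E"
  have "bordered 1 S * bordered 1 T = 1\<^sub>m (Suc n)" "bordered 1 T * bordered 1 S = 1\<^sub>m (Suc n)"
    by (simp_all add: bordered_mult ST bordered_one)
  moreover have "bordered e A = bordered 1 S * ?E * adj (bordered 1 S)"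
    by (simp add: bordered_mult bordered_adj eq)
  moreover have "\<forall>i<Suc n. \<forall>j<Suc n. ?E $$ (i, j) = 0 \<or> i = j \<and> ?E $$ (i, j) = 1"
  proof (intro allI impI)
    fix i j assume "i < Suc n" "j < Suc n"
    then show "?E $$ (i, j) = 0 \<or> i = j \<and> ?E $$ (i, j) = 1"
      using assms(2) E[rule_format, of "i - 1" "j - 1"]
      by (cases i; cases j) (auto simp: bordered_def)
  qed
  ultimately show ?thesis using bordered_carrier[OF c(1)] bordered_carrier[OF c(2)]
      bordered_carrier[OF c(3)]
    by (intro congruence_diagonalisableI[of "bordered 1 S" _ "bordered 1 T" ?E])
qed

lemma psd_lower_block:
  assumes "A \<in> carrier_mat (Suc n) (Suc n)" "psd A"
  shows "psd (mat n n (\<lambda>(i, j). A $$ (Suc i, Suc j)))"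
  unfolding psd_iff_sum[OF mat_carrier]
proof
  fix x :: "nat \<Rightarrow> complex"
  define y where "y i = (case i of 0 \<Rightarrow> 0 | Suc k \<Rightarrow> x k)" for i
  have "0 \<le> (\<Sum>i<Suc n. \<Sum>j<Suc n. A $$ (i, j) * y j * cnj (y i))"
    using assms psd_iff_sum by blast
  then show "0 \<le> (\<Sum>i<n. \<Sum>j<n. mat n n (\<lambda>(i, j). A $$ (Suc i, Suc j)) $$ (i, j) * x j * cnj (x i))"
    by (simp add: sum.lessThan_Suc_shift y_def del: sum.lessThan_Suc)
qed

lemma psd_congruence_diagonalisable:
  "A \<in> carrier_mat n n \<Longrightarrow> psd A \<Longrightarrow> congruence_diagonalisable n A"
proof (induction n arbitrary: A)
  case 0
  then have "A = 1\<^sub>m 0 * 1\<^sub>m 0 * adj (1\<^sub>m 0)" by (intro eq_matI) auto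
  then show ?case by (intro congruence_diagonalisableI[of "1\<^sub>m 0" _ "1\<^sub>m 0" "1\<^sub>m 0"]) simp_all
next
  case (Suc n)
  \<comment> \<open>Once the first column vanishes below a pivot 0 or 1, symmetry clears the first
    row as well, and the induction hypothesis applies to the remaining block.\<close>
  have bordered_case: "congruence_diagonalisable (Suc n) M"
    if M: "M \<in> carrier_mat (Suc n) (Suc n)" and psd: "psd M"
      and zero: "\<And>i. i < n \<Longrightarrow> M $$ (Suc i, 0) = 0" and e: "M $$ (0, 0) = 0 \<or> M $$ (0, 0) = 1" for M
  proof -
    let ?M = "mat n n (\<lambda>(i, j). M $$ (Suc i, Suc j))"
    have zero': "M $$ (0, Suc i) = 0" if "i < n" for i
      using psd_hermitian_entry[OF M psd, of "Suc i" 0] zero[OF that] that by simp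
    have eq: "M = bordered (M $$ (0, 0)) ?M"
    proof (intro eq_matI)
      fix i j assume "i < dim_row (bordered (M $$ (0, 0)) ?M)" "j < dim_col (bordered (M $$ (0, 0)) ?M)"
      then show "M $$ (i, j) = bordered (M $$ (0, 0)) ?M $$ (i, j)"
        using zero zero' by (cases i; cases j) (auto simp: bordered_def)
    qed (use M in \<open>auto simp: bordered_def\<close>)
    show ?thesis
      by (subst eq)
         (rule congruence_diagonalisable_bordered[OF Suc.IH[OF mat_carrier psd_lower_block[OF M psd]] e])
  qed
  let ?a = "A $$ (0, 0)"
  show ?case
  proof (cases "?a = 0")
    case True
    have "A $$ (Suc i, 0) = 0" if "i < n" for i
      using psd_hermitian_entry[OF Suc.prems, of 0 "Suc i"] that
        psd_zero_diagonal[OF Suc.prems _ _ True, of "Suc i"] by simp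
    then show ?thesis using True by (intro bordered_case Suc.prems) simp_all
  next
    case False
    define r where "r = sqrt (Re ?a)"
    have r: "?a = complex_of_real r * complex_of_real r" "r > 0"
      using False psd_diagonal[OF Suc.prems, of 0]
      by (auto simp: r_def less_eq_complex_def complex_eq_iff simp flip: of_real_mult)
    \<comment> \<open>One step of symmetric Gaussian elimination: \<open>K\<close> subtracts
      multiples of row 0 to clear column 0 and scales the pivot to 1; \<open>L\<close> is its
      inverse.\<close>
    define L where "L = mat (Suc n) (Suc n) (\<lambda>(i, j). if j = 0 then if i = 0 then complex_of_real r
      else A $$ (i, 0) / r else if i = j then 1 else 0)"
    define K where "K = mat (Suc n) (Suc n) (\<lambda>(i, j). if j = 0 then if i = 0 then 1 / complex_of_real r
      else - A $$ (i, 0) / ?a else if i = j then 1 else 0)"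
    have [simp]: "dim_row A = Suc n" "dim_col A = Suc n" "dim_row L = Suc n" "dim_col L = Suc n"
      "dim_row K = Suc n" "dim_col K = Suc n" using Suc.prems by (auto simp: L_def K_def)
    have delta: "(\<Sum>k<n. (if i = k then 1 else 0) * f k) = f i" if "i < n" for i and f :: "nat \<Rightarrow> complex"
    proof -
      have "(\<Sum>k<n. (if i = k then 1 else 0) * f k) = (\<Sum>k<n. if k = i then f k else 0)"
        by (intro sum.cong) auto
      then show ?thesis using that by simp
    qed
    have "L * K = 1\<^sub>m (Suc n)"
    proof (intro eq_matI)
      fix i j assume ij: "i < dim_row (1\<^sub>m (Suc n))" "j < dim_col (1\<^sub>m (Suc n))"
      show "(L * K) $$ (i, j) = 1\<^sub>m (Suc n) $$ (i, j)"
        using ij r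
        by (cases i; cases j)
           (auto simp: L_def K_def index_mult_sum sum.lessThan_Suc_shift sum_negf delta
             simp flip: sum_divide_distrib simp del: index_mult_mat(1) sum.lessThan_Suc)
    qed auto
    moreover have "K * L = 1\<^sub>m (Suc n)"
    proof (intro eq_matI)
      fix i j assume ij: "i < dim_row (1\<^sub>m (Suc n))" "j < dim_col (1\<^sub>m (Suc n))"
      show "(K * L) $$ (i, j) = 1\<^sub>m (Suc n) $$ (i, j)"
        using ij r
        by (cases i; cases j)
           (auto simp: L_def K_def index_mult_sum sum.lessThan_Suc_shift sum_negf delta
             simp flip: sum_divide_distrib simp del: index_mult_mat(1) sum.lessThan_Suc)
    qed auto
    moreover have "congruence_diagonalisable (Suc n) (K * A * adj K)"
    proof (rule bordered_case)
      \<comment> \<open>Row 0 of \<open>K\<close> is 1/r followed by zeros, so multiplication by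
        \<open>adj K\<close> only scales column 0.\<close>
      have entry: "(K * A * adj K) $$ (i, 0) = (K * A) $$ (i, 0) / r" if "i < Suc n" for i
        using that
        by (subst index_mult_sum)
           (auto simp: K_def sum.lessThan_Suc_shift simp del: index_mult_mat(1) sum.lessThan_Suc)
      show "(K * A * adj K) $$ (Suc i, 0) = 0" if "i < n" for i
        using that r False
        by (simp add: entry index_mult_sum sum.lessThan_Suc_shift del: index_mult_mat(1) sum.lessThan_Suc)
           (simp add: K_def sum_negf delta flip: sum_divide_distrib)
      show "(K * A * adj K) $$ (0, 0) = 0 \<or> (K * A * adj K) $$ (0, 0) = 1"
        using r
        by (simp add: entry index_mult_sum sum.lessThan_Suc_shift del: index_mult_mat(1) sum.lessThan_Suc)
           (simp add: K_def)
    qed (auto intro: psd_congruence Suc.prems)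
    ultimately show ?thesis
      using Suc.prems by (intro congruence_diagonalisable_congruence[of A _ L K]) auto
  qed
qed

section \<open>Factorisations of positive matrices and of equal Gram matrices\<close>

lemma diagonal_projection:
  assumes c: "E \<in> carrier_mat n n"
    and E: "\<forall>i<n. \<forall>j<n. E $$ (i, j) = 0 \<or> i = j \<and> E $$ (i, j) = 1"
  shows "adj E = E" "E * E = E"
proof -
  have [simp]: "dim_row E = n" "dim_col E = n" using c by auto
  show "adj E = E"
  proof (intro eq_matI)
    fix i j assume "i < dim_row E" "j < dim_col E"
    then show "adj E $$ (i, j) = E $$ (i, j)"
      using E[rule_format, of i j] E[rule_format, of j i] by (cases "i = j") auto
  qed auto
  show "E * E = E"
  proof (intro eq_matI)
    fix i j assume "i < dim_row E" "j < dim_col E"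
    then have ij: "i < n" "j < n" by auto
    have "(E * E) $$ (i, j) = (\<Sum>k<n. E $$ (i, k) * E $$ (k, j))"
      using ij by (subst index_mult_sum) auto
    also have "\<dots> = (\<Sum>k<n. if k = i then E $$ (i, i) * E $$ (i, j) else 0)"
    proof (intro sum.cong refl)
      fix k assume "k \<in> {..<n}"
      then show "E $$ (i, k) * E $$ (k, j) = (if k = i then E $$ (i, i) * E $$ (i, j) else 0)"
        using E[rule_format, of i k] ij by auto
    qed
    also have "\<dots> = E $$ (i, j)"
      using ij E[rule_format, of i j] E[rule_format, of i i] by (cases "i = j") auto
    finally show "(E * E) $$ (i, j) = E $$ (i, j)" .
  qed auto
qed

lemma psd_factor:
  assumes A: "A \<in> carrier_mat n n" and psd: "psd A"
  obtains B where "B \<in> carrier_mat n n" "A = B * adj B"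
proof -
  obtain S T E where c: "S \<in> carrier_mat n n" "E \<in> carrier_mat n n" and eq: "A = S * E * adj S"
    and E: "\<forall>i<n. \<forall>j<n. E $$ (i, j) = 0 \<or> i = j \<and> E $$ (i, j) = 1"
    using psd_congruence_diagonalisable[OF assms] unfolding congruence_diagonalisable_def by blast
  have [simp]: "dim_row S = n" "dim_col S = n" "dim_row E = n" "dim_col E = n" using c by auto
  have EE: "E * adj E = E" using diagonal_projection[OF c(2) E] by simp
  have "A = (S * E) * adj (S * E)"
    by (simp add: eq adj_mult mat_assoc mult_cong_right[OF EE])
  then show thesis using that[of "S * E"] c by auto
qed

lemma gram_zero:
  assumes "B * adj B = 0\<^sub>m n n" "B \<in> carrier_mat n m"
  shows "B = 0\<^sub>m n m"
proof (intro eq_matI)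
  have [simp]: "dim_row B = n" "dim_col B = m" using assms(2) by auto
  fix i j assume "i < dim_row (0\<^sub>m n m :: complex mat)" "j < dim_col (0\<^sub>m n m :: complex mat)"
  then have ij: "i < n" "j < m" by auto
  have "0 = (B * adj B) $$ (i, i)" using assms(1) ij by simp
  also have "\<dots> = (\<Sum>k<m. B $$ (i, k) * cnj (B $$ (i, k)))"
    using ij by (subst index_mult_sum) auto
  also have "\<dots> = complex_of_real (\<Sum>k<m. (cmod (B $$ (i, k)))\<^sup>2)"
    by (simp only: complex_norm_square of_real_sum)
  finally have "(\<Sum>k<m. (cmod (B $$ (i, k)))\<^sup>2) = 0" by (metis of_real_eq_0_iff)
  then have "\<forall>k<m. B $$ (i, k) = 0" by (subst (asm) sum_nonneg_eq_0_iff) auto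
  then show "B $$ (i, j) = 0\<^sub>m n m $$ (i, j)" using ij by simp
qed (use assms in auto)

text \<open>It remains to see that the 0/1 matrix \<open>E\<close> is the identity. If its i-th
  diagonal entry were 0, the matrix E - e T \<open>adj T\<close>, congruent to A - e, would have the
  i-th diagonal entry -e |row i of T|^2; this row would vanish, against
  \<open>T * S = 1\<^sub>m n\<close>.\<close>

lemma positive_definite_factor:
  assumes A: "A \<in> carrier_mat n n" and e: "e > 0"
    and psd: "psd (A - scalar_mat e n)"
  obtains S T where "S \<in> carrier_mat n n" "T \<in> carrier_mat n n" "S * T = 1\<^sub>m n" "T * S = 1\<^sub>m n"
    "A = S * adj S"
proof -
  have "A = (A - scalar_mat e n) + scalar_mat e n"
    using A by (intro eq_matI) auto
  then have "psd A"
    using A e psd psd_one psd_add[of _ n "scalar_mat e n"] psd_smult[of "1\<^sub>m n" n e]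
    by (metis less_imp_le minus_carrier_mat one_carrier_mat smult_carrier_mat)
  from psd_congruence_diagonalisable[OF A this]
  obtain S T E where c: "S \<in> carrier_mat n n" "T \<in> carrier_mat n n" "E \<in> carrier_mat n n"
    and ST: "S * T = 1\<^sub>m n" "T * S = 1\<^sub>m n" and eq: "A = S * E * adj S"
    and E: "\<forall>i<n. \<forall>j<n. E $$ (i, j) = 0 \<or> i = j \<and> E $$ (i, j) = 1"
    unfolding congruence_diagonalisable_def by blast
  have [simp]: "dim_row A = n" "dim_col A = n" "dim_row S = n" "dim_col S = n" "dim_row T = n"
    "dim_col T = n" "dim_row E = n" "dim_col E = n" using A c by auto
  have ST': "adj S * adj T = 1\<^sub>m n" using ST(2) by (simp flip: adj_mult)
  have "E $$ (i, i) \<noteq> 0" if i: "i < n" for i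
  proof
    assume zero: "E $$ (i, i) = 0"
    have "T * (A - scalar_mat e n) * adj T = E - complex_of_real e \<cdot>\<^sub>m (T * adj T)"
      by (simp add: eq mat_algebra ST' mult_cong_right[OF ST(2)])
    then have "psd (E - complex_of_real e \<cdot>\<^sub>m (T * adj T))"
      using psd_congruence[OF psd, of T] by simp
    moreover have "E - complex_of_real e \<cdot>\<^sub>m (T * adj T) \<in> carrier_mat n n"
      by (rule carrier_matI) simp_all
    ultimately have "0 \<le> (E - complex_of_real e \<cdot>\<^sub>m (T * adj T)) $$ (i, i)"
      using i psd_diagonal by blast
    then have "0 \<le> - (e * (T * adj T) $$ (i, i))"
      using i zero by (simp del: index_mult_mat(1))
    also have "(T * adj T) $$ (i, i) = complex_of_real (\<Sum>k<n. (cmod (T $$ (i, k)))\<^sup>2)"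
      using i by (subst index_mult_sum) (auto simp: complex_norm_square simp flip: of_real_power)
    finally have "e * (\<Sum>k<n. (cmod (T $$ (i, k)))\<^sup>2) \<le> 0" by (simp add: less_eq_complex_def)
    then have "(\<Sum>k<n. (cmod (T $$ (i, k)))\<^sup>2) = 0"
      using e by (simp add: mult_le_0_iff sum_nonneg antisym)
    then have "\<forall>k<n. T $$ (i, k) = 0" by (subst (asm) sum_nonneg_eq_0_iff) auto
    then have "(T * S) $$ (i, i) = 0" using i by (subst index_mult_sum) auto
    then show False using i ST(2) by simp
  qed
  then have "E = 1\<^sub>m n" using E by (intro eq_matI) force+
  then have "A = S * adj S" using eq by (simp add: mat_units)
  then show thesis using that c ST by blast
qed

text \<open>A factorisation lemma of Douglas type. Multiplication by T turns the common Gram matrix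
  into the projection E, so T U and T W are partial isometries with the same range. V is the second
  followed by the adjoint of the first, and G is the projection onto the kernel of T U, the part
  that V does not reach.\<close>

lemma equal_gram_factor:
  assumes UW: "U \<in> carrier_mat n p" "W \<in> carrier_mat n q" and gram: "U * adj U = W * adj W"
  obtains V G where "V \<in> carrier_mat p q" "G \<in> carrier_mat p p" "W = U * V"
    "V * adj V + G * adj G = 1\<^sub>m p"
proof -
  have "U * adj U \<in> carrier_mat n n" using UW by auto
  from psd_congruence_diagonalisable[OF this psd_gram]
  obtain S T E where c: "S \<in> carrier_mat n n" "T \<in> carrier_mat n n" "E \<in> carrier_mat n n"
    and ST: "S * T = 1\<^sub>m n" "T * S = 1\<^sub>m n" and eq: "U * adj U = S * E * adj S"
    and E: "\<forall>i<n. \<forall>j<n. E $$ (i, j) = 0 \<or> i = j \<and> E $$ (i, j) = 1"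
    unfolding congruence_diagonalisable_def by blast
  have [simp]: "dim_row U = n" "dim_col U = p" "dim_row W = n" "dim_col W = q" "dim_row S = n"
    "dim_col S = n" "dim_row T = n" "dim_col T = n" "dim_row E = n" "dim_col E = n"
    using UW c by auto
  have ST': "adj S * adj T = 1\<^sub>m n" using ST(2) by (simp flip: adj_mult)
  note adjE = diagonal_projection(1)[OF c(3) E] and EE = diagonal_projection(2)[OF c(3) E]
  \<comment> \<open>The Gram matrix of \<open>M - E * M\<close> is (I - E) E (I - E) = 0.\<close>
  have fix_E: "E * M = M" if M: "M \<in> carrier_mat n k" and MM: "M * adj M = E" for M k
  proof -
    have [simp]: "dim_row M = n" "dim_col M = k" using M by auto
    have "(M - E * M) * adj (M - E * M) = 0\<^sub>m n n"
      by (simp add: mat_algebra adjE mult_cong_right[OF MM] MM EE) (intro eq_matI; simp)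
    then have *: "M - E * M = 0\<^sub>m n k" by (rule gram_zero) auto
    show ?thesis
    proof (intro eq_matI)
      fix i j assume "i < dim_row M" "j < dim_col M"
      then show "(E * M) $$ (i, j) = M $$ (i, j)"
        using arg_cong[OF *, of "\<lambda>A. A $$ (i, j)"] by (simp del: index_mult_mat(1))
    qed auto
  qed
  define U' where "U' = T * U"
  define W' where "W' = T * W"
  have [simp]: "dim_row U' = n" "dim_col U' = p" "dim_row W' = n" "dim_col W' = q"
    by (auto simp: U'_def W'_def)
  have U'U': "U' * adj U' = E"
    by (simp add: U'_def mat_algebra mult_cong_right[OF eq] ST' mult_cong_right[OF ST(2)])
  have W'W': "W' * adj W' = E"
    by (simp add: W'_def mat_algebra mult_cong_right[OF gram[symmetric]] mult_cong_right[OF eq]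
        ST' mult_cong_right[OF ST(2)])
  have EU': "E * U' = U'" and EW': "E * W' = W'"
    by (rule fix_E[OF carrier_matI]; simp add: U'U' W'W')+
  have UU': "S * U' = U" and WW': "S * W' = W"
    by (simp_all add: U'_def W'_def mult_cong_right[OF ST(1)] mat_units)
  define V where "V = adj U' * W'"
  define G where "G = 1\<^sub>m p - adj U' * U'"
  have "U * V = S * (U' * adj U' * W')" by (simp add: V_def mat_assoc flip: UU')
  then have "W = U * V" by (simp add: U'U' EW' WW')
  moreover have "V * adj V + G * adj G = 1\<^sub>m p"
    by (simp add: V_def G_def mat_algebra mult_cong_right[OF W'W'] mult_cong_right[OF U'U'] EU' EW')
       (intro eq_matI; simp)
  moreover have "V \<in> carrier_mat p q" "G \<in> carrier_mat p p"
    by (rule carrier_matI; simp add: V_def G_def)+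
  ultimately show thesis using that by blast
qed

text \<open>A crude bound suffices: |A_ij x_j x_i| \<le> |A_ij| |x|^2, so the sum of the moduli of
  the entries dominates the form. The summand 1 only makes \<open>K\<close> positive.\<close>

lemma hermitian_bound:
  assumes A: "A \<in> carrier_mat n n" and herm: "adj A = A"
  obtains K :: real where "K > 0" "psd (scalar_mat K n - A)"
proof
  define K where "K = (\<Sum>i<n. \<Sum>j<n. cmod (A $$ (i, j))) + 1"
  show "K > 0" by (simp add: K_def add_nonneg_pos sum_nonneg)
  have entry: "cnj (A $$ (i, j)) = A $$ (j, i)" if "i < n" "j < n" for i j
    using index_adj[of j A i] herm A that by simp
  have C: "scalar_mat K n - A \<in> carrier_mat n n" using A by auto
  show "psd (scalar_mat K n - A)"
    unfolding psd_iff_sum[OF C]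
  proof
    fix x :: "nat \<Rightarrow> complex"
    define N where "N = (\<Sum>k<n. (cmod (x k))\<^sup>2)"
    define q where "q = (\<Sum>i<n. \<Sum>j<n. A $$ (i, j) * x j * cnj (x i))"
    have N: "N \<ge> 0" by (simp add: N_def sum_nonneg)
    have small: "(cmod (x i))\<^sup>2 \<le> N" if "i < n" for i
      using that member_le_sum[of i "{..<n}" "\<lambda>k. (cmod (x k))\<^sup>2"] by (simp add: N_def)
    have prod: "cmod (x j) * cmod (x i) \<le> N" if "i < n" "j < n" for i j
      using small[OF that(1)] small[OF that(2)] sum_squares_bound[of "cmod (x i)" "cmod (x j)"]
      by (simp add: algebra_simps)
    have "cmod q \<le> (\<Sum>i<n. \<Sum>j<n. cmod (A $$ (i, j)) * N)"
      unfolding q_def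
      by (intro sum_norm_le order_trans[OF norm_sum] sum_mono)
         (auto simp: norm_mult mult.assoc intro!: mult_left_mono prod)
    also have "\<dots> = (K - 1) * N" by (simp add: K_def sum_distrib_right)
    also have "\<dots> \<le> K * N" using N by (simp add: algebra_simps)
    finally have "Re q \<le> K * N" using complex_Re_le_cmod[of q] by linarith
    moreover have "cnj q = (\<Sum>i<n. \<Sum>j<n. A $$ (j, i) * cnj (x j) * x i)"
      by (simp add: q_def entry)
    then have "cnj q = q"
      unfolding q_def by (subst sum.swap) (simp add: mult_ac)
    then have "Im q = 0" by (simp add: complex_eq_iff)
    moreover have "(\<Sum>i<n. \<Sum>j<n. (scalar_mat K n - A) $$ (i, j) * x j * cnj (x i)) =
        complex_of_real (K * N) - q"
    proof -
      have "(\<Sum>i<n. \<Sum>j<n. (scalar_mat K n - A) $$ (i, j) * x j * cnj (x i)) =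
        (\<Sum>i<n. \<Sum>j<n. (if j = i then K * (x i * cnj (x i)) else 0) - A $$ (i, j) * x j * cnj (x i))"
        using A by (intro sum.cong) (auto simp: algebra_simps)
      also have "\<dots> = (\<Sum>i<n. K * (x i * cnj (x i))) - q"
        by (simp add: sum_subtractf q_def)
      also have "(\<Sum>i<n. K * (x i * cnj (x i))) = complex_of_real (K * N)"
        unfolding N_def of_real_mult of_real_sum by (simp add: sum_distrib_left complex_norm_square del: of_real_power)
      finally show ?thesis .
    qed
    ultimately show "0 \<le> (\<Sum>i<n. \<Sum>j<n. (scalar_mat K n - A) $$ (i, j) * x j * cnj (x i))"
      by (simp add: less_eq_complex_def)
  qed
qed
section \<open>Operator norm\<close>

lemma l2_norm_nonneg: "0 \<le> l2_norm v"
  by (simp add: l2_norm_def sum_nonneg)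

lemma l2_norm_square: "complex_of_real ((l2_norm v)\<^sup>2) = v \<bullet>c v"
  by (simp add: l2_norm_def sum_nonneg scalar_prod_def atLeast0LessThan complex_norm_square
      del: of_real_power)

lemma l2_norm_smult: "l2_norm (a \<cdot>\<^sub>v v) = cmod a * l2_norm v"
  by (simp add: l2_norm_def norm_mult power_mult_distrib real_sqrt_mult flip: sum_distrib_left)

text \<open>The form of the matrix on the left at \<open>v\<close> is c^2 |v|^2 - |A v|^2.\<close>

lemma psd_bound_iff:
  assumes A: "A \<in> carrier_mat n m" and c: "c \<ge> 0"
  shows "psd (scalar_mat (c\<^sup>2) m - adj A * A) \<longleftrightarrow>
    (\<forall>v\<in>carrier_vec m. l2_norm (A *\<^sub>v v) \<le> c * l2_norm v)"
proof -
  let ?k = "complex_of_real (c\<^sup>2)"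
  have form: "((?k \<cdot>\<^sub>m 1\<^sub>m m - adj A * A) *\<^sub>v v) \<bullet>c v =
      complex_of_real ((c * l2_norm v)\<^sup>2 - (l2_norm (A *\<^sub>v v))\<^sup>2)" if v: "v \<in> carrier_vec m" for v
  proof -
    have Av: "A *\<^sub>v v \<in> carrier_vec n" by (rule mult_mat_vec_carrier[OF A v])
    have one: "(?k \<cdot>\<^sub>m 1\<^sub>m m) *\<^sub>v v = ?k \<cdot>\<^sub>v v"
      using v by (intro eq_vecI) (simp_all add: smult_scalar_prod_distrib[of _ m])
    have AA: "adj A * A *\<^sub>v v = adj A *\<^sub>v (A *\<^sub>v v)"
      by (rule assoc_mult_mat_vec[OF adj_carrier[OF A] A v])
    have "(?k \<cdot>\<^sub>m 1\<^sub>m m - adj A * A) *\<^sub>v v = ?k \<cdot>\<^sub>v v - adj A *\<^sub>v (A *\<^sub>v v)"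
      unfolding one[symmetric] AA[symmetric]
      by (rule minus_mult_distrib_mat_vec[OF _ mult_carrier_mat[OF adj_carrier[OF A] A] v]) simp
    then have "((?k \<cdot>\<^sub>m 1\<^sub>m m - adj A * A) *\<^sub>v v) \<bullet>c v = (?k \<cdot>\<^sub>v v) \<bullet>c v - (adj A *\<^sub>v (A *\<^sub>v v)) \<bullet>c v"
      using v mult_mat_vec_carrier[OF adj_carrier[OF A] Av]
      by (simp add: minus_scalar_prod_distrib[of _ m])
    also have "(adj A *\<^sub>v (A *\<^sub>v v)) \<bullet>c v = (A *\<^sub>v v) \<bullet>c (A *\<^sub>v v)"
      using cscalar_mult_adj[of "A *\<^sub>v v" "adj A" v] Av v A by simp
    also have "(?k \<cdot>\<^sub>v v) \<bullet>c v = ?k * (v \<bullet>c v)"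
      using v by simp
    finally show ?thesis by (simp only: l2_norm_square[symmetric] of_real_diff of_real_mult power_mult_distrib)
  qed
  have "psd (?k \<cdot>\<^sub>m 1\<^sub>m m - adj A * A) \<longleftrightarrow>
      (\<forall>v\<in>carrier_vec m. (l2_norm (A *\<^sub>v v))\<^sup>2 \<le> (c * l2_norm v)\<^sup>2)"
    using A by (auto simp: psd_def form less_eq_complex_def simp del: of_real_power)
  also have "\<dots> \<longleftrightarrow> (\<forall>v\<in>carrier_vec m. l2_norm (A *\<^sub>v v) \<le> c * l2_norm v)"
    using c l2_norm_nonneg by (auto simp: abs_le_square_iff[symmetric])
  finally show ?thesis .
qed

text \<open>\<open>op_norm\<close> is a supremum of reals and can be estimated only once the set is
  known to be bounded; this comes from \<open>hermitian_bound\<close> for \<open>adj A * A\<close>.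
  The bound on the unit ball extends to all vectors by scaling.\<close>

lemma op_norm_le_iff:
  assumes A: "A \<in> carrier_mat n m" and c: "c \<ge> 0"
  shows "op_norm A \<le> c \<longleftrightarrow> psd (scalar_mat (c\<^sup>2) m - adj A * A)"
proof -
  let ?B = "{v \<in> carrier_vec m. l2_norm v \<le> 1}"
  have "adj A * A \<in> carrier_mat m m" "adj (adj A * A) = adj A * A"
    using A by (auto simp: adj_mult)
  then obtain K where K: "K > 0" "psd (scalar_mat K m - adj A * A)"
    by (rule hermitian_bound)
  then have "l2_norm (A *\<^sub>v v) \<le> sqrt K * l2_norm v" if "v \<in> carrier_vec m" for v
    using psd_bound_iff[OF A, of "sqrt K"] that by simp
  then have "l2_norm (A *\<^sub>v v) \<le> sqrt K" if "v \<in> ?B" for v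
    using that K(1) mult_left_mono[of "l2_norm v" 1 "sqrt K"] by (fastforce intro: order_trans)
  then have bdd: "bdd_above ((\<lambda>v. l2_norm (A *\<^sub>v v)) ` ?B)" by (auto intro!: bdd_aboveI)
  have "0\<^sub>v m \<in> ?B" by (simp add: l2_norm_def)
  then have "op_norm A \<le> c \<longleftrightarrow> (\<forall>v\<in>?B. l2_norm (A *\<^sub>v v) \<le> c)"
    using A bdd unfolding op_norm_def by (subst cSUP_le_iff) (blast, auto)
  also have "\<dots> \<longleftrightarrow> (\<forall>v\<in>carrier_vec m. l2_norm (A *\<^sub>v v) \<le> c * l2_norm v)"
  proof (intro iffI ballI)
    fix v :: "complex vec" assume *: "\<forall>v\<in>?B. l2_norm (A *\<^sub>v v) \<le> c" and v: "v \<in> carrier_vec m"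
    show "l2_norm (A *\<^sub>v v) \<le> c * l2_norm v"
    proof (cases "l2_norm v = 0")
      case True
      then have "v \<bullet>c v = 0" using l2_norm_square[of v] by simp
      then have "v = 0\<^sub>v m" using v conjugate_square_eq_0_vec by blast
      moreover have "A *\<^sub>v 0\<^sub>v m = 0\<^sub>v n" using A by (intro eq_vecI) auto
      ultimately show ?thesis by (simp add: l2_norm_def)
    next
      case False
      let ?r = "l2_norm v"
      have r: "?r > 0" using False l2_norm_nonneg[of v] by linarith
      have "complex_of_real (1 / ?r) \<cdot>\<^sub>v v \<in> ?B" using r v by (simp add: l2_norm_smult norm_divide)
      then have "l2_norm (A *\<^sub>v (complex_of_real (1 / ?r) \<cdot>\<^sub>v v)) \<le> c" using * by blast
      also have "A *\<^sub>v (complex_of_real (1 / ?r) \<cdot>\<^sub>v v) = complex_of_real (1 / ?r) \<cdot>\<^sub>v (A *\<^sub>v v)"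
        by (rule mult_mat_vec[OF A v])
      finally show ?thesis using r by (simp add: l2_norm_smult norm_divide field_simps)
    qed
  next
    fix v :: "complex vec" assume "\<forall>v\<in>carrier_vec m. l2_norm (A *\<^sub>v v) \<le> c * l2_norm v" and v: "v \<in> ?B"
    then have "l2_norm (A *\<^sub>v v) \<le> c * l2_norm v" by blast
    also have "\<dots> \<le> c" using v c mult_left_mono[of "l2_norm v" 1 c] by simp
    finally show "l2_norm (A *\<^sub>v v) \<le> c" .
  qed
  finally show ?thesis using psd_bound_iff[OF A c] by simp
qed

section \<open>Kronecker products\<close>

lemma dim_kron [simp]:
  "dim_row (kron A B) = dim_row A * dim_row B" "dim_col (kron A B) = dim_col A * dim_col B"
  by (simp_all add: kron_def)

lemma index_kron [simp]:
  "i < dim_row A * dim_row B \<Longrightarrow> j < dim_col A * dim_col B \<Longrightarrow>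
    kron A B $$ (i, j) = A $$ (i div dim_row B, j div dim_col B) * B $$ (i mod dim_row B, j mod dim_col B)"
  by (simp add: kron_def)

lemma kron_carrier [simp]:
  "A \<in> carrier_mat a b \<Longrightarrow> B \<in> carrier_mat c d \<Longrightarrow> kron A B \<in> carrier_mat (a * c) (b * d)"
  by (intro carrier_matI) auto

lemma digit_bounds:
  assumes "i < a * (b::nat)"
  shows "i div b < a" "i mod b < b"
  using assms by (simp_all add: less_mult_imp_div_less) (cases b; simp)

lemma digits_less: "i < a \<Longrightarrow> j < b \<Longrightarrow> i * b + j < a * (b::nat)"
proof -
  assume "i < a" "j < b"
  then have "i * b + j < Suc i * b" "Suc i * b \<le> a * b" by (simp, intro mult_right_mono) auto
  then show ?thesis by linarith
qed

text \<open>Indices of a tensor product are two-digit numbers. Read in either direction, this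
  equation carries all the Kronecker computations below.\<close>

lemma sum_digits:
  fixes f :: "nat \<Rightarrow> nat \<Rightarrow> 'a::comm_monoid_add"
  shows "(\<Sum>k<a * b. f (k div b) (k mod b)) = (\<Sum>i<a. \<Sum>j<b. f i j)"
proof -
  have "(\<Sum>k<a * b. f (k div b) (k mod b)) = (\<Sum>(i, j)\<in>{..<a} \<times> {..<b}. f i j)"
    by (rule sum.reindex_bij_witness[of _ "\<lambda>(i, j). i * b + j" "\<lambda>k. (k div b, k mod b)"])
       (auto simp: digit_bounds digits_less)
  then show ?thesis by (simp add: sum.cartesian_product)
qed

lemma kron_mult:
  assumes "dim_col A = dim_row C" "dim_col B = dim_row D"
  shows "kron A B * kron C D = kron (A * C) (B * D)"
proof (intro eq_matI)
  fix i j assume "i < dim_row (kron (A * C) (B * D))" "j < dim_col (kron (A * C) (B * D))"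
  then have i: "i < dim_row A * dim_row B" and j: "j < dim_col C * dim_col D" by auto
  have "(kron A B * kron C D) $$ (i, j) =
      (\<Sum>k<dim_row C * dim_row D. A $$ (i div dim_row B, k div dim_row D) * C $$ (k div dim_row D, j div dim_col D) *
         (B $$ (i mod dim_row B, k mod dim_row D) * D $$ (k mod dim_row D, j mod dim_col D)))"
    using i j assms by (subst index_mult_sum) (auto intro!: sum.cong)
  also have "\<dots> = (\<Sum>p<dim_row C. \<Sum>q<dim_row D. A $$ (i div dim_row B, p) * C $$ (p, j div dim_col D) *
         (B $$ (i mod dim_row B, q) * D $$ (q, j mod dim_col D)))"
    by (rule sum_digits)
  also have "\<dots> = (A * C) $$ (i div dim_row B, j div dim_col D) * (B * D) $$ (i mod dim_row B, j mod dim_col D)"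
    using digit_bounds[OF i] digit_bounds[OF j] assms
    by (simp only: index_mult_sum sum_product)
  also have "\<dots> = kron (A * C) (B * D) $$ (i, j)" using i j by simp
  finally show "(kron A B * kron C D) $$ (i, j) = kron (A * C) (B * D) $$ (i, j)" .
qed (use assms in auto)

lemma kron_assoc: "kron (kron A B) C = kron A (kron B C)"
proof -
  have digits: "i div (b * c) = i div c div b" "i mod (b * c) div c = i div c mod b"
    "i mod (b * c) mod c = i mod c" if "i < a * (b * c)" for i a b c :: nat
  proof -
    have c: "c > 0" using that by (intro gr0I) auto
    show "i div (b * c) = i div c div b" by (metis div_mult2_eq mult.commute)
    have "i mod (b * c) = c * (i div c mod b) + i mod c"
      using mod_mult2_eq[of i c b] by (simp only: mult.commute)
    then show "i mod (b * c) div c = i div c mod b" "i mod (b * c) mod c = i mod c"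
      using c by simp_all
  qed
  show ?thesis
  proof (intro eq_matI)
    fix i j assume "i < dim_row (kron A (kron B C))" "j < dim_col (kron A (kron B C))"
    then have i: "i < dim_row A * (dim_row B * dim_row C)" and j: "j < dim_col A * (dim_col B * dim_col C)"
      by auto
    then have i': "i < dim_row A * dim_row B * dim_row C" and j': "j < dim_col A * dim_col B * dim_col C"
      by (simp_all add: mult.assoc)
    show "kron (kron A B) C $$ (i, j) = kron A (kron B C) $$ (i, j)"
      using i j i' j' digit_bounds[OF i] digit_bounds[OF j] digit_bounds[OF i'] digit_bounds[OF j']
      by (simp add: digits[OF i] digits[OF j] mult.assoc)
  qed (auto simp: mult.assoc)
qed

lemma kron_adj: "adj (kron A B) = kron (adj A) (adj B)"
  by (intro eq_matI) (auto simp: digit_bounds)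

lemma kron_one: "kron (1\<^sub>m a) (1\<^sub>m b) = 1\<^sub>m (a * b)"
proof (intro eq_matI)
  fix i j assume "i < dim_row (1\<^sub>m (a * b))" "j < dim_col (1\<^sub>m (a * b))"
  then have ij: "i < a * b" "j < a * b" by auto
  have "i = j \<longleftrightarrow> i div b = j div b \<and> i mod b = j mod b" by (metis div_mult_mod_eq)
  then show "kron (1\<^sub>m a) (1\<^sub>m b) $$ (i, j) = 1\<^sub>m (a * b) $$ (i, j)"
    using ij digit_bounds[OF ij(1)] digit_bounds[OF ij(2)] by simp
qed auto

lemma kron_one_left: "kron (1\<^sub>m 1) A = A"
  by (intro eq_matI) (auto simp: digit_bounds)

lemma kron_add:
  assumes "dim_row A = dim_row B" "dim_col A = dim_col B"
  shows "kron (A + B) C = kron A C + kron B C" "kron C (A + B) = kron C A + kron C B"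
  using assms by (intro eq_matI; auto simp: digit_bounds distrib_left distrib_right left_diff_distrib right_diff_distrib)+

lemma kron_minus:
  assumes "dim_row A = dim_row B" "dim_col A = dim_col B"
  shows "kron (A - B) C = kron A C - kron B C" "kron C (A - B) = kron C A - kron C B"
  using assms by (intro eq_matI; auto simp: digit_bounds distrib_left distrib_right left_diff_distrib right_diff_distrib)+

lemma kron_smult: "kron (k \<cdot>\<^sub>m A) B = k \<cdot>\<^sub>m kron A B" "kron A (k \<cdot>\<^sub>m B) = k \<cdot>\<^sub>m kron A B"
  by (intro eq_matI; auto simp: digit_bounds)+

lemma kron_zero: "kron A (0\<^sub>m n m) = 0\<^sub>m (dim_row A * n) (dim_col A * m)"
  by (intro eq_matI) (auto simp: digit_bounds)

lemma psd_kron_one: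
  assumes "A \<in> carrier_mat n n" "psd A"
  shows "psd (kron A (1\<^sub>m k))" "psd (kron (1\<^sub>m k) A)"
proof -
  obtain B where B: "B \<in> carrier_mat n n" "A = B * adj B" using psd_factor[OF assms] by blast
  then have "kron A (1\<^sub>m k) = kron B (1\<^sub>m k) * adj (kron B (1\<^sub>m k))"
    "kron (1\<^sub>m k) A = kron (1\<^sub>m k) B * adj (kron (1\<^sub>m k) B)"
    by (simp_all add: kron_adj kron_mult mat_units)
  then show "psd (kron A (1\<^sub>m k))" "psd (kron (1\<^sub>m k) A)" by (simp_all add: psd_gram)
qed
section \<open>The row ball\<close>

lemma mat_list_sum_carrier:
  "set As \<subseteq> carrier_mat nr nc \<Longrightarrow> mat_list_sum nr nc As \<in> carrier_mat nr nc"
  by (induction As) (auto simp: mat_list_sum_def)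

lemma index_mat_list_sum:
  assumes "set As \<subseteq> carrier_mat nr nc" "i < nr" "j < nc"
  shows "mat_list_sum nr nc As $$ (i, j) = (\<Sum>k<length As. (As ! k) $$ (i, j))"
  using assms
proof (induction As)
  case (Cons A As)
  have "mat_list_sum nr nc (A # As) = A + mat_list_sum nr nc As" by (simp add: mat_list_sum_def)
  then show ?case using Cons mat_list_sum_carrier[of As nr nc]
    by (simp add: sum.lessThan_Suc_shift del: sum.lessThan_Suc)
qed (simp add: mat_list_sum_def)

text \<open>The row \<open>[Z\<^sub>1 \<dots> Z\<^sub>d]\<close> with its columns ordered so that it maps \<open>\<complex>\<^sup>m \<otimes> \<complex>\<^sup>d\<close> to
  \<open>\<complex>\<^sup>m\<close>. Hence \<open>\<Sum> Z\<^sub>i Q Z\<^sub>i\<^sup>*\<close> is the product of the row, \<open>Q \<otimes> I\<^sub>d\<close> and the adjoint of the row.\<close>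

definition row_matrix :: "nat \<Rightarrow> nat \<Rightarrow> complex mat list \<Rightarrow> complex mat" where
  "row_matrix d m Z = mat m (m * d) (\<lambda>(a, k). (Z ! (k mod d)) $$ (a, k div d))"

text \<open>The same row with its columns in the order of \<open>\<complex>\<^sup>d \<otimes> \<complex>\<^sup>m\<close>.\<close>

definition row_matrix_swapped :: "nat \<Rightarrow> nat \<Rightarrow> complex mat list \<Rightarrow> complex mat" where
  "row_matrix_swapped d m Z = mat m (d * m) (\<lambda>(a, k). (Z ! (k div m)) $$ (a, k mod m))"

lemma dim_row_matrix [simp]:
  "dim_row (row_matrix d m Z) = m" "dim_col (row_matrix d m Z) = m * d"
  "dim_row (row_matrix_swapped d m Z) = m" "dim_col (row_matrix_swapped d m Z) = d * m"
  by (simp_all add: row_matrix_def row_matrix_swapped_def)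

lemma index_row_matrix [simp]:
  "i < m \<Longrightarrow> p < m * d \<Longrightarrow> row_matrix d m Z $$ (i, p) = (Z ! (p mod d)) $$ (i, p div d)"
  "i < m \<Longrightarrow> q < d * m \<Longrightarrow> row_matrix_swapped d m Z $$ (i, q) = (Z ! (q div m)) $$ (i, q mod m)"
  by (simp_all add: row_matrix_def row_matrix_swapped_def)

lemma sum_delta_mult:
  fixes f :: "nat \<Rightarrow> complex"
  assumes "i < d"
  shows "(\<Sum>j<d. (if i = j then 1 else 0) * f j) = f i"
proof -
  have "(\<Sum>j<d. (if i = j then 1 else 0) * f j) = (\<Sum>j<d. if j = i then f j else 0)"
    by (intro sum.cong) auto
  then show ?thesis using assms by simp
qed

text \<open>The right-hand side is an entry of \<Sum> Z_k Q \<open>adj Z_k\<close>. It is kept as a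
  triple sum because the Stein equations are later compared entry by entry with the equations of the
  inverse.\<close>

lemma row_matrix_conj:
  assumes Q: "Q \<in> carrier_mat m m" and ij: "i < m" "j < m"
  shows "(row_matrix d m Z * kron Q (1\<^sub>m d) * adj (row_matrix d m Z)) $$ (i, j) =
    (\<Sum>k<d. \<Sum>a<m. \<Sum>b<m. (Z ! k) $$ (i, a) * Q $$ (a, b) * cnj ((Z ! k) $$ (j, b)))"
proof -
  have [simp]: "dim_row Q = m" "dim_col Q = m" using Q by auto
  have left: "(row_matrix d m Z * kron Q (1\<^sub>m d)) $$ (i, p) = (\<Sum>a<m. (Z ! (p mod d)) $$ (i, a) * Q $$ (a, p div d))"
    if p: "p < m * d" for p
  proof -
    have "(row_matrix d m Z * kron Q (1\<^sub>m d)) $$ (i, p) =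
        (\<Sum>q<m * d. (Z ! (q mod d)) $$ (i, q div d) * (Q $$ (q div d, p div d) * (if q mod d = p mod d then 1 else 0)))"
      using ij p by (subst index_mult_sum) (auto simp: digit_bounds)
    also have "\<dots> = (\<Sum>a<m. \<Sum>k<d. (Z ! k) $$ (i, a) * (Q $$ (a, p div d) * (if k = p mod d then 1 else 0)))"
      by (rule sum_digits)
    also have "\<dots> = (\<Sum>a<m. \<Sum>k<d. (if p mod d = k then 1 else 0) * ((Z ! k) $$ (i, a) * Q $$ (a, p div d)))"
      by (intro sum.cong) auto
    also have "\<dots> = (\<Sum>a<m. (Z ! (p mod d)) $$ (i, a) * Q $$ (a, p div d))"
      using digit_bounds[OF p] by (simp add: sum_delta_mult)
    finally show ?thesis .
  qed
  have "(row_matrix d m Z * kron Q (1\<^sub>m d) * adj (row_matrix d m Z)) $$ (i, j) =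
      (\<Sum>p<m * d. (\<Sum>a<m. (Z ! (p mod d)) $$ (i, a) * Q $$ (a, p div d)) * cnj ((Z ! (p mod d)) $$ (j, p div d)))"
    using ij by (subst index_mult_sum) (auto simp: left simp del: index_mult_mat(1))
  also have "\<dots> = (\<Sum>b<m. \<Sum>k<d. (\<Sum>a<m. (Z ! k) $$ (i, a) * Q $$ (a, b)) * cnj ((Z ! k) $$ (j, b)))"
    by (rule sum_digits)
  also have "\<dots> = (\<Sum>k<d. \<Sum>b<m. \<Sum>a<m. (Z ! k) $$ (i, a) * Q $$ (a, b) * cnj ((Z ! k) $$ (j, b)))"
    by (subst sum.swap) (simp add: sum_distrib_right)
  also have "\<dots> = (\<Sum>k<d. \<Sum>a<m. \<Sum>b<m. (Z ! k) $$ (i, a) * Q $$ (a, b) * cnj ((Z ! k) $$ (j, b)))"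
    by (rule sum.cong[OF refl], rule sum.swap)
  finally show ?thesis .
qed

lemma row_matrix_swapped_conj:
  assumes Q: "Q \<in> carrier_mat m m" and ij: "i < m" "j < m"
  shows "(row_matrix_swapped d m Z * kron (1\<^sub>m d) Q * adj (row_matrix_swapped d m Z)) $$ (i, j) =
    (\<Sum>k<d. \<Sum>a<m. \<Sum>b<m. (Z ! k) $$ (i, a) * Q $$ (a, b) * cnj ((Z ! k) $$ (j, b)))"
proof -
  have [simp]: "dim_row Q = m" "dim_col Q = m" using Q by auto
  have left: "(row_matrix_swapped d m Z * kron (1\<^sub>m d) Q) $$ (i, p) = (\<Sum>a<m. (Z ! (p div m)) $$ (i, a) * Q $$ (a, p mod m))"
    if p: "p < d * m" for p
  proof -
    have "(row_matrix_swapped d m Z * kron (1\<^sub>m d) Q) $$ (i, p) =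
        (\<Sum>q<d * m. (Z ! (q div m)) $$ (i, q mod m) * ((if q div m = p div m then 1 else 0) * Q $$ (q mod m, p mod m)))"
      using ij p by (subst index_mult_sum) (auto simp: digit_bounds)
    also have "\<dots> = (\<Sum>k<d. \<Sum>a<m. (Z ! k) $$ (i, a) * ((if k = p div m then 1 else 0) * Q $$ (a, p mod m)))"
      by (rule sum_digits)
    also have "\<dots> = (\<Sum>k<d. (if p div m = k then 1 else 0) * (\<Sum>a<m. (Z ! k) $$ (i, a) * Q $$ (a, p mod m)))"
      by (intro sum.cong) (auto simp: sum_distrib_left)
    also have "\<dots> = (\<Sum>a<m. (Z ! (p div m)) $$ (i, a) * Q $$ (a, p mod m))"
      using digit_bounds[OF p] by (simp add: sum_delta_mult)
    finally show ?thesis .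
  qed
  have "(row_matrix_swapped d m Z * kron (1\<^sub>m d) Q * adj (row_matrix_swapped d m Z)) $$ (i, j) =
      (\<Sum>p<d * m. (\<Sum>a<m. (Z ! (p div m)) $$ (i, a) * Q $$ (a, p mod m)) * cnj ((Z ! (p div m)) $$ (j, p mod m)))"
    using ij by (subst index_mult_sum) (auto simp: left simp del: index_mult_mat(1))
  also have "\<dots> = (\<Sum>k<d. \<Sum>b<m. (\<Sum>a<m. (Z ! k) $$ (i, a) * Q $$ (a, b)) * cnj ((Z ! k) $$ (j, b)))"
    by (rule sum_digits)
  also have "\<dots> = (\<Sum>k<d. \<Sum>a<m. \<Sum>b<m. (Z ! k) $$ (i, a) * Q $$ (a, b) * cnj ((Z ! k) $$ (j, b)))"
    by (simp add: sum_distrib_right, rule sum.cong[OF refl], rule sum.swap)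
  finally show ?thesis .
qed

lemma row_matrix_gram:
  assumes "length Z = d" "set Z \<subseteq> carrier_mat m m"
  shows "mat_list_sum m m (map (\<lambda>A. A * adj A) Z) = row_matrix d m Z * adj (row_matrix d m Z)"
proof (intro eq_matI)
  have c: "set (map (\<lambda>A. A * adj A) Z) \<subseteq> carrier_mat m m" using assms(2) by auto
  have "mat_list_sum m m (map (\<lambda>A. A * adj A) Z) \<in> carrier_mat m m" by (rule mat_list_sum_carrier[OF c])
  then show "dim_row (mat_list_sum m m (map (\<lambda>A. A * adj A) Z)) = dim_row (row_matrix d m Z * adj (row_matrix d m Z))"
    "dim_col (mat_list_sum m m (map (\<lambda>A. A * adj A) Z)) = dim_col (row_matrix d m Z * adj (row_matrix d m Z))"
    by auto
  fix i j assume "i < dim_row (row_matrix d m Z * adj (row_matrix d m Z))"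
    "j < dim_col (row_matrix d m Z * adj (row_matrix d m Z))"
  then have ij: "i < m" "j < m" by auto
  have Zk: "Z ! k \<in> carrier_mat m m" if "k < d" for k using assms that nth_mem by blast
  have "(row_matrix d m Z * adj (row_matrix d m Z)) $$ (i, j) =
      (\<Sum>k<d. \<Sum>a<m. \<Sum>b<m. (Z ! k) $$ (i, a) * 1\<^sub>m m $$ (a, b) * cnj ((Z ! k) $$ (j, b)))"
    using row_matrix_conj[of "1\<^sub>m m" m i j d Z] ij by (simp add: kron_one mat_units)
  also have "\<dots> = (\<Sum>k<d. \<Sum>a<m. \<Sum>b<m. (if a = b then 1 else 0) * ((Z ! k) $$ (i, a) * cnj ((Z ! k) $$ (j, b))))"
    by (intro sum.cong) auto
  also have "\<dots> = (\<Sum>k<d. \<Sum>a<m. (Z ! k) $$ (i, a) * cnj ((Z ! k) $$ (j, a)))"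
    by (simp add: sum_delta_mult)
  also have "\<dots> = (\<Sum>k<d. (Z ! k * adj (Z ! k)) $$ (i, j))"
  proof (rule sum.cong[OF refl])
    fix k assume "k \<in> {..<d}"
    then have "dim_row (Z ! k) = m" "dim_col (Z ! k) = m" using Zk by auto
    then show "(\<Sum>a<m. (Z ! k) $$ (i, a) * cnj ((Z ! k) $$ (j, a))) = (Z ! k * adj (Z ! k)) $$ (i, j)"
      using ij by (subst index_mult_sum) auto
  qed
  finally show "mat_list_sum m m (map (\<lambda>A. A * adj A) Z) $$ (i, j) =
      (row_matrix d m Z * adj (row_matrix d m Z)) $$ (i, j)"
    using ij assms(1) index_mat_list_sum[OF c ij] by simp
qed

text \<open>\<open>op_norm_le_iff\<close> speaks of H^2 for the Gram matrix H of the row; as H is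
  positive, this is traded for a bound on H itself. The strict inequality becomes a margin c < 1,
  the form in which row balls are used below.\<close>

lemma row_ball_level_iff:
  assumes "length Z = d" "set Z \<subseteq> carrier_mat m m"
  shows "Z \<in> row_ball_level d m \<longleftrightarrow> (\<exists>c. 0 < c \<and> c < 1 \<and>
    psd (scalar_mat c m - row_matrix d m Z * adj (row_matrix d m Z)))"
proof -
  define H where "H = row_matrix d m Z * adj (row_matrix d m Z)"
  have [simp]: "dim_row H = m" "dim_col H = m" by (auto simp: H_def)
  have H: "H \<in> carrier_mat m m" by (rule carrier_matI) simp_all
  have psdH: "psd H" unfolding H_def by (rule psd_gram)
  note herm = psd_hermitian[OF psdH]
  have "Z \<in> row_ball_level d m \<longleftrightarrow> op_norm H < 1"
    using assms row_matrix_gram[OF assms] by (simp add: row_ball_level_def H_def)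
  also have "\<dots> \<longleftrightarrow> (\<exists>c. 0 < c \<and> c < 1 \<and> op_norm H \<le> c)"
  proof
    assume "op_norm H < 1"
    then show "\<exists>c. 0 < c \<and> c < 1 \<and> op_norm H \<le> c" by (intro exI[of _ "max (1 / 2) (op_norm H)"]) auto
  qed auto
  also have "\<dots> \<longleftrightarrow> (\<exists>c. 0 < c \<and> c < 1 \<and> psd (scalar_mat c m - H))"
  proof -
    have "op_norm H \<le> c \<longleftrightarrow> psd (scalar_mat c m - H)" if c: "c > 0" for c
    proof -
      let ?D = "scalar_mat c m - H" and ?S = "scalar_mat (c\<^sup>2) m - H * H"
      have hermD: "adj ?D = ?D" by (simp add: adj_minus herm)
      have D: "?D \<in> carrier_mat m m" and S: "?S \<in> carrier_mat m m" by (rule carrier_matI; simp)+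
      have "op_norm H \<le> c \<longleftrightarrow> psd ?S" using op_norm_le_iff[OF H, of c] c by (simp add: herm)
      also have "\<dots> \<longleftrightarrow> psd ?D"
      proof
        assume "psd ?S"
        \<comment> \<open>With D = c - H and S = c^2 - H^2 one has 2 c D = D^2 + S.\<close>
        then have "psd (complex_of_real (1 / (2 * c)) \<cdot>\<^sub>m (?D * adj ?D + ?S))"
          using c by (intro psd_smult[of _ m] psd_add[of _ m] psd_gram) (auto intro!: carrier_matI)
        also have "complex_of_real (1 / (2 * c)) \<cdot>\<^sub>m (?D * adj ?D + ?S) = ?D"
          unfolding hermD using c
          by (simp add: mat_algebra)
             (intro eq_matI; simp add: field_simps power2_eq_square del: index_mult_mat(1))
        finally show "psd ?D" .
      next
        assume D': "psd ?D"
        \<comment> \<open>Conversely S = c D + (D H D + H D H) / c, because D and H commute and D +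
          H = c.\<close>
        have "psd (complex_of_real c \<cdot>\<^sub>m ?D + complex_of_real (1 / c) \<cdot>\<^sub>m (?D * H * adj ?D + H * ?D * adj H))"
          using c by (intro psd_smult[of _ m] psd_add[of _ m] psd_congruence D' psdH) (auto intro!: carrier_matI)
        also have "complex_of_real c \<cdot>\<^sub>m ?D + complex_of_real (1 / c) \<cdot>\<^sub>m (?D * H * adj ?D + H * ?D * adj H) = ?S"
          unfolding hermD herm using c
          by (simp add: mat_algebra)
             (intro eq_matI; simp add: field_simps power2_eq_square del: index_mult_mat(1))
        finally show "psd ?S" .
      qed
      finally show ?thesis .
    qed
    then show ?thesis by blast
  qed
  finally show ?thesis by (simp add: H_def)
qed

lemma row_ball_levelD:
  assumes "Z \<in> row_ball_level d m"
  shows "length Z = d" "set Z \<subseteq> carrier_mat m m"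
    "\<exists>c. 0 < c \<and> c < 1 \<and> psd (scalar_mat c m - row_matrix d m Z * adj (row_matrix d m Z))"
proof -
  show Z: "length Z = d" "set Z \<subseteq> carrier_mat m m" using assms by (auto simp: row_ball_level_def)
  show "\<exists>c. 0 < c \<and> c < 1 \<and> psd (scalar_mat c m - row_matrix d m Z * adj (row_matrix d m Z))"
    using assms row_ball_level_iff[OF Z] by blast
qed

text \<open>Packs the d relations between the tuples into a single matrix equation. It is applied
  with an invertible T for similarities and with a coordinate inclusion for direct sums.\<close>

lemma row_matrix_intertwine:
  assumes T: "T \<in> carrier_mat m' m"
    and Z: "\<And>k. k < d \<Longrightarrow> Z ! k \<in> carrier_mat m m" and Z': "\<And>k. k < d \<Longrightarrow> Z' ! k \<in> carrier_mat m' m'"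
    and eq: "\<And>k. k < d \<Longrightarrow> Z' ! k * T = T * Z ! k"
  shows "row_matrix d m' Z' * kron T (1\<^sub>m d) = T * row_matrix d m Z"
proof (intro eq_matI)
  have [simp]: "dim_row T = m'" "dim_col T = m" using T by auto
  fix i p assume "i < dim_row (T * row_matrix d m Z)" "p < dim_col (T * row_matrix d m Z)"
  then have i: "i < m'" and p: "p < m * d" by auto
  note k = digit_bounds(2)[OF p]
  have [simp]: "dim_row (Z ! (p mod d)) = m" "dim_col (Z ! (p mod d)) = m"
    "dim_row (Z' ! (p mod d)) = m'" "dim_col (Z' ! (p mod d)) = m'" using Z[OF k] Z'[OF k] by auto
  have "(row_matrix d m' Z' * kron T (1\<^sub>m d)) $$ (i, p) =
      (\<Sum>q<m' * d. (Z' ! (q mod d)) $$ (i, q div d) * (T $$ (q div d, p div d) * (if q mod d = p mod d then 1 else 0)))"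
    using i p by (subst index_mult_sum) (auto simp: digit_bounds)
  also have "\<dots> = (\<Sum>a<m'. \<Sum>k<d. (Z' ! k) $$ (i, a) * (T $$ (a, p div d) * (if k = p mod d then 1 else 0)))"
    by (rule sum_digits)
  also have "\<dots> = (\<Sum>a<m'. \<Sum>k<d. (if p mod d = k then 1 else 0) * ((Z' ! k) $$ (i, a) * T $$ (a, p div d)))"
    by (intro sum.cong) auto
  also have "\<dots> = (\<Sum>a<m'. (Z' ! (p mod d)) $$ (i, a) * T $$ (a, p div d))"
    using k by (simp add: sum_delta_mult)
  also have "\<dots> = (Z' ! (p mod d) * T) $$ (i, p div d)"
    using i digit_bounds[OF p] by (subst index_mult_sum) auto
  also have "\<dots> = (T * Z ! (p mod d)) $$ (i, p div d)" by (simp only: eq[OF k])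
  also have "\<dots> = (T * row_matrix d m Z) $$ (i, p)"
    using i p digit_bounds[OF p] by (subst (1 2) index_mult_sum) auto
  finally show "(row_matrix d m' Z' * kron T (1\<^sub>m d)) $$ (i, p) = (T * row_matrix d m Z) $$ (i, p)" .
qed (use T in auto)

section \<open>Stein equations\<close>

lemma psd_zero: "psd (0\<^sub>m n n)"
  using psd_gram[of "0\<^sub>m n n"] by simp

text \<open>A lower bound improves itself: if Q \<ge> -r then Q \<ge> -r c, because Q + r c is the
  sum of the Stein defect, the conjugate of (Q + r) \<otimes> I by R, and r (c - R
  \<open>adj R\<close>). Starting from some lower bound -K, the bounds -K c^k tend to 0.\<close>

lemma stein_hermitian_psd:
  assumes R: "R \<in> carrier_mat N (N * d)" and c: "0 \<le> c" "c < 1"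
    and contr: "psd (scalar_mat c N - R * adj R)"
    and Q: "Q \<in> carrier_mat N N" and herm: "adj Q = Q"
    and stein: "psd (Q - R * kron Q (1\<^sub>m d) * adj R)"
  shows "psd Q"
proof -
  have [simp]: "dim_row R = N" "dim_col R = N * d" "dim_row Q = N" "dim_col Q = N" using R Q by auto
  have step: "psd (Q + scalar_mat (r * c) N)"
    if r: "r \<ge> 0" and psd: "psd (Q + scalar_mat r N)" for r
  proof -
    let ?S = "Q - R * kron Q (1\<^sub>m d) * adj R"
      and ?C = "R * kron (Q + scalar_mat r N) (1\<^sub>m d) * adj R"
      and ?D = "complex_of_real r \<cdot>\<^sub>m (scalar_mat c N - R * adj R)"
    have C: "Q + scalar_mat r N \<in> carrier_mat N N" by (rule carrier_matI) simp_all
    have "psd ?C" by (rule psd_congruence[OF psd_kron_one(1)[OF C psd]]) simp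
    then have "psd (?S + (?C + ?D))"
      using stein contr r
      by (intro psd_add[of _ N] psd_smult[of _ N]) (auto intro!: carrier_matI)
    also have "?S + (?C + ?D) = Q + scalar_mat (r * c) N"
      by (simp add: kron_add kron_smult kron_one mat_algebra)
         (intro eq_matI; simp add: algebra_simps del: index_mult_mat(1))
    finally show ?thesis .
  qed
  have "- Q \<in> carrier_mat N N" "adj (- Q) = - Q" using herm by (auto intro!: carrier_matI eq_matI)
       (metis Q carrier_matD index_adj complex_cnj_minus)
  then obtain K where K: "K > 0" "psd (scalar_mat K N - (- Q))" by (rule hermitian_bound)
  have "scalar_mat K N - (- Q) = Q + scalar_mat K N"
    by (intro eq_matI) auto
  with K have base: "psd (Q + scalar_mat K N)" by simp
  have iter: "psd (Q + scalar_mat (K * c ^ k) N)" for k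
  proof (induction k)
    case (Suc k)
    from step[OF _ this] show ?case using K(1) c(1) by (simp add: mult_ac)
  qed (use base in simp)
  show ?thesis
  proof (rule psd_limit[OF Q one_carrier_mat])
    fix e :: real assume e: "e > 0"
    have "(\<lambda>k. K * c ^ k) \<longlonglongrightarrow> K * 0" using c by (intro tendsto_intros LIMSEQ_power_zero) auto
    then have "\<forall>\<^sub>F k in sequentially. K * c ^ k < e" using e by (simp add: order_tendstoD(2))
    then obtain k where k: "K * c ^ k < e" by (auto simp: eventually_sequentially)
    have "psd ((Q + scalar_mat (K * c ^ k) N) + scalar_mat (e - K * c ^ k) N)"
      using k by (intro psd_add[of _ N] iter psd_smult[of _ N] psd_one) (auto intro!: carrier_matI)
    also have "(Q + scalar_mat (K * c ^ k) N) + scalar_mat (e - K * c ^ k) N =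
        Q + scalar_mat e N"
      by (intro eq_matI) (auto simp: algebra_simps)
    finally show "psd (Q + scalar_mat e N)" .
  qed
qed

text \<open>For a Hermitian solution H the positivity result applies to H and to -H, so H = 0. The
  adjoint of a solution is again a solution, so the general case follows from Q +
  \<open>adj Q\<close> and \<i> (Q - \<open>adj Q\<close>).\<close>

lemma stein_unique:
  assumes R: "R \<in> carrier_mat N (N * d)" and c: "0 \<le> c" "c < 1"
    and contr: "psd (scalar_mat c N - R * adj R)"
    and Q: "Q \<in> carrier_mat N N" and stein: "Q = R * kron Q (1\<^sub>m d) * adj R"
  shows "Q = 0\<^sub>m N N"
proof -
  have [simp]: "dim_row R = N" "dim_col R = N * d" "dim_row Q = N" "dim_col Q = N" using R Q by auto
  have herm: "H = 0\<^sub>m N N" if H: "H \<in> carrier_mat N N" and adj: "adj H = H"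
    and eq: "R * kron H (1\<^sub>m d) * adj R = H" for H
  proof (rule psd_antisym[OF H])
    have [simp]: "dim_row H = N" "dim_col H = N" using H by auto
    have minus: "H - H = 0\<^sub>m N N" by (intro eq_matI) auto
    show "psd H"
      by (rule stein_hermitian_psd[OF R c contr H adj]) (simp add: eq minus psd_zero)
    have uminus: "- H = (- 1) \<cdot>\<^sub>m H" by (intro eq_matI) auto
    show "psd (- H)"
      unfolding uminus
    proof (rule stein_hermitian_psd[OF R c contr])
      have "R * kron ((- 1) \<cdot>\<^sub>m H) (1\<^sub>m d) * adj R = (- 1) \<cdot>\<^sub>m H"
        by (simp add: kron_smult mat_smult eq)
      moreover have "(- 1) \<cdot>\<^sub>m H - (- 1) \<cdot>\<^sub>m H = 0\<^sub>m N N" by (intro eq_matI) auto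
      ultimately show "psd ((- 1) \<cdot>\<^sub>m H - R * kron ((- 1) \<cdot>\<^sub>m H) (1\<^sub>m d) * adj R)"
        by (simp only: psd_zero)
    qed (auto simp: adj intro!: carrier_matI)
  qed
  have stein': "R * (kron Q (1\<^sub>m d) * adj R) = Q" using stein by (simp add: mat_assoc)
  have adj_stein: "R * (kron (adj Q) (1\<^sub>m d) * adj R) = adj Q"
    using arg_cong[OF stein', of adj] by (simp add: adj_mult kron_adj mat_assoc)
  have "Q + adj Q = 0\<^sub>m N N"
  proof (rule herm)
    show "adj (Q + adj Q) = Q + adj Q" by (intro eq_matI) auto
    show "R * kron (Q + adj Q) (1\<^sub>m d) * adj R = Q + adj Q"
      by (simp add: kron_add mat_algebra stein' adj_stein)
  qed (auto intro!: carrier_matI)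
  moreover have "\<i> \<cdot>\<^sub>m (Q - adj Q) = 0\<^sub>m N N"
  proof (rule herm)
    show "adj (\<i> \<cdot>\<^sub>m (Q - adj Q)) = \<i> \<cdot>\<^sub>m (Q - adj Q)" by (intro eq_matI) (auto simp: algebra_simps)
    show "R * kron (\<i> \<cdot>\<^sub>m (Q - adj Q)) (1\<^sub>m d) * adj R = \<i> \<cdot>\<^sub>m (Q - adj Q)"
      by (simp add: kron_minus kron_smult mat_algebra stein' adj_stein)
  qed (auto intro!: carrier_matI)
  ultimately have sum: "Q + adj Q = 0\<^sub>m N N" and diff: "\<i> \<cdot>\<^sub>m (Q - adj Q) = 0\<^sub>m N N"
    by auto
  have zero: "Q $$ (i, j) + adj Q $$ (i, j) = 0" "\<i> * (Q $$ (i, j) - adj Q $$ (i, j)) = 0"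
    if "i < N" "j < N" for i j
    using that arg_cong[OF sum, of "\<lambda>A. A $$ (i, j)"] arg_cong[OF diff, of "\<lambda>A. A $$ (i, j)"]
    by (simp_all del: index_adj)
  show ?thesis
  proof (rule eq_matI)
    fix i j assume "i < dim_row (0\<^sub>m N N)" "j < dim_col (0\<^sub>m N N)"
    then show "Q $$ (i, j) = 0\<^sub>m N N $$ (i, j)" using zero[of i j] by (simp del: index_adj)
  qed auto
qed

text \<open>A positive defect is Hermitian, so Q - \<open>adj Q\<close> solves the homogeneous
  equation and vanishes. This supplies the symmetry that the Hermitian version asks for.\<close>

lemma stein_psd:
  assumes R: "R \<in> carrier_mat N (N * d)" and c: "0 \<le> c" "c < 1"
    and contr: "psd (scalar_mat c N - R * adj R)"
    and Q: "Q \<in> carrier_mat N N" and stein: "psd (Q - R * kron Q (1\<^sub>m d) * adj R)"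
  shows "psd Q"
proof (rule stein_hermitian_psd[OF R c contr Q _ stein])
  have [simp]: "dim_row R = N" "dim_col R = N * d" "dim_row Q = N" "dim_col Q = N" using R Q by auto
  let ?S = "\<lambda>Q. R * (kron Q (1\<^sub>m d) * adj R)"
  have eq: "adj Q - ?S (adj Q) = Q - ?S Q"
    using psd_hermitian[OF stein] by (simp add: mat_algebra kron_adj)
  have diff: "Q - adj Q = 0\<^sub>m N N"
  proof (rule stein_unique[OF R c contr])
    have "?S (Q - adj Q) = ?S Q - ?S (adj Q)" by (simp add: kron_minus mat_algebra)
    also have "\<dots> = Q - adj Q"
    proof (rule eq_matI)
      fix i j assume "i < dim_row (Q - adj Q)" "j < dim_col (Q - adj Q)"
      then show "(?S Q - ?S (adj Q)) $$ (i, j) = (Q - adj Q) $$ (i, j)"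
        using arg_cong[OF eq, of "\<lambda>A. A $$ (i, j)"]
        by (simp add: algebra_simps del: index_adj index_mult_mat(1))
    qed auto
    finally show "Q - adj Q = R * kron (Q - adj Q) (1\<^sub>m d) * adj R" by (simp add: mat_assoc)
  qed (auto intro!: carrier_matI)
  show "adj Q = Q"
  proof (intro eq_matI)
    fix i j assume "i < dim_row Q" "j < dim_col Q"
    then show "adj Q $$ (i, j) = Q $$ (i, j)"
      using arg_cong[OF diff, of "\<lambda>A. A $$ (i, j)"] by (simp del: index_adj)
  qed auto
qed
section \<open>The Pick matrix\<close>

lemma mat_inv_eqI:
  assumes A: "A \<in> carrier_mat n n" and B: "B \<in> carrier_mat n n" and AB: "A * B = 1\<^sub>m n" "B * A = 1\<^sub>m n"
  shows "mat_inv A = B"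
proof -
  have "A \<in> Units (ring_mat TYPE(complex) n ())"
    using A B AB unfolding Units_def by (auto simp: ring_mat_simps)
  then obtain C where C: "mat_inverse A = Some C" using mat_inverse(1)[OF A] by fastforce
  have [simp]: "dim_row A = n" "dim_col A = n" "dim_row B = n" "dim_col B = n" using A B by auto
  have AC: "A * C = 1\<^sub>m n" "C \<in> carrier_mat n n" using mat_inverse(2)[OF A C] by auto
  then have [simp]: "dim_row C = n" "dim_col C = n" by auto
  have "B * A * C = B" by (simp add: mat_assoc AC mat_units)
  then have "C = B" by (simp add: AB mat_units)
  then show ?thesis by (simp add: mat_inv_def C)
qed

lemma trivial_kernel_inverse:
  fixes A :: "complex mat"
  assumes A: "A \<in> carrier_mat n n"
    and ker: "\<And>v. v \<in> carrier_vec n \<Longrightarrow> A *\<^sub>v v = 0\<^sub>v n \<Longrightarrow> v = 0\<^sub>v n"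
  obtains B where "B \<in> carrier_mat n n" "A * B = 1\<^sub>m n" "B * A = 1\<^sub>m n"
proof -
  have "det A \<noteq> 0" using ker det_0_iff_vec_prod_zero_field[OF A] by blast
  then have "A \<in> Units (ring_mat TYPE(complex) n ())" by (rule det_non_zero_imp_unit[OF A])
  then obtain C where "mat_inverse A = Some C" using mat_inverse(1)[OF A] by fastforce
  from mat_inverse(2)[OF A this] show thesis using that by blast
qed

text \<open>Unstacking w into a matrix W, column by column, turns the equation for w into W = \<Sum>
  X_i W \<open>adj X_i\<close>, which by contractivity has only the zero solution. Hence the inverse
  in the Pick matrix exists.\<close>

lemma pick_operator_kernel:
  assumes X: "X \<in> row_ball_level d n" and w: "w \<in> carrier_vec (n * n)"
    and ker: "\<And>p. p < n * n \<Longrightarrow> w $ p = (\<Sum>i<d. \<Sum>c<n. \<Sum>l<n.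
       cnj ((X ! i) $$ (p div n, c)) * (X ! i) $$ (p mod n, l) * w $ (c * n + l))"
  shows "w = 0\<^sub>v (n * n)"
proof -
  obtain c where c: "0 < c" "c < 1"
    "psd (scalar_mat c n - row_matrix d n X * adj (row_matrix d n X))"
    using row_ball_levelD(3)[OF X] by blast
  define W where "W = mat n n (\<lambda>(b, a). w $ (a * n + b))"
  have W: "W \<in> carrier_mat n n" by (simp add: W_def)
  have "W = row_matrix d n X * kron W (1\<^sub>m d) * adj (row_matrix d n X)"
  proof (rule eq_matI)
    fix b a assume "b < dim_row (row_matrix d n X * kron W (1\<^sub>m d) * adj (row_matrix d n X))"
      "a < dim_col (row_matrix d n X * kron W (1\<^sub>m d) * adj (row_matrix d n X))"
    then have ab: "b < n" "a < n" by auto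
    have "(row_matrix d n X * kron W (1\<^sub>m d) * adj (row_matrix d n X)) $$ (b, a) =
        (\<Sum>i<d. \<Sum>l<n. \<Sum>c<n. (X ! i) $$ (b, l) * W $$ (l, c) * cnj ((X ! i) $$ (a, c)))"
      by (rule row_matrix_conj[OF W ab])
    also have "\<dots> = (\<Sum>i<d. \<Sum>c<n. \<Sum>l<n. (X ! i) $$ (b, l) * W $$ (l, c) * cnj ((X ! i) $$ (a, c)))"
      by (rule sum.cong[OF refl], rule sum.swap)
    also have "\<dots> = (\<Sum>i<d. \<Sum>c<n. \<Sum>l<n. cnj ((X ! i) $$ (a, c)) * (X ! i) $$ (b, l) * w $ (c * n + l))"
      by (intro sum.cong refl) (simp add: W_def mult_ac)
    also have "\<dots> = w $ (a * n + b)"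
      using ker[of "a * n + b"] ab digits_less[OF ab(2,1)] by simp
    finally show "W $$ (b, a) = (row_matrix d n X * kron W (1\<^sub>m d) * adj (row_matrix d n X)) $$ (b, a)"
      using ab by (simp add: W_def del: index_mult_mat(1))
  qed (use W in auto)
  then have zero: "W = 0\<^sub>m n n"
    using c W by (intro stein_unique[of "row_matrix d n X" n d c W]) (auto intro!: carrier_matI)
  show ?thesis
  proof (rule eq_vecI)
    fix p assume "p < dim_vec (0\<^sub>v (n * n))"
    then have p: "p < n * n" by simp
    have "W $$ (p mod n, p div n) = w $ p" using digit_bounds[OF p] by (simp add: W_def)
    then show "w $ p = 0\<^sub>v (n * n) $ p" using digit_bounds[OF p] p by (simp add: zero)
  qed (use w in auto)
qed

definition pick_operator :: "nat \<Rightarrow> complex mat list \<Rightarrow> complex mat" where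
  "pick_operator n X = mat_list_sum (n * n) (n * n) (map (\<lambda>A. kron (map_mat cnj A) A) X)"

lemma pick_operator_carrier:
  "set X \<subseteq> carrier_mat n n \<Longrightarrow> pick_operator n X \<in> carrier_mat (n * n) (n * n)"
  unfolding pick_operator_def by (intro mat_list_sum_carrier) auto

lemma index_pick_operator:
  assumes X: "length X = d" "set X \<subseteq> carrier_mat n n" and pq: "p < n * n" "q < n * n"
  shows "pick_operator n X $$ (p, q) =
    (\<Sum>i<d. cnj ((X ! i) $$ (p div n, q div n)) * (X ! i) $$ (p mod n, q mod n))"
proof -
  have "pick_operator n X $$ (p, q) = (\<Sum>i<d. kron (map_mat cnj (X ! i)) (X ! i) $$ (p, q))"
    using assms unfolding pick_operator_def by (subst index_mat_list_sum) auto
  also have "\<dots> = (\<Sum>i<d. cnj ((X ! i) $$ (p div n, q div n)) * (X ! i) $$ (p mod n, q mod n))"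
  proof (rule sum.cong[OF refl])
    fix i assume "i \<in> {..<d}"
    then have "X ! i \<in> carrier_mat n n" using X nth_mem by blast
    then have "dim_row (X ! i) = n" "dim_col (X ! i) = n" by auto
    then show "kron (map_mat cnj (X ! i)) (X ! i) $$ (p, q) =
        cnj ((X ! i) $$ (p div n, q div n)) * (X ! i) $$ (p mod n, q mod n)"
      using pq digit_bounds[OF pq(1)] digit_bounds[OF pq(2)] by simp
  qed
  finally show ?thesis .
qed

lemma pick_inverse:
  assumes X: "X \<in> row_ball_level d n"
  obtains G where "G \<in> carrier_mat (n * n) (n * n)" "pick_matrix n X = psi n G"
    "(1\<^sub>m (n * n) - pick_operator n X) * G = 1\<^sub>m (n * n)"
    "G * (1\<^sub>m (n * n) - pick_operator n X) = 1\<^sub>m (n * n)"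
proof -
  note Xc = row_ball_levelD(1,2)[OF X]
  let ?M = "pick_operator n X"
  have M: "?M \<in> carrier_mat (n * n) (n * n)" by (rule pick_operator_carrier[OF Xc(2)])
  have A: "1\<^sub>m (n * n) - ?M \<in> carrier_mat (n * n) (n * n)" by (rule minus_carrier_mat[OF M])
  obtain G where G: "G \<in> carrier_mat (n * n) (n * n)" "(1\<^sub>m (n * n) - ?M) * G = 1\<^sub>m (n * n)"
    "G * (1\<^sub>m (n * n) - ?M) = 1\<^sub>m (n * n)"
  proof (rule trivial_kernel_inverse[OF A])
    fix w :: "complex vec" assume w: "w \<in> carrier_vec (n * n)" and ker: "(1\<^sub>m (n * n) - ?M) *\<^sub>v w = 0\<^sub>v (n * n)"
    show "w = 0\<^sub>v (n * n)"
    proof (rule pick_operator_kernel[OF X w])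
      fix p assume p: "p < n * n"
      have "(1\<^sub>m (n * n) - ?M) *\<^sub>v w = w - ?M *\<^sub>v w"
        using minus_mult_distrib_mat_vec[OF one_carrier_mat M w] w by simp
      then have "(w - ?M *\<^sub>v w) $ p = 0\<^sub>v (n * n) $ p" by (simp only: ker)
      then have "w $ p = (?M *\<^sub>v w) $ p" using p M w by simp
      also have "\<dots> = (\<Sum>q<n * n. (\<Sum>i<d. cnj ((X ! i) $$ (p div n, q div n)) * (X ! i) $$ (p mod n, q mod n)) * w $ (q div n * n + q mod n))"
        using p M w index_pick_operator[OF Xc p] by (simp add: scalar_prod_def atLeast0LessThan)
      also have "\<dots> = (\<Sum>c<n. \<Sum>l<n. (\<Sum>i<d. cnj ((X ! i) $$ (p div n, c)) * (X ! i) $$ (p mod n, l)) * w $ (c * n + l))"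
        by (rule sum_digits)
      also have "\<dots> = (\<Sum>c<n. \<Sum>i<d. \<Sum>l<n. cnj ((X ! i) $$ (p div n, c)) * (X ! i) $$ (p mod n, l) * w $ (c * n + l))"
        unfolding sum_distrib_right by (rule sum.cong[OF refl], rule sum.swap)
      also have "\<dots> = (\<Sum>i<d. \<Sum>c<n. \<Sum>l<n. cnj ((X ! i) $$ (p div n, c)) * (X ! i) $$ (p mod n, l) * w $ (c * n + l))"
        by (rule sum.swap)
      finally show "w $ p = (\<Sum>i<d. \<Sum>c<n. \<Sum>l<n. cnj ((X ! i) $$ (p div n, c)) * (X ! i) $$ (p mod n, l) * w $ (c * n + l))" .
    qed
  qed
  moreover have "mat_inv (1\<^sub>m (n * n) - ?M) = G" by (rule mat_inv_eqI[OF A G(1,2,3)])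
  then have "pick_matrix n X = psi n G" by (simp add: pick_matrix_def kron_one pick_operator_def)
  ultimately show thesis using that by blast
qed

definition vec_identity :: "nat \<Rightarrow> complex mat" where
  "vec_identity n = mat (n * n) 1 (\<lambda>(p, _). if p div n = p mod n then 1 else 0)"

lemma dim_vec_identity [simp]: "dim_row (vec_identity n) = n * n" "dim_col (vec_identity n) = 1"
  by (simp_all add: vec_identity_def)

lemma vec_identity_gram:
  "p < n * n \<Longrightarrow> q < n * n \<Longrightarrow> (vec_identity n * adj (vec_identity n)) $$ (p, q) =
    (if p div n = p mod n \<and> q div n = q mod n then 1 else 0)"
  by (subst index_mult_sum) (auto simp: vec_identity_def)

lemma pick_matrix_carrier: "pick_matrix n X \<in> carrier_mat (n * n) (n * n)"
  by (simp add: pick_matrix_def psi_carrier)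

text \<open>The column order of \<open>row_matrix\<close>, with C^d as the last factor, makes this a
  literal equality. For ampliations \<open>kron A (1\<^sub>m k)\<close> it is the swapped order,
  with C^d in front, that avoids a permutation; hence the two versions of the row.\<close>

lemma row_matrix_ampliation:
  assumes "\<And>i. i < d \<Longrightarrow> X ! i \<in> carrier_mat n n" "length X = d"
  shows "row_matrix d (k * n) (map (kron (1\<^sub>m k)) X) = kron (1\<^sub>m k) (row_matrix d n X)"
proof (rule eq_matI)
  fix p q assume "p < dim_row (kron (1\<^sub>m k) (row_matrix d n X))" "q < dim_col (kron (1\<^sub>m k) (row_matrix d n X))"
  then have p: "p < k * n" and q: "q < k * (n * d)" by auto
  have q': "q < k * n * d" using q by (simp add: mult.assoc)
  have [simp]: "dim_row (X ! (q mod d)) = n" "dim_col (X ! (q mod d)) = n"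
    using assms(1)[OF digit_bounds(2)[OF q']] by auto
  have "q mod (n * d) = d * (q div d mod n) + q mod d" using mod_mult2_eq[of q d n] by (simp only: mult.commute)
  moreover have "d > 0" using q' by (cases d) auto
  ultimately have digits: "q mod (n * d) div d = q div d mod n" "q mod (n * d) mod d = q mod d" by simp_all
  have "q div (n * d) = q div d div n" by (metis div_mult2_eq mult.commute)
  then show "row_matrix d (k * n) (map (kron (1\<^sub>m k)) X) $$ (p, q) = kron (1\<^sub>m k) (row_matrix d n X) $$ (p, q)"
    using p q q' assms(2) digit_bounds[OF p] digit_bounds[OF q] digit_bounds[OF q']
      digit_bounds[OF digit_bounds(1)[OF q']]
    by (simp add: digits)
qed auto

lemma row_matrix_swapped_ampliation:
  assumes "\<And>i. i < d \<Longrightarrow> X ! i \<in> carrier_mat n n" "length X = d"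
  shows "row_matrix_swapped d (n * k) (map (\<lambda>A. kron A (1\<^sub>m k)) X) = kron (row_matrix_swapped d n X) (1\<^sub>m k)"
proof (rule eq_matI)
  fix p q assume "p < dim_row (kron (row_matrix_swapped d n X) (1\<^sub>m k))" "q < dim_col (kron (row_matrix_swapped d n X) (1\<^sub>m k))"
  then have p: "p < n * k" and q: "q < d * n * k" by auto
  have q': "q < d * (n * k)" using q by (simp add: mult.assoc)
  have "q mod (n * k) = k * (q div k mod n) + q mod k" using mod_mult2_eq[of q k n] by (simp only: mult.commute)
  moreover have "k > 0" using q by (cases k) auto
  ultimately have digits: "q mod (n * k) div k = q div k mod n" "q mod (n * k) mod k = q mod k" by simp_all
  have div: "q div (n * k) = q div k div n" by (metis div_mult2_eq mult.commute)
  have [simp]: "dim_row (X ! (q div k div n)) = n" "dim_col (X ! (q div k div n)) = n"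
    using assms(1)[OF digit_bounds(1)[OF q']] by (auto simp: div)
  show "row_matrix_swapped d (n * k) (map (\<lambda>A. kron A (1\<^sub>m k)) X) $$ (p, q) =
      kron (row_matrix_swapped d n X) (1\<^sub>m k) $$ (p, q)"
    using p q q' assms(2) digit_bounds[OF p] digit_bounds[OF q] digit_bounds[OF q']
      digit_bounds[OF digit_bounds(1)[OF q]]
    by (simp add: digits div)
qed auto

lemma sum_index_diff_one:
  fixes f :: "nat \<Rightarrow> complex"
  assumes "i < n"
  shows "(\<Sum>k<n. ((if i = k then 1 else 0) - g k) * f k) = f i - (\<Sum>k<n. g k * f k)"
    "(\<Sum>k<n. f k * ((if k = i then 1 else 0) - g k)) = f i - (\<Sum>k<n. f k * g k)"
proof -
  have "(\<Sum>k<n. f k * (if k = i then 1 else 0)) = (\<Sum>k<n. if k = i then f k else 0)"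
    by (intro sum.cong) auto
  then show "(\<Sum>k<n. f k * ((if k = i then 1 else 0) - g k)) = f i - (\<Sum>k<n. f k * g k)"
    using assms by (simp add: right_diff_distrib sum_subtractf)
qed (use assms in \<open>simp add: left_diff_distrib sum_subtractf sum_delta_mult\<close>)

text \<open>Write a row index of P as (p1, p0) and a column index as (q1, q0). By
  \<open>psi\<close>, this entry of P is the entry of the inverse G in row (q0, p0) and column (q1,
  p1). Multiplying G from the left by \<open>pick_operator\<close> therefore acts on the last digits
  of P, which is conjugation with I \<otimes> X_i; multiplying from the right acts on the first
  digits, which is conjugation with X_i^T \<otimes> I. The identity matrix becomes the Gram matrix
  of vec I.\<close>

lemma pick_matrix_stein:
  assumes X: "X \<in> row_ball_level d n"
  defines "R \<equiv> kron (1\<^sub>m n) (row_matrix d n X)"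
    and "C \<equiv> kron (row_matrix_swapped d n (map transpose_mat X)) (1\<^sub>m n)"
  shows "pick_matrix n X - R * kron (pick_matrix n X) (1\<^sub>m d) * adj R =
      vec_identity n * adj (vec_identity n)"
    and "pick_matrix n X - C * kron (1\<^sub>m d) (pick_matrix n X) * adj C =
      vec_identity n * adj (vec_identity n)"
proof -
  note Xc = row_ball_levelD(1,2)[OF X]
  let ?M = "pick_operator n X" and ?P = "pick_matrix n X" and ?N = "n * n"
  have Xi: "X ! i \<in> carrier_mat n n" if "i < d" for i using Xc that nth_mem by blast
  have [simp]: "dim_row ?M = ?N" "dim_col ?M = ?N" using pick_operator_carrier[OF Xc(2)] by auto
  have P: "?P \<in> carrier_mat ?N ?N" by (rule pick_matrix_carrier)
  have [simp]: "dim_row ?P = ?N" "dim_col ?P = ?N" using P by auto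
  obtain G where G: "G \<in> carrier_mat ?N ?N" "?P = psi n G" "(1\<^sub>m ?N - ?M) * G = 1\<^sub>m ?N" "G * (1\<^sub>m ?N - ?M) = 1\<^sub>m ?N"
    using pick_inverse[OF X] by blast
  have [simp]: "dim_row G = ?N" "dim_col G = ?N" using G by auto
  have PG: "?P $$ (a * n + b, c * n + e) = G $$ (e * n + b, c * n + a)"
    if "a < n" "b < n" "c < n" "e < n" for a b c e
    using that digits_less[OF that(1,2)] digits_less[OF that(3,4)] by (simp add: G(2) psi_def)
  have [simp]: "dim_row R = ?N" "dim_col R = ?N * d" "dim_row C = ?N" "dim_col C = d * ?N"
    by (simp_all add: R_def C_def mult.assoc)
  let ?T = "map (kron (1\<^sub>m n)) X" and ?C = "map (\<lambda>A. kron A (1\<^sub>m n)) (map transpose_mat X)"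
  have R: "R = row_matrix d ?N ?T" unfolding R_def by (rule row_matrix_ampliation[symmetric]) (use Xi Xc in auto)
  have C: "C = row_matrix_swapped d ?N ?C"
    unfolding C_def by (rule row_matrix_swapped_ampliation[symmetric]) (use Xi Xc in auto)
  have eq_id: "a * n + b = c * n + e \<longleftrightarrow> a = c \<and> b = e" if "b < n" "e < n" for a b c e :: nat
  proof
    assume eq: "a * n + b = c * n + e"
    from arg_cong[OF eq, of "\<lambda>x. x div n"] arg_cong[OF eq, of "\<lambda>x. x mod n"] that
    show "a = c \<and> b = e" by simp
  qed simp
  show "?P - R * kron ?P (1\<^sub>m d) * adj R = vec_identity n * adj (vec_identity n)"
  proof (rule eq_matI)
    fix p q assume "p < dim_row (vec_identity n * adj (vec_identity n))"
      "q < dim_col (vec_identity n * adj (vec_identity n))"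
    then have p: "p < ?N" and q: "q < ?N" by auto
    define p1 p0 q1 q0 where d: "p1 = p div n" "p0 = p mod n" "q1 = q div n" "q0 = q mod n"
    have b: "p1 < n" "p0 < n" "q1 < n" "q0 < n" using digit_bounds[OF p] digit_bounds[OF q] by (auto simp: d)
    have pq: "p = p1 * n + p0" "q = q1 * n + q0" by (simp_all add: d)
    note lt = digits_less[OF b(4,2)] digits_less[OF b(3,1)]
    have T: "(?T ! i) $$ (r, l) = (if r div n = l div n then 1 else 0) * (X ! i) $$ (r mod n, l mod n)"
      if "i < d" "r < ?N" "l < ?N" for i r l
      using that Xc(1) Xi[OF that(1)] digit_bounds[OF that(2)] digit_bounds[OF that(3)] by auto
    have "(R * kron ?P (1\<^sub>m d) * adj R) $$ (p, q) =
        (\<Sum>i<d. \<Sum>l<?N. \<Sum>c<?N. (?T ! i) $$ (p, l) * ?P $$ (l, c) * cnj ((?T ! i) $$ (q, c)))"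
      unfolding R by (rule row_matrix_conj[OF P p q])
    also have "\<dots> = (\<Sum>i<d. \<Sum>l<?N. \<Sum>c<?N. (if p1 = l div n then 1 else 0) * ((if q1 = c div n then 1 else 0) *
        ((X ! i) $$ (p0, l mod n) * ?P $$ (l div n * n + l mod n, c div n * n + c mod n) * cnj ((X ! i) $$ (q0, c mod n)))))"
      using p q by (intro sum.cong refl) (simp add: T d del: map_map nth_map)
    also have "\<dots> = (\<Sum>i<d. \<Sum>l<?N. (\<Sum>c1<n. \<Sum>c<n. (if p1 = l div n then 1 else 0) * ((if q1 = c1 then 1 else 0) *
        ((X ! i) $$ (p0, l mod n) * ?P $$ (l div n * n + l mod n, c1 * n + c) * cnj ((X ! i) $$ (q0, c))))))"
      by (rule sum.cong[OF refl], rule sum.cong[OF refl], rule sum_digits)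
    also have "\<dots> = (\<Sum>i<d. \<Sum>l1<n. \<Sum>l<n. (\<Sum>c1<n. \<Sum>c<n. (if p1 = l1 then 1 else 0) * ((if q1 = c1 then 1 else 0) *
        ((X ! i) $$ (p0, l) * ?P $$ (l1 * n + l, c1 * n + c) * cnj ((X ! i) $$ (q0, c))))))"
      by (rule sum.cong[OF refl], rule sum_digits)
    also have "\<dots> = (\<Sum>i<d. \<Sum>l<n. \<Sum>c<n. (X ! i) $$ (p0, l) * ?P $$ (p1 * n + l, q1 * n + c) * cnj ((X ! i) $$ (q0, c)))"
      using b by (simp add: sum_delta_mult flip: sum_distrib_left)
    also have "\<dots> = (\<Sum>i<d. \<Sum>l<n. \<Sum>c<n. cnj ((X ! i) $$ (q0, c)) * (X ! i) $$ (p0, l) * G $$ (c * n + l, q1 * n + p1))"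
      using b by (intro sum.cong refl) (simp only: lessThan_iff PG b, simp add: mult_ac)
    also have "\<dots> = (\<Sum>i<d. \<Sum>c<n. \<Sum>l<n. cnj ((X ! i) $$ (q0, c)) * (X ! i) $$ (p0, l) * G $$ (c * n + l, q1 * n + p1))"
      by (rule sum.cong[OF refl], rule sum.swap)
    also have "\<dots> = (\<Sum>c<n. \<Sum>i<d. \<Sum>l<n. cnj ((X ! i) $$ (q0, c)) * (X ! i) $$ (p0, l) * G $$ (c * n + l, q1 * n + p1))"
      by (rule sum.swap)
    also have "\<dots> = (\<Sum>c<n. \<Sum>l<n. (\<Sum>i<d. cnj ((X ! i) $$ (q0, c)) * (X ! i) $$ (p0, l)) * G $$ (c * n + l, q1 * n + p1))"
      unfolding sum_distrib_right by (rule sum.cong[OF refl], rule sum.swap)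
    also have "\<dots> = (\<Sum>k<?N. (\<Sum>i<d. cnj ((X ! i) $$ (q0, k div n)) * (X ! i) $$ (p0, k mod n)) * G $$ (k div n * n + k mod n, q1 * n + p1))"
      by (rule sum_digits[symmetric])
    also have "\<dots> = (\<Sum>k<?N. ?M $$ (q0 * n + p0, k) * G $$ (k, q1 * n + p1))"
      using lt b by (intro sum.cong refl) (simp add: index_pick_operator[OF Xc])
    finally have conj: "(R * kron ?P (1\<^sub>m d) * adj R) $$ (p, q) = \<dots>" .
    have "(1\<^sub>m ?N :: complex mat) $$ (q0 * n + p0, q1 * n + p1) = ((1\<^sub>m ?N - ?M) * G) $$ (q0 * n + p0, q1 * n + p1)"
      by (simp only: G(3))
    also have "\<dots> = (\<Sum>k<?N. ((if q0 * n + p0 = k then 1 else 0) - ?M $$ (q0 * n + p0, k)) * G $$ (k, q1 * n + p1))"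
      using lt by (subst index_mult_sum) (auto intro!: sum.cong)
    also have "\<dots> = G $$ (q0 * n + p0, q1 * n + p1) - (\<Sum>k<?N. ?M $$ (q0 * n + p0, k) * G $$ (k, q1 * n + p1))"
      by (rule sum_index_diff_one[OF lt(1)])
    also have "\<dots> = ?P $$ (p, q) - (R * kron ?P (1\<^sub>m d) * adj R) $$ (p, q)"
      unfolding conj using b by (simp add: pq PG)
    finally have "?P $$ (p, q) - (R * kron ?P (1\<^sub>m d) * adj R) $$ (p, q) =
        (if q0 = q1 \<and> p0 = p1 then 1 else 0)"
      using lt b by (simp add: eq_id)
    then show "(?P - R * kron ?P (1\<^sub>m d) * adj R) $$ (p, q) = (vec_identity n * adj (vec_identity n)) $$ (p, q)"
      using p q by (auto simp: vec_identity_gram d simp del: index_mult_mat(1))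
  qed auto
  show "?P - C * kron (1\<^sub>m d) ?P * adj C = vec_identity n * adj (vec_identity n)"
  proof (rule eq_matI)
    fix p q assume "p < dim_row (vec_identity n * adj (vec_identity n))"
      "q < dim_col (vec_identity n * adj (vec_identity n))"
    then have p: "p < ?N" and q: "q < ?N" by auto
    define p1 p0 q1 q0 where d: "p1 = p div n" "p0 = p mod n" "q1 = q div n" "q0 = q mod n"
    have b: "p1 < n" "p0 < n" "q1 < n" "q0 < n" using digit_bounds[OF p] digit_bounds[OF q] by (auto simp: d)
    have pq: "p = p1 * n + p0" "q = q1 * n + q0" by (simp_all add: d)
    note lt = digits_less[OF b(4,2)] digits_less[OF b(3,1)]
    have T: "(?C ! i) $$ (r, l) = (if r mod n = l mod n then 1 else 0) * (X ! i) $$ (l div n, r div n)"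
      if "i < d" "r < ?N" "l < ?N" for i r l
      using that Xc(1) Xi[OF that(1)] digit_bounds[OF that(2)] digit_bounds[OF that(3)] by auto
    have "(C * kron (1\<^sub>m d) ?P * adj C) $$ (p, q) =
        (\<Sum>i<d. \<Sum>l<?N. \<Sum>c<?N. (?C ! i) $$ (p, l) * ?P $$ (l, c) * cnj ((?C ! i) $$ (q, c)))"
      unfolding C by (rule row_matrix_swapped_conj[OF P p q])
    also have "\<dots> = (\<Sum>i<d. \<Sum>l<?N. \<Sum>c<?N. (if p0 = l mod n then 1 else 0) * ((if q0 = c mod n then 1 else 0) *
        ((X ! i) $$ (l div n, p1) * ?P $$ (l div n * n + l mod n, c div n * n + c mod n) * cnj ((X ! i) $$ (c div n, q1)))))"
      using p q by (intro sum.cong refl) (simp add: T d del: map_map nth_map)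
    also have "\<dots> = (\<Sum>i<d. \<Sum>l<?N. (\<Sum>c<n. \<Sum>c0<n. (if p0 = l mod n then 1 else 0) * ((if q0 = c0 then 1 else 0) *
        ((X ! i) $$ (l div n, p1) * ?P $$ (l div n * n + l mod n, c * n + c0) * cnj ((X ! i) $$ (c, q1))))))"
      by (rule sum.cong[OF refl], rule sum.cong[OF refl], rule sum_digits)
    also have "\<dots> = (\<Sum>i<d. \<Sum>l<n. \<Sum>l0<n. (\<Sum>c<n. \<Sum>c0<n. (if p0 = l0 then 1 else 0) * ((if q0 = c0 then 1 else 0) *
        ((X ! i) $$ (l, p1) * ?P $$ (l * n + l0, c * n + c0) * cnj ((X ! i) $$ (c, q1))))))"
      by (rule sum.cong[OF refl], rule sum_digits)
    also have "\<dots> = (\<Sum>i<d. \<Sum>l<n. \<Sum>c<n. (X ! i) $$ (l, p1) * ?P $$ (l * n + p0, c * n + q0) * cnj ((X ! i) $$ (c, q1)))"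
      using b by (simp add: sum_delta_mult flip: sum_distrib_left)
    also have "\<dots> = (\<Sum>i<d. \<Sum>l<n. \<Sum>c<n. G $$ (q0 * n + p0, c * n + l) * (cnj ((X ! i) $$ (c, q1)) * (X ! i) $$ (l, p1)))"
      using b by (intro sum.cong refl) (simp only: lessThan_iff PG b, simp add: mult_ac)
    also have "\<dots> = (\<Sum>i<d. \<Sum>c<n. \<Sum>l<n. G $$ (q0 * n + p0, c * n + l) * (cnj ((X ! i) $$ (c, q1)) * (X ! i) $$ (l, p1)))"
      by (rule sum.cong[OF refl], rule sum.swap)
    also have "\<dots> = (\<Sum>c<n. \<Sum>i<d. \<Sum>l<n. G $$ (q0 * n + p0, c * n + l) * (cnj ((X ! i) $$ (c, q1)) * (X ! i) $$ (l, p1)))"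
      by (rule sum.swap)
    also have "\<dots> = (\<Sum>c<n. \<Sum>l<n. G $$ (q0 * n + p0, c * n + l) * (\<Sum>i<d. cnj ((X ! i) $$ (c, q1)) * (X ! i) $$ (l, p1)))"
      unfolding sum_distrib_left by (rule sum.cong[OF refl], rule sum.swap)
    also have "\<dots> = (\<Sum>k<?N. G $$ (q0 * n + p0, k div n * n + k mod n) * (\<Sum>i<d. cnj ((X ! i) $$ (k div n, q1)) * (X ! i) $$ (k mod n, p1)))"
      by (rule sum_digits[symmetric])
    also have "\<dots> = (\<Sum>k<?N. G $$ (q0 * n + p0, k) * ?M $$ (k, q1 * n + p1))"
      using lt b by (intro sum.cong refl) (simp add: index_pick_operator[OF Xc])
    finally have conj: "(C * kron (1\<^sub>m d) ?P * adj C) $$ (p, q) = \<dots>" .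
    have "(1\<^sub>m ?N :: complex mat) $$ (q0 * n + p0, q1 * n + p1) = (G * (1\<^sub>m ?N - ?M)) $$ (q0 * n + p0, q1 * n + p1)"
      by (simp only: G(4))
    also have "\<dots> = (\<Sum>k<?N. G $$ (q0 * n + p0, k) * ((if k = q1 * n + p1 then 1 else 0) - ?M $$ (k, q1 * n + p1)))"
      using lt by (subst index_mult_sum) (auto intro!: sum.cong)
    also have "\<dots> = G $$ (q0 * n + p0, q1 * n + p1) - (\<Sum>k<?N. G $$ (q0 * n + p0, k) * ?M $$ (k, q1 * n + p1))"
      by (rule sum_index_diff_one[OF lt(2)])
    also have "\<dots> = ?P $$ (p, q) - (C * kron (1\<^sub>m d) ?P * adj C) $$ (p, q)"
      unfolding conj using b by (simp add: pq PG)
    finally have "?P $$ (p, q) - (C * kron (1\<^sub>m d) ?P * adj C) $$ (p, q) =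
        (if q0 = q1 \<and> p0 = p1 then 1 else 0)"
      using lt b by (simp add: eq_id)
    then show "(?P - C * kron (1\<^sub>m d) ?P * adj C) $$ (p, q) = (vec_identity n * adj (vec_identity n)) $$ (p, q)"
      using p q by (auto simp: vec_identity_gram d simp del: index_mult_mat(1))
  qed auto
qed

lemma ampliation_in_row_ball:
  assumes X: "X \<in> row_ball_level d n"
  shows "map (kron (1\<^sub>m k)) X \<in> row_ball_level d (k * n)"
proof -
  note Xc = row_ball_levelD(1,2)[OF X]
  let ?r = "row_matrix d n X"
  let ?R = "kron (1\<^sub>m k) ?r"
  obtain c where c: "0 < c" "c < 1" "psd (scalar_mat c n - ?r * adj ?r)"
    using row_ball_levelD(3)[OF X] by blast
  have C: "scalar_mat c n - ?r * adj ?r \<in> carrier_mat n n" by (rule carrier_matI) simp_all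
  have "kron (1\<^sub>m k) (scalar_mat c n - ?r * adj ?r) =
      scalar_mat c (k * n) - ?R * adj ?R"
    by (simp add: kron_minus kron_smult kron_one kron_adj kron_mult mat_units)
  moreover have "row_matrix d (k * n) (map (kron (1\<^sub>m k)) X) = ?R"
    by (rule row_matrix_ampliation) (use Xc nth_mem in blast)+
  ultimately have eq: "kron (1\<^sub>m k) (scalar_mat c n - ?r * adj ?r) =
      scalar_mat c (k * n) - row_matrix d (k * n) (map (kron (1\<^sub>m k)) X) *
        adj (row_matrix d (k * n) (map (kron (1\<^sub>m k)) X))" by simp
  have "psd (kron (1\<^sub>m k) (scalar_mat c n - ?r * adj ?r))"
    by (rule psd_kron_one(2)[OF C c(3)])
  moreover have "set (map (kron (1\<^sub>m k)) X) \<subseteq> carrier_mat (k * n) (k * n)"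
    using Xc(2) by auto
  ultimately show ?thesis
    using c(1,2) Xc(1) unfolding eq by (subst row_ball_level_iff) (simp, simp, blast)
qed

text \<open>By the first Stein equation the defect of P is the Gram matrix of vec I, and a positive
  defect forces a positive solution.\<close>

lemma pick_matrix_psd:
  assumes X: "X \<in> row_ball_level d n"
  shows "psd (pick_matrix n X)"
proof -
  note Xc = row_ball_levelD(1,2)[OF X]
  let ?R = "kron (1\<^sub>m n) (row_matrix d n X)"
  have row: "row_matrix d (n * n) (map (kron (1\<^sub>m n)) X) = ?R"
    by (rule row_matrix_ampliation) (use Xc nth_mem in blast)+
  obtain c where c: "0 < c" "c < 1" "psd (scalar_mat c (n * n) - ?R * adj ?R)"
    using row_ball_levelD(3)[OF ampliation_in_row_ball[OF X, of n]] unfolding row by blast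
  have R: "?R \<in> carrier_mat (n * n) (n * n * d)" by (rule carrier_matI) (simp_all add: mult.assoc)
  have "psd (pick_matrix n X - ?R * kron (pick_matrix n X) (1\<^sub>m d) * adj ?R)"
    unfolding pick_matrix_stein(1)[OF X] by (rule psd_gram)
  then show ?thesis
    by (rule stein_psd[OF R less_imp_le[OF c(1)] c(2,3) pick_matrix_carrier])
qed

section \<open>Matrices of matrices\<close>

text \<open>The tensor \<open>\<Sum> F\<^sub>i\<^sub>j \<otimes> E\<^sub>i\<^sub>j\<close> of an \<open>s \<times> t\<close> array of \<open>a \<times> b\<close> matrices.\<close>

definition tensor_blocks :: "nat \<Rightarrow> nat \<Rightarrow> nat \<Rightarrow> nat \<Rightarrow> (nat \<Rightarrow> nat \<Rightarrow> complex mat) \<Rightarrow> complex mat" where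
  "tensor_blocks a b s t F = mat (a * s) (b * t) (\<lambda>(p, q). F (p mod s) (q mod t) $$ (p div s, q div t))"

lemma dim_tensor_blocks [simp]:
  "dim_row (tensor_blocks a b s t F) = a * s" "dim_col (tensor_blocks a b s t F) = b * t"
  by (simp_all add: tensor_blocks_def)

lemma index_tensor_blocks [simp]:
  "p < a * s \<Longrightarrow> q < b * t \<Longrightarrow>
    tensor_blocks a b s t F $$ (p, q) = F (p mod s) (q mod t) $$ (p div s, q div t)"
  by (simp add: tensor_blocks_def)

lemma tensor_blocks_cong:
  "(\<And>i j. i < s \<Longrightarrow> j < t \<Longrightarrow> F i j = G i j) \<Longrightarrow> tensor_blocks a b s t F = tensor_blocks a b s t G"
  by (intro eq_matI) (auto simp: digit_bounds)

text \<open>The blocks live in the first tensor factor, so \<open>kron T (1\<^sub>m t)\<close>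
  multiplies every block by T. Statements about each function of a matrix of nc functions thus
  become one matrix equation.\<close>

lemma tensor_blocks_mult_kron:
  assumes F: "\<And>i j. i < s \<Longrightarrow> j < t \<Longrightarrow> F i j \<in> carrier_mat a b" and T: "T \<in> carrier_mat b c"
  shows "tensor_blocks a b s t F * kron T (1\<^sub>m t) = tensor_blocks a c s t (\<lambda>i j. F i j * T)"
proof (rule eq_matI)
  have [simp]: "dim_row T = b" "dim_col T = c" using T by auto
  fix p q assume "p < dim_row (tensor_blocks a c s t (\<lambda>i j. F i j * T))"
    "q < dim_col (tensor_blocks a c s t (\<lambda>i j. F i j * T))"
  then have p: "p < a * s" and q: "q < c * t" by auto
  note bounds = digit_bounds[OF p] digit_bounds[OF q]
  have [simp]: "dim_row (F (p mod s) (q mod t)) = a" "dim_col (F (p mod s) (q mod t)) = b"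
    using F[OF bounds(2,4)] by auto
  have "(tensor_blocks a b s t F * kron T (1\<^sub>m t)) $$ (p, q) =
      (\<Sum>k<b * t. F (p mod s) (k mod t) $$ (p div s, k div t) * (T $$ (k div t, q div t) * (if k mod t = q mod t then 1 else 0)))"
    using p q by (subst index_mult_sum) (auto simp: digit_bounds)
  also have "\<dots> = (\<Sum>k<b. \<Sum>j<t. F (p mod s) j $$ (p div s, k) * (T $$ (k, q div t) * (if j = q mod t then 1 else 0)))"
    by (rule sum_digits)
  also have "\<dots> = (\<Sum>k<b. \<Sum>j<t. (if q mod t = j then 1 else 0) * (F (p mod s) j $$ (p div s, k) * T $$ (k, q div t)))"
    by (intro sum.cong) auto
  also have "\<dots> = (F (p mod s) (q mod t) * T) $$ (p div s, q div t)"
    using bounds by (simp add: sum_delta_mult index_mult_sum del: index_mult_mat(1))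
  finally show "(tensor_blocks a b s t F * kron T (1\<^sub>m t)) $$ (p, q) =
      tensor_blocks a c s t (\<lambda>i j. F i j * T) $$ (p, q)" using p q by simp
qed (use T in auto)

lemma kron_mult_tensor_blocks:
  assumes F: "\<And>i j. i < s \<Longrightarrow> j < t \<Longrightarrow> F i j \<in> carrier_mat b c" and T: "T \<in> carrier_mat a b"
  shows "kron T (1\<^sub>m s) * tensor_blocks b c s t F = tensor_blocks a c s t (\<lambda>i j. T * F i j)"
proof (rule eq_matI)
  have [simp]: "dim_row T = a" "dim_col T = b" using T by auto
  fix p q assume "p < dim_row (tensor_blocks a c s t (\<lambda>i j. T * F i j))"
    "q < dim_col (tensor_blocks a c s t (\<lambda>i j. T * F i j))"
  then have p: "p < a * s" and q: "q < c * t" by auto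
  note bounds = digit_bounds[OF p] digit_bounds[OF q]
  have [simp]: "dim_row (F (p mod s) (q mod t)) = b" "dim_col (F (p mod s) (q mod t)) = c"
    using F[OF bounds(2,4)] by auto
  have "(kron T (1\<^sub>m s) * tensor_blocks b c s t F) $$ (p, q) =
      (\<Sum>k<b * s. (T $$ (p div s, k div s) * (if p mod s = k mod s then 1 else 0)) * F (k mod s) (q mod t) $$ (k div s, q div t))"
    using p q by (subst index_mult_sum) (auto simp: digit_bounds)
  also have "\<dots> = (\<Sum>k<b. \<Sum>j<s. (T $$ (p div s, k) * (if p mod s = j then 1 else 0)) * F j (q mod t) $$ (k, q div t))"
    by (rule sum_digits)
  also have "\<dots> = (\<Sum>k<b. \<Sum>j<s. (if p mod s = j then 1 else 0) * (T $$ (p div s, k) * F j (q mod t) $$ (k, q div t)))"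
    by (intro sum.cong) auto
  also have "\<dots> = (T * F (p mod s) (q mod t)) $$ (p div s, q div t)"
    using bounds by (simp add: sum_delta_mult index_mult_sum del: index_mult_mat(1))
  finally show "(kron T (1\<^sub>m s) * tensor_blocks b c s t F) $$ (p, q) =
      tensor_blocks a c s t (\<lambda>i j. T * F i j) $$ (p, q)" using p q by simp
qed (use T in auto)

lemma kron_tensor_blocks:
  assumes F: "\<And>i j. i < s \<Longrightarrow> j < t \<Longrightarrow> F i j \<in> carrier_mat a b"
  shows "kron (1\<^sub>m k) (tensor_blocks a b s t F) = tensor_blocks (k * a) (k * b) s t (\<lambda>i j. kron (1\<^sub>m k) (F i j))"
proof (rule eq_matI)
  fix p q assume "p < dim_row (tensor_blocks (k * a) (k * b) s t (\<lambda>i j. kron (1\<^sub>m k) (F i j)))"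
    "q < dim_col (tensor_blocks (k * a) (k * b) s t (\<lambda>i j. kron (1\<^sub>m k) (F i j)))"
  then have p: "p < k * a * s" and q: "q < k * b * t" by auto
  have p': "p < k * (a * s)" and q': "q < k * (b * t)" using p q by (simp_all add: mult.assoc)
  have digits: "r mod (x * y) div y = r div y mod x" "r mod (x * y) mod y = r mod y"
    "r div (x * y) = r div y div x" if "r < k * x * y" for r x y :: nat
  proof -
    have "r mod (x * y) = y * (r div y mod x) + r mod y" using mod_mult2_eq[of r y x] by (simp only: mult.commute)
    moreover have "y > 0" using that by (cases y) auto
    ultimately show "r mod (x * y) div y = r div y mod x" "r mod (x * y) mod y = r mod y" by simp_all
    show "r div (x * y) = r div y div x" by (metis div_mult2_eq mult.commute)
  qed
  have [simp]: "dim_row (F (p mod s) (q mod t)) = a" "dim_col (F (p mod s) (q mod t)) = b"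
    using F[OF digit_bounds(2)[OF p] digit_bounds(2)[OF q]] by auto
  show "kron (1\<^sub>m k) (tensor_blocks a b s t F) $$ (p, q) =
      tensor_blocks (k * a) (k * b) s t (\<lambda>i j. kron (1\<^sub>m k) (F i j)) $$ (p, q)"
    using p q p' q' digit_bounds[OF p] digit_bounds[OF q] digit_bounds[OF p'] digit_bounds[OF q']
      digit_bounds[OF digit_bounds(1)[OF p]] digit_bounds[OF digit_bounds(1)[OF q]]
    by (simp add: digits[OF p] digits[OF q])
qed (auto simp: mult.assoc)

lemma tensor_blocks_inject:
  assumes eq: "tensor_blocks a b s t F = tensor_blocks a b s t G"
    and F: "F i j \<in> carrier_mat a b" and G: "G i j \<in> carrier_mat a b" and ij: "i < s" "j < t"
  shows "F i j = G i j"
proof (rule eq_matI)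
  fix p q assume "p < dim_row (G i j)" "q < dim_col (G i j)"
  then have pq: "p < a" "q < b" using G by auto
  have "tensor_blocks a b s t F $$ (p * s + i, q * t + j) = tensor_blocks a b s t G $$ (p * s + i, q * t + j)"
    by (simp only: eq)
  then show "F i j $$ (p, q) = G i j $$ (p, q)"
    using digits_less[OF pq(1) ij(1)] digits_less[OF pq(2) ij(2)] ij by simp
qed (use F G in auto)

lemma sum_list_concat_map:
  "(\<Sum>x\<leftarrow>concat (map f xs). g x) = (\<Sum>y\<leftarrow>xs. \<Sum>x\<leftarrow>f y. (g x :: complex))"
  by (induction xs) auto

lemma block_tensor_eq:
  assumes Y: "Y \<in> carrier_mat s t" and blocks: "\<And>i j. i < s \<Longrightarrow> j < t \<Longrightarrow> Y $$ (i, j) \<in> carrier_mat n n"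
  shows "block_tensor n Y = tensor_blocks n n s t (\<lambda>i j. Y $$ (i, j))"
proof (rule eq_matI)
  have [simp]: "dim_row Y = s" "dim_col Y = t" using Y by auto
  define As where "As = [kron (Y $$ (i, j)) (matrix_unit s t i j). i \<leftarrow> [0..<s], j \<leftarrow> [0..<t]]"
  have As: "set As \<subseteq> carrier_mat (n * s) (n * t)"
    using blocks by (auto simp: As_def matrix_unit_def)
  have eq: "block_tensor n Y = mat_list_sum (n * s) (n * t) As" by (simp add: block_tensor_def As_def)
  have carrier: "block_tensor n Y \<in> carrier_mat (n * s) (n * t)"
    unfolding eq by (rule mat_list_sum_carrier[OF As])
  show "dim_row (block_tensor n Y) = dim_row (tensor_blocks n n s t (\<lambda>i j. Y $$ (i, j)))"
    "dim_col (block_tensor n Y) = dim_col (tensor_blocks n n s t (\<lambda>i j. Y $$ (i, j)))"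
    using carrier by auto
  fix p q assume "p < dim_row (tensor_blocks n n s t (\<lambda>i j. Y $$ (i, j)))"
    "q < dim_col (tensor_blocks n n s t (\<lambda>i j. Y $$ (i, j)))"
  then have p: "p < n * s" and q: "q < n * t" by auto
  note bounds = digit_bounds[OF p] digit_bounds[OF q]
  have "block_tensor n Y $$ (p, q) = (\<Sum>A\<leftarrow>As. A $$ (p, q))"
    unfolding eq index_mat_list_sum[OF As p q] by (simp add: sum_list_sum_nth atLeast0LessThan)
  also have "\<dots> = (\<Sum>i<s. \<Sum>j<t. kron (Y $$ (i, j)) (matrix_unit s t i j) $$ (p, q))"
    unfolding As_def sum_list_concat_map
    by (simp add: interv_sum_list_conv_sum_set_nat atLeast0LessThan o_def)
  also have "\<dots> = (\<Sum>i<s. (if p mod s = i then 1 else 0) * (\<Sum>j<t. (if q mod t = j then 1 else 0) * Y $$ (i, j) $$ (p div s, q div t)))"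
    unfolding sum_distrib_left
  proof (intro sum.cong refl)
    fix i j assume "i \<in> {..<s}" "j \<in> {..<t}"
    then have "dim_row (Y $$ (i, j)) = n" "dim_col (Y $$ (i, j)) = n" using blocks[of i j] by auto
    then show "kron (Y $$ (i, j)) (matrix_unit s t i j) $$ (p, q) =
        (if p mod s = i then 1 else 0) * ((if q mod t = j then 1 else 0) * Y $$ (i, j) $$ (p div s, q div t))"
      using p q bounds by (simp add: matrix_unit_def)
  qed
  also have "\<dots> = Y $$ (p mod s, q mod t) $$ (p div s, q div t)"
    using bounds by (simp add: sum_delta_mult)
  finally show "block_tensor n Y $$ (p, q) = tensor_blocks n n s t (\<lambda>i j. Y $$ (i, j)) $$ (p, q)"
    using p q by simp
qed

text \<open>Conjugation with the flips \<open>\<complex>\<^sup>a \<otimes> \<complex>\<^sup>b \<rightarrow> \<complex>\<^sup>b \<otimes> \<complex>\<^sup>a\<close> and \<open>\<complex>\<^sup>c \<otimes> \<complex>\<^sup>e \<rightarrow> \<complex>\<^sup>e \<otimes> \<complex>\<^sup>c\<close>.\<close>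

definition swap_factors :: "nat \<Rightarrow> nat \<Rightarrow> nat \<Rightarrow> nat \<Rightarrow> complex mat \<Rightarrow> complex mat" where
  "swap_factors a b c e A = mat (b * a) (e * c)
     (\<lambda>(p, q). A $$ ((p mod a) * b + p div a, (q mod c) * e + q div c))"

lemma dim_swap_factors [simp]:
  "dim_row (swap_factors a b c e A) = b * a" "dim_col (swap_factors a b c e A) = e * c"
  by (simp_all add: swap_factors_def)

lemma index_swap_factors [simp]:
  "p < b * a \<Longrightarrow> q < e * c \<Longrightarrow>
    swap_factors a b c e A $$ (p, q) = A $$ ((p mod a) * b + p div a, (q mod c) * e + q div c)"
  by (simp add: swap_factors_def)

text \<open>The flip of the middle space occurs in both factors and cancels; entrywise this is an
  exchange of two sums.\<close>

lemma swap_factors_mult: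
  assumes A: "A \<in> carrier_mat (a * b) (c * e)" and B: "B \<in> carrier_mat (c * e) (f * g)"
  shows "swap_factors a b c e A * swap_factors c e f g B = swap_factors a b f g (A * B)"
proof (rule eq_matI)
  have [simp]: "dim_row A = a * b" "dim_col A = c * e" "dim_row B = c * e" "dim_col B = f * g" using A B by auto
  fix p q assume "p < dim_row (swap_factors a b f g (A * B))" "q < dim_col (swap_factors a b f g (A * B))"
  then have p: "p < b * a" and q: "q < g * f" by auto
  let ?p = "(p mod a) * b + p div a" and ?q = "(q mod f) * g + q div f"
  have pq: "?p < a * b" "?q < f * g"
    using digits_less[OF digit_bounds(2,1)[OF p]] digits_less[OF digit_bounds(2,1)[OF q]] by auto
  have "(swap_factors a b c e A * swap_factors c e f g B) $$ (p, q) =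
      (\<Sum>k<e * c. A $$ (?p, (k mod c) * e + k div c) * B $$ ((k mod c) * e + k div c, ?q))"
    using p q by (subst index_mult_sum) auto
  also have "\<dots> = (\<Sum>i<e. \<Sum>j<c. A $$ (?p, j * e + i) * B $$ (j * e + i, ?q))"
    by (rule sum_digits)
  also have "\<dots> = (\<Sum>j<c. \<Sum>i<e. A $$ (?p, j * e + i) * B $$ (j * e + i, ?q))" by (rule sum.swap)
  also have "\<dots> = (\<Sum>k<c * e. A $$ (?p, k div e * e + k mod e) * B $$ (k div e * e + k mod e, ?q))"
    by (rule sum_digits[symmetric])
  also have "\<dots> = (A * B) $$ (?p, ?q)"
    using pq by (subst index_mult_sum) auto
  finally show "(swap_factors a b c e A * swap_factors c e f g B) $$ (p, q) =
      swap_factors a b f g (A * B) $$ (p, q)" using p q by simp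
qed auto

lemma swap_factors_adj:
  assumes A: "A \<in> carrier_mat (a * b) (c * e)"
  shows "adj (swap_factors a b c e A) = swap_factors c e a b (adj A)"
proof (rule eq_matI)
  fix p q assume "p < dim_row (swap_factors c e a b (adj A))" "q < dim_col (swap_factors c e a b (adj A))"
  then have p: "p < e * c" and q: "q < b * a" by auto
  then show "adj (swap_factors a b c e A) $$ (p, q) = swap_factors c e a b (adj A) $$ (p, q)"
    using A digits_less[OF digit_bounds(2,1)[OF p]] digits_less[OF digit_bounds(2,1)[OF q]] by auto
qed auto

lemma swap_factors_one_minus:
  assumes A: "A \<in> carrier_mat (a * b) (a * b)"
  shows "swap_factors a b a b (1\<^sub>m (a * b) - A) = 1\<^sub>m (b * a) - swap_factors a b a b A"
proof (rule eq_matI)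
  fix p q assume "p < dim_row (1\<^sub>m (b * a) - swap_factors a b a b A)" "q < dim_col (1\<^sub>m (b * a) - swap_factors a b a b A)"
  then have p: "p < b * a" and q: "q < b * a" by auto
  have eq: "(p mod a) * b + p div a = (q mod a) * b + q div a \<longleftrightarrow> p = q"
  proof
    assume e: "(p mod a) * b + p div a = (q mod a) * b + q div a"
    from arg_cong[OF e, of "\<lambda>x. x div b"] arg_cong[OF e, of "\<lambda>x. x mod b"]
    have "p mod a = q mod a" "p div a = q div a" using digit_bounds[OF p] digit_bounds[OF q] by auto
    then show "p = q" by (metis div_mult_mod_eq)
  qed simp
  show "swap_factors a b a b (1\<^sub>m (a * b) - A) $$ (p, q) = (1\<^sub>m (b * a) - swap_factors a b a b A) $$ (p, q)"
    using A p q digits_less[OF digit_bounds(2,1)[OF p]] digits_less[OF digit_bounds(2,1)[OF q]] eq by auto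
qed auto

lemma swap_factors_psd:
  assumes A: "A \<in> carrier_mat (a * b) (a * b)" and psd: "psd A"
  shows "psd (swap_factors a b a b A)"
proof -
  obtain B where B: "B \<in> carrier_mat (a * b) (a * b)" "A = B * adj B" using psd_factor[OF A psd] by blast
  then have "swap_factors a b a b A = swap_factors a b a b B * adj (swap_factors a b a b B)"
    by (simp add: swap_factors_mult swap_factors_adj)
  then show ?thesis by (simp add: psd_gram)
qed

section \<open>Norms of block matrices\<close>

lemma op_norm_le_one_iff:
  assumes A: "A \<in> carrier_mat n m"
  shows "op_norm A \<le> 1 \<longleftrightarrow> psd (1\<^sub>m n - A * adj A)"
proof -
  have one: "scalar_mat (1\<^sup>2) m = 1\<^sub>m m" by (intro eq_matI) auto
  have "op_norm A \<le> 1 \<longleftrightarrow> psd (1\<^sub>m m - adj A * A)"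
    using op_norm_le_iff[OF A, of 1] unfolding one by simp
  also have "\<dots> \<longleftrightarrow> psd (1\<^sub>m n - A * adj A)"
  proof
    assume "psd (1\<^sub>m m - adj A * A)"
    then have "psd (1\<^sub>m m - adj A * adj (adj A))" by (simp only: adj_adj)
    from psd_coisometry[OF this adj_carrier[OF A]] show "psd (1\<^sub>m n - A * adj A)" by (simp only: adj_adj)
  qed (rule psd_coisometry[OF _ A])
  finally show ?thesis .
qed

text \<open>The array and the tensor of the blocks differ by flips of the tensor factors, which
  preserve contractivity in both directions. The norm in \<open>H_infinity_norm\<close> can thus be
  tested on the tensor, the form in which the Pick inequality is stated.\<close>

lemma block_matrix_norm_iff:
  assumes F: "F \<in> carrier_mat s t" and blocks: "\<And>i j. i < s \<Longrightarrow> j < t \<Longrightarrow> F $$ (i, j) \<in> carrier_mat m m"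
  defines "\<Phi> \<equiv> tensor_blocks m m s t (\<lambda>i j. F $$ (i, j))"
  shows "op_norm (block_matrix m F) \<le> 1 \<longleftrightarrow> psd (1\<^sub>m (m * s) - \<Phi> * adj \<Phi>)"
proof -
  let ?B = "block_matrix m F"
  have [simp]: "dim_row F = s" "dim_col F = t" using F by auto
  have B: "?B \<in> carrier_mat (s * m) (t * m)" by (simp add: block_matrix_def)
  have \<Phi>: "\<Phi> \<in> carrier_mat (m * s) (m * t)" by (rule carrier_matI) (simp_all add: \<Phi>_def)
  have BF: "\<Phi> = swap_factors s m t m ?B"
  proof (rule eq_matI)
    fix p q assume "p < dim_row (swap_factors s m t m ?B)" "q < dim_col (swap_factors s m t m ?B)"
    then have p: "p < m * s" and q: "q < m * t" by auto
    then show "\<Phi> $$ (p, q) = swap_factors s m t m ?B $$ (p, q)"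
      using digits_less[OF digit_bounds(2,1)[OF p]] digits_less[OF digit_bounds(2,1)[OF q]]
        digit_bounds[OF p] digit_bounds[OF q]
      by (simp add: \<Phi>_def block_matrix_def)
  qed (simp_all add: \<Phi>_def)
  have FB: "?B = swap_factors m s m t \<Phi>"
  proof (rule eq_matI)
    fix p q assume "p < dim_row (swap_factors m s m t \<Phi>)" "q < dim_col (swap_factors m s m t \<Phi>)"
    then have p: "p < s * m" and q: "q < t * m" by auto
    then show "?B $$ (p, q) = swap_factors m s m t \<Phi> $$ (p, q)"
      using digits_less[OF digit_bounds(2,1)[OF p]] digits_less[OF digit_bounds(2,1)[OF q]]
        digit_bounds[OF p] digit_bounds[OF q]
      by (simp add: \<Phi>_def block_matrix_def)
  qed (simp_all add: block_matrix_def)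
  have flip: "psd (1\<^sub>m (y * x) - swap_factors x y z w A * adj (swap_factors x y z w A))"
    if A: "A \<in> carrier_mat (x * y) (z * w)" and psd: "psd (1\<^sub>m (x * y) - A * adj A)" for x y z w A
  proof -
    have AA: "A * adj A \<in> carrier_mat (x * y) (x * y)" by (rule mult_carrier_mat[OF A adj_carrier[OF A]])
    have "psd (swap_factors x y x y (1\<^sub>m (x * y) - A * adj A))"
      by (rule swap_factors_psd[OF minus_carrier_mat[OF AA] psd])
    then show ?thesis
      by (simp add: swap_factors_one_minus[OF AA] swap_factors_adj[OF A]
          swap_factors_mult[OF A adj_carrier[OF A]])
  qed
  show ?thesis
    unfolding op_norm_le_one_iff[OF B]
    using flip[OF B] flip[OF \<Phi>] BF FB by metis
qed
section \<open>Necessity\<close>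

text \<open>As the identity stands in the first factor, one more copy of A is one more diagonal
  block. By induction, respect for direct sums then gives the value of an nc function at an
  ampliation.\<close>

lemma kron_one_Suc:
  "direct_sum (kron (1\<^sub>m k) A) A = kron (1\<^sub>m (Suc k)) A"
proof (rule eq_matI)
  fix p q assume "p < dim_row (kron (1\<^sub>m (Suc k)) A)" "q < dim_col (kron (1\<^sub>m (Suc k)) A)"
  then have p: "p < Suc k * dim_row A" and q: "q < Suc k * dim_col A" by auto
  have digits: "x div n = (if x < k * n then x div n else k)" "x mod n = (if x < k * n then x mod n else x - k * n)"
    "x < k * n \<Longrightarrow> x div n < k"
    if "x < Suc k * n" for x n :: nat
  proof -
    show "x < k * n \<Longrightarrow> x div n < k" by (rule digit_bounds)
    have n: "n > 0" using that by (cases n) auto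
    have "x div n = k \<and> x mod n = x - k * n" if "\<not> x < k * n"
    proof -
      have "x = k * n + (x - k * n)" "x - k * n < n" using that \<open>x < Suc k * n\<close> by auto
      then show ?thesis using n by (metis add.right_neutral div_less div_mult_self3 mod_less mod_mult_self3 not_less0)
    qed
    then show "x div n = (if x < k * n then x div n else k)" "x mod n = (if x < k * n then x mod n else x - k * n)"
      by auto
  qed
  show "direct_sum (kron (1\<^sub>m k) A) A $$ (p, q) = kron (1\<^sub>m (Suc k)) A $$ (p, q)"
    using p q digits[OF p] digits[OF q] digit_bounds[OF p] digit_bounds[OF q]
    by (simp add: direct_sum_def split: if_splits)
qed (simp_all add: direct_sum_def)

lemma nc_function_ampliation:
  assumes f: "nc_function d f" and X: "X \<in> row_ball_level d n" and n: "1 \<le> n" and k: "1 \<le> k"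
  shows "f (map (kron (1\<^sub>m k)) X) = kron (1\<^sub>m k) (f X)"
  using k
proof (induction k rule: dec_induct)
  case base
  have "map (kron (1\<^sub>m 1)) X = X" by (rule map_idI) (rule kron_one_left)
  then show ?case by (simp add: kron_one_left del: One_nat_def)
next
  case (step k)
  have "map2 direct_sum (map (kron (1\<^sub>m k)) X) X = map (kron (1\<^sub>m (Suc k))) X"
    by (rule nth_equalityI) (simp_all add: kron_one_Suc)
  moreover have "map (kron (1\<^sub>m k)) X \<in> row_ball d" "X \<in> row_ball d"
    using ampliation_in_row_ball[OF X, of k] X step(1) n unfolding row_ball_def by force+
  ultimately show ?case using f step(3) kron_one_Suc unfolding nc_function_def by metis
qed

text \<open>The row of the conjugated tuple is T R (S \<otimes> I). Congruence of the hypothesis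
  with T sends \<open>S * adj S\<close> to the identity and leaves the margin 1 - \<delta>.\<close>

lemma similarity_in_row_ball:
  assumes Z: "length Z = d" "set Z \<subseteq> carrier_mat N N"
    and c: "S \<in> carrier_mat N N" "T \<in> carrier_mat N N" and ST: "S * T = 1\<^sub>m N" "T * S = 1\<^sub>m N"
    and \<delta>: "0 < \<delta>" "\<delta> < 1"
    and psd: "psd (S * adj S - row_matrix d N Z * kron (S * adj S) (1\<^sub>m d) * adj (row_matrix d N Z)
      - complex_of_real \<delta> \<cdot>\<^sub>m (S * adj S))"
  shows "map (\<lambda>A. T * A * S) Z \<in> row_ball_level d N"
proof -
  have [simp]: "dim_row S = N" "dim_col S = N" "dim_row T = N" "dim_col T = N" using c by auto
  let ?Z = "map (\<lambda>A. T * A * S) Z" and ?R = "row_matrix d N Z"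
  let ?r = "row_matrix d N ?Z"
  have Zk: "Z ! k \<in> carrier_mat N N" if "k < d" for k using Z that nth_mem by blast
  have Zc: "set ?Z \<subseteq> carrier_mat N N"
  proof
    fix A assume "A \<in> set ?Z"
    then show "A \<in> carrier_mat N N" by (auto intro!: carrier_matI)
  qed
  have "?r * kron T (1\<^sub>m d) = T * ?R"
  proof (rule row_matrix_intertwine[OF c(2) Zk])
    fix k assume k: "k < d"
    have [simp]: "dim_row (Z ! k) = N" "dim_col (Z ! k) = N" using Zk[OF k] by auto
    show "?Z ! k \<in> carrier_mat N N" using k Z by (auto intro!: carrier_matI)
    show "?Z ! k * T = T * Z ! k" using k Z by (simp add: mat_assoc ST mat_units)
  qed
  then have "?r * kron T (1\<^sub>m d) * kron S (1\<^sub>m d) = T * ?R * kron S (1\<^sub>m d)" by simp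
  then have r: "?r = T * (?R * kron S (1\<^sub>m d))"
    by (simp add: mat_assoc kron_mult ST mat_units kron_one)
  have ST': "adj S * adj T = 1\<^sub>m N" using ST(2) by (simp flip: adj_mult)
  let ?D = "S * adj S - ?R * kron (S * adj S) (1\<^sub>m d) * adj ?R - complex_of_real \<delta> \<cdot>\<^sub>m (S * adj S)"
  have KS: "kron S (1\<^sub>m d) * (kron (adj S) (1\<^sub>m d) * M) = kron (S * adj S) (1\<^sub>m d) * M"
    if "dim_row M = N * d" for M
    using that by (simp add: mat_units kron_mult flip: mat_assoc)
  have TS: "T * (S * M) = M" if "dim_row M = N" for M
    using that by (simp add: mat_units ST flip: mat_assoc)
  have "T * ?D * adj T = scalar_mat (1 - \<delta>) N - ?r * adj ?r"
    by (simp add: r mat_algebra kron_adj TS ST' KS)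
       (intro eq_matI; simp add: algebra_simps del: index_mult_mat(1))
  then have "psd (scalar_mat (1 - \<delta>) N - ?r * adj ?r)"
    using psd_congruence[OF psd, of T] by simp
  then show ?thesis
    using \<delta> Z(1) Zc by (subst row_ball_level_iff) (auto intro!: exI[of _ "1 - \<delta>"])
qed

lemma pick_psd_of_interpolant:
  assumes n: "1 \<le> n" and X: "X \<in> row_ball_level d n" and F: "F \<in> carrier_mat s t"
    and nc: "\<And>i j. i < s \<Longrightarrow> j < t \<Longrightarrow> nc_function d (F $$ (i, j))"
    and norm: "H_infinity_norm d F \<le> 1"
  defines "\<Phi> \<equiv> tensor_blocks n n s t (\<lambda>i j. (F $$ (i, j)) X)"
  shows "psd (kron (pick_matrix n X) (1\<^sub>m s) -
    kron (1\<^sub>m n) \<Phi> * kron (pick_matrix n X) (1\<^sub>m t) * kron (1\<^sub>m n) (adj \<Phi>))"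
proof -
  note Xc = row_ball_levelD(1,2)[OF X]
  let ?N = "n * n" and ?P = "pick_matrix n X" and ?X = "map (kron (1\<^sub>m n)) X"
  let ?r = "row_matrix d n X" and ?R = "row_matrix d ?N ?X" and ?W = "kron (1\<^sub>m n) \<Phi>"
  have N: "1 \<le> ?N" using n by (metis mult_le_mono mult_1)
  have R: "?R = kron (1\<^sub>m n) ?r" by (rule row_matrix_ampliation) (use Xc nth_mem in blast)+
  have Xball: "?X \<in> row_ball_level d ?N" by (rule ampliation_in_row_ball[OF X])
  note Xc' = row_ball_levelD(1,2)[OF Xball]
  have P: "?P \<in> carrier_mat ?N ?N" by (rule pick_matrix_carrier)
  have psdP: "psd ?P" by (rule pick_matrix_psd[OF X])
  have [simp]: "dim_row ?P = ?N" "dim_col ?P = ?N" using P by auto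
  have [simp]: "dim_row \<Phi> = n * s" "dim_col \<Phi> = n * t" by (simp_all add: \<Phi>_def)
  obtain c where c: "0 < c" "c < 1" "psd (scalar_mat c ?N - ?R * adj ?R)"
    using row_ball_levelD(3)[OF Xball] by blast
  have stein: "?P - ?R * kron ?P (1\<^sub>m d) * adj ?R = vec_identity n * adj (vec_identity n)"
    using pick_matrix_stein(1)[OF X] unfolding R .
  \<comment> \<open>The inequality for the perturbed Pick matrix, sorted as the claimed matrix plus
    \<open>e\<close> times a fixed one, which is the shape that \<open>psd_limit\<close>
    takes.\<close>
  have pos: "psd ((kron ?P (1\<^sub>m s) - ?W * kron ?P (1\<^sub>m t) * adj ?W) +
      complex_of_real e \<cdot>\<^sub>m (1\<^sub>m (?N * s) - ?W * adj ?W))" if e: "e > 0" for e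
  proof -
    let ?I = "1\<^sub>m ?N :: complex mat"
    let ?Pe = "?P + complex_of_real e \<cdot>\<^sub>m ?I"
    have Pe: "?Pe \<in> carrier_mat ?N ?N" by (rule carrier_matI) simp_all
    have "?Pe - complex_of_real e \<cdot>\<^sub>m ?I = ?P" by (intro eq_matI) auto
    then have "psd (?Pe - complex_of_real e \<cdot>\<^sub>m ?I)" using psdP by simp
    from positive_definite_factor[OF Pe e this]
    obtain S T where ST: "S \<in> carrier_mat ?N ?N" "T \<in> carrier_mat ?N ?N" "S * T = ?I" "T * S = ?I"
      and PS: "?Pe = S * adj S" by blast
    have [simp]: "dim_row S = ?N" "dim_col S = ?N" "dim_row T = ?N" "dim_col T = ?N" using ST by auto
    have "adj ?Pe = ?Pe" unfolding PS by (simp add: adj_mult)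
    then obtain K where K: "K > 0" "psd (complex_of_real K \<cdot>\<^sub>m ?I - ?Pe)"
      using hermitian_bound[OF Pe] by blast
    \<comment> \<open>Chosen such that \<open>\<delta> * (K + e) = e * (1 - c)\<close>: the gain
      \<open>e * (1 - c)\<close> from the perturbation has to dominate \<open>\<delta>\<close> times
      \<open>?Pe\<close>, and \<open>?Pe\<close> is at most \<open>K\<close>. The additional
      \<open>e\<close> in the denominator ensures \<open>\<delta> < 1\<close>; its share is the
      summand \<open>\<delta> * e\<close> of the certificate below.\<close>
    define \<delta> where "\<delta> = e * (1 - c) / (K + e)"
    have "e * (1 - c) < K + e" using K(1) e c(1) mult_strict_left_mono[of "1 - c" 1 e] by linarith
    then have \<delta>: "0 < \<delta>" "\<delta> < 1" using K(1) e c by (auto simp: \<delta>_def field_simps)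
    have "psd (vec_identity n * adj (vec_identity n) + (complex_of_real e \<cdot>\<^sub>m (complex_of_real c \<cdot>\<^sub>m ?I - ?R * adj ?R)
        + (complex_of_real \<delta> \<cdot>\<^sub>m (complex_of_real K \<cdot>\<^sub>m ?I - ?Pe) + complex_of_real (\<delta> * e) \<cdot>\<^sub>m ?I)))"
      using e c(3) K(2) \<delta> by (intro psd_add[of _ ?N] psd_smult[of _ ?N] psd_gram psd_one) (auto intro!: carrier_matI)
    also have "vec_identity n * adj (vec_identity n) + (complex_of_real e \<cdot>\<^sub>m (complex_of_real c \<cdot>\<^sub>m ?I - ?R * adj ?R)
        + (complex_of_real \<delta> \<cdot>\<^sub>m (complex_of_real K \<cdot>\<^sub>m ?I - ?Pe) + complex_of_real (\<delta> * e) \<cdot>\<^sub>m ?I)) =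
      ?Pe - ?R * kron ?Pe (1\<^sub>m d) * adj ?R - complex_of_real \<delta> \<cdot>\<^sub>m ?Pe"
    proof -
      have \<delta>K: "complex_of_real \<delta> * complex_of_real K + complex_of_real \<delta> * complex_of_real e =
          complex_of_real e - complex_of_real e * complex_of_real c"
      proof -
        have "\<delta> * (K + e) = e * (1 - c)" using K(1) e by (simp add: \<delta>_def)
        then have "\<delta> * K + \<delta> * e = e - e * c" by (simp add: algebra_simps)
        then show ?thesis by (metis of_real_add of_real_diff of_real_mult)
      qed
      have S: "?R * kron ?Pe (1\<^sub>m d) * adj ?R =
          ?R * kron ?P (1\<^sub>m d) * adj ?R + complex_of_real e \<cdot>\<^sub>m (?R * adj ?R)"
        by (simp add: kron_add kron_smult kron_one mat_algebra)
      show ?thesis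
        unfolding S stein[symmetric]
      proof (rule eq_matI)
        fix i j assume "i < dim_row (?Pe - (?R * kron ?P (1\<^sub>m d) * adj ?R + complex_of_real e \<cdot>\<^sub>m (?R * adj ?R)) - complex_of_real \<delta> \<cdot>\<^sub>m ?Pe)"
          "j < dim_col (?Pe - (?R * kron ?P (1\<^sub>m d) * adj ?R + complex_of_real e \<cdot>\<^sub>m (?R * adj ?R)) - complex_of_real \<delta> \<cdot>\<^sub>m ?Pe)"
        then have ij: "i < ?N" "j < ?N" by auto
        show "(?P - ?R * kron ?P (1\<^sub>m d) * adj ?R + (complex_of_real e \<cdot>\<^sub>m (complex_of_real c \<cdot>\<^sub>m ?I - ?R * adj ?R)
        + (complex_of_real \<delta> \<cdot>\<^sub>m (complex_of_real K \<cdot>\<^sub>m ?I - ?Pe) + complex_of_real (\<delta> * e) \<cdot>\<^sub>m ?I))) $$ (i, j) =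
          (?Pe - (?R * kron ?P (1\<^sub>m d) * adj ?R + complex_of_real e \<cdot>\<^sub>m (?R * adj ?R)) - complex_of_real \<delta> \<cdot>\<^sub>m ?Pe) $$ (i, j)"
        proof (cases "i = j")
          case True
          then show ?thesis using ij \<delta>K by (simp add: algebra_simps del: index_mult_mat(1))
        next
          case False
          then show ?thesis using ij by (simp add: algebra_simps del: index_mult_mat(1))
        qed
      qed simp_all
    qed
    finally have pos': "psd (S * adj S - ?R * kron (S * adj S) (1\<^sub>m d) * adj ?R - complex_of_real \<delta> \<cdot>\<^sub>m (S * adj S))"
      unfolding PS .
    let ?Z = "map (\<lambda>A. T * A * S) ?X"
    have Zball: "?Z \<in> row_ball_level d ?N" by (rule similarity_in_row_ball[OF Xc' ST \<delta> pos'])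
    have inv: "mat_inv S = T" by (rule mat_inv_eqI[OF ST])
    have "invertible_mat S"
      unfolding invertible_mat_def inverts_mat_def square_mat.simps using ST(3,4) by (intro conjI exI[of _ T]) simp_all
    then have FZ: "(F $$ (i, j)) ?Z = T * kron (1\<^sub>m n) ((F $$ (i, j)) X) * S" if ij: "i < s" "j < t" for i j
    proof -
      note f = nc[OF ij]
      have "?Z \<in> row_ball d" unfolding row_ball_def using Zball N by blast
      then have "(F $$ (i, j)) ?Z = T * (F $$ (i, j)) ?X * S"
        using f N Xball ST(1) \<open>invertible_mat S\<close> unfolding nc_function_def inv[symmetric] by blast
      then show ?thesis by (simp only: nc_function_ampliation[OF f X n n])
    qed
    have FX: "(F $$ (i, j)) X \<in> carrier_mat n n" if "i < s" "j < t" for i j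
      using nc[OF that] X n unfolding nc_function_def by blast
    have FX': "kron (1\<^sub>m n) ((F $$ (i, j)) X) \<in> carrier_mat ?N ?N" if "i < s" "j < t" for i j
      using FX[OF that] by simp
    have FZc: "(F $$ (i, j)) ?Z \<in> carrier_mat ?N ?N" if "i < s" "j < t" for i j
      using nc[OF that] Zball N unfolding nc_function_def by blast
    define \<Psi> where "\<Psi> = tensor_blocks ?N ?N s t (\<lambda>i j. (F $$ (i, j)) ?Z)"
    have [simp]: "dim_row \<Psi> = ?N * s" "dim_col \<Psi> = ?N * t" by (simp_all add: \<Psi>_def)
    have TF: "T * kron (1\<^sub>m n) ((F $$ (i, j)) X) \<in> carrier_mat ?N ?N" if "i < s" "j < t" for i j
      by (rule mult_carrier_mat[OF ST(2) FX'[OF that]])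
    have "\<Psi> = tensor_blocks ?N ?N s t (\<lambda>i j. T * kron (1\<^sub>m n) ((F $$ (i, j)) X) * S)"
      unfolding \<Psi>_def by (rule tensor_blocks_cong) (rule FZ)
    also have "\<dots> = tensor_blocks ?N ?N s t (\<lambda>i j. T * kron (1\<^sub>m n) ((F $$ (i, j)) X)) * kron S (1\<^sub>m t)"
      by (rule tensor_blocks_mult_kron[OF _ ST(1), symmetric]) (rule TF)
    also have "tensor_blocks ?N ?N s t (\<lambda>i j. T * kron (1\<^sub>m n) ((F $$ (i, j)) X)) =
        kron T (1\<^sub>m s) * tensor_blocks ?N ?N s t (\<lambda>i j. kron (1\<^sub>m n) ((F $$ (i, j)) X))"
      by (rule kron_mult_tensor_blocks[OF _ ST(2), symmetric]) (rule FX')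
    also have "tensor_blocks ?N ?N s t (\<lambda>i j. kron (1\<^sub>m n) ((F $$ (i, j)) X)) = ?W"
      unfolding \<Phi>_def by (rule kron_tensor_blocks[symmetric]) (rule FX)
    finally have \<Psi>: "\<Psi> = kron T (1\<^sub>m s) * ?W * kron S (1\<^sub>m t)" .
    have "op_norm (block_matrix ?N (map_mat (\<lambda>f. f ?Z) F)) \<le> 1"
    proof -
      have "ereal (op_norm (block_matrix ?N (map_mat (\<lambda>f. f ?Z) F))) \<le> H_infinity_norm d F"
        unfolding H_infinity_norm_def using N Zball by (intro SUP_upper2[of ?N] SUP_upper) auto
      also note norm
      finally show ?thesis by simp
    qed
    moreover have "tensor_blocks ?N ?N s t (\<lambda>i j. map_mat (\<lambda>f. f ?Z) F $$ (i, j)) = \<Psi>"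
      unfolding \<Psi>_def using F by (intro tensor_blocks_cong) auto
    ultimately have "psd (1\<^sub>m (?N * s) - \<Psi> * adj \<Psi>)"
      using block_matrix_norm_iff[of "map_mat (\<lambda>f. f ?Z) F" s t ?N] F FZc by auto
    from psd_congruence[OF this, of "kron S (1\<^sub>m s)"]
    have *: "psd (kron S (1\<^sub>m s) * (1\<^sub>m (?N * s) - \<Psi> * adj \<Psi>) * adj (kron S (1\<^sub>m s)))" by simp
    \<comment> \<open>The factor T from the value at the similar tuple cancels against S, so that
      only the ampliated value at X and one factor S remain.\<close>
    have S\<Psi>: "kron S (1\<^sub>m s) * \<Psi> = ?W * kron S (1\<^sub>m t)"
    proof -
      have "kron S (1\<^sub>m s) * \<Psi> = kron S (1\<^sub>m s) * kron T (1\<^sub>m s) * (?W * kron S (1\<^sub>m t))"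
        by (simp add: \<Psi> mat_assoc mult.assoc)
      then show ?thesis by (simp add: kron_mult ST(3) kron_one mat_units mult.assoc)
    qed
    have "kron S (1\<^sub>m s) * (1\<^sub>m (?N * s) - \<Psi> * adj \<Psi>) * adj (kron S (1\<^sub>m s)) =
        kron S (1\<^sub>m s) * adj (kron S (1\<^sub>m s)) - (kron S (1\<^sub>m s) * \<Psi>) * adj (kron S (1\<^sub>m s) * \<Psi>)"
      by (simp add: mat_algebra)
    also have "\<dots> = kron ?Pe (1\<^sub>m s) - ?W * kron ?Pe (1\<^sub>m t) * adj ?W"
    proof -
      have K: "kron S (1\<^sub>m k) * adj (kron S (1\<^sub>m k)) = kron ?Pe (1\<^sub>m k)" for k
        by (simp add: kron_adj kron_mult mat_units PS)
      have "(?W * kron S (1\<^sub>m t)) * adj (?W * kron S (1\<^sub>m t)) = ?W * (kron S (1\<^sub>m t) * adj (kron S (1\<^sub>m t))) * adj ?W"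
        by (simp add: adj_mult mat_assoc mult.assoc)
      then show ?thesis unfolding S\<Psi> by (simp only: K)
    qed
    also have "\<dots> = (kron ?P (1\<^sub>m s) - ?W * kron ?P (1\<^sub>m t) * adj ?W) + complex_of_real e \<cdot>\<^sub>m (1\<^sub>m (?N * s) - ?W * adj ?W)"
      by (simp add: kron_add kron_smult kron_one mat_algebra mult.assoc)
         (intro eq_matI; simp add: algebra_simps del: index_mult_mat(1))
    finally show ?thesis using * by simp
  qed
  have C: "kron ?P (1\<^sub>m s) - ?W * kron ?P (1\<^sub>m t) * adj ?W \<in> carrier_mat (?N * s) (?N * s)"
    "1\<^sub>m (?N * s) - ?W * adj ?W \<in> carrier_mat (?N * s) (?N * s)"
    by (rule carrier_matI; simp add: mult.assoc)+
  have "psd (kron ?P (1\<^sub>m s) - ?W * kron ?P (1\<^sub>m t) * adj ?W)" by (rule psd_limit[OF C pos])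
  then show ?thesis by (simp add: kron_adj)
qed
section \<open>Transfer functions\<close>

text \<open>The hypothesis on \<open>L * adj L\<close> bounds the norm of \<open>adj L\<close>, so
  the kernel argument is run for I - \<open>adj L\<close>: a fixed vector w satisfies |w| \<le> sqrt
  c |w| and vanishes. Adjoints then give the inverse of I - L.\<close>

lemma strict_contraction_inverse:
  assumes L: "L \<in> carrier_mat N N" and c: "0 < c" "c < 1"
    and psd: "psd (scalar_mat c N - L * adj L)"
  obtains J where "J \<in> carrier_mat N N" "(1\<^sub>m N - L) * J = 1\<^sub>m N" "J * (1\<^sub>m N - L) = 1\<^sub>m N"
proof -
  have [simp]: "dim_row L = N" "dim_col L = N" using L by auto
  have L': "adj L \<in> carrier_mat N N" by (rule adj_carrier[OF L])
  have A: "1\<^sub>m N - adj L \<in> carrier_mat N N" by (rule minus_carrier_mat[OF L'])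
  obtain J where J: "J \<in> carrier_mat N N" "(1\<^sub>m N - adj L) * J = 1\<^sub>m N" "J * (1\<^sub>m N - adj L) = 1\<^sub>m N"
  proof (rule trivial_kernel_inverse[OF A])
    fix w :: "complex vec" assume w: "w \<in> carrier_vec N" and ker: "(1\<^sub>m N - adj L) *\<^sub>v w = 0\<^sub>v N"
    have Lw: "adj L *\<^sub>v w \<in> carrier_vec N" by (rule mult_mat_vec_carrier[OF L' w])
    have "w - adj L *\<^sub>v w = 0\<^sub>v N"
      using minus_mult_distrib_mat_vec[OF one_carrier_mat L' w] ker w by simp
    have "adj L *\<^sub>v w = w"
    proof (rule eq_vecI)
      fix i assume "i < dim_vec w"
      then show "(adj L *\<^sub>v w) $ i = w $ i"
        using arg_cong[OF \<open>w - adj L *\<^sub>v w = 0\<^sub>v N\<close>, of "\<lambda>v. v $ i"] w Lw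
        by (simp del: index_mult_mat_vec)
    qed (use w in simp)
    moreover have "l2_norm (adj L *\<^sub>v w) \<le> sqrt c * l2_norm w"
      using psd_bound_iff[OF L', of "sqrt c"] psd c w by simp
    ultimately have "(1 - sqrt c) * l2_norm w \<le> 0" by (simp add: algebra_simps)
    moreover have "sqrt c < 1" using c by simp
    ultimately have "l2_norm w = 0" using l2_norm_nonneg[of w] by (simp add: mult_le_0_iff)
    then have "w \<bullet>c w = 0" using l2_norm_square[of w] by simp
    then show "w = 0\<^sub>v N" using w conjugate_square_eq_0_vec by blast
  qed
  have [simp]: "dim_row J = N" "dim_col J = N" using J by auto
  have "(1\<^sub>m N - L) * adj J = 1\<^sub>m N" "adj J * (1\<^sub>m N - L) = 1\<^sub>m N"
    using arg_cong[OF J(3), of adj] arg_cong[OF J(2), of adj] by (simp_all add: adj_mult adj_minus)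
  then show thesis using that[of "adj J"] J(1) by simp
qed

text \<open>Bookkeeping for \<open>transfer_contractive\<close>. Each group is the expansion of a
  Gram matrix: \<open>a\<close> is its constant term, \<open>b\<close> and \<open>c\<close> are the
  cross terms, and \<open>d\<close> is quadratic in K. Added across the groups, the cross terms
  cancel.\<close>

lemma sum_three_blocks:
  assumes "a1 + a2 + a3 = (I :: complex mat)" "b1 + b2 + b3 = 0\<^sub>m N N" "c1 + c2 + c3 = 0\<^sub>m N N" "d1 + d2 + d3 = K"
    and "a1 \<in> carrier_mat N N" "a2 \<in> carrier_mat N N" "a3 \<in> carrier_mat N N"
    and "b1 \<in> carrier_mat N N" "b2 \<in> carrier_mat N N" "b3 \<in> carrier_mat N N"
    and "c1 \<in> carrier_mat N N" "c2 \<in> carrier_mat N N" "c3 \<in> carrier_mat N N"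
    and "d1 \<in> carrier_mat N N" "d2 \<in> carrier_mat N N" "d3 \<in> carrier_mat N N"
  shows "a1 + b1 + c1 + d1 + (a2 + b2 + c2 + d2) + (a3 + b3 + c3 + d3) = I + K"
proof (rule eq_matI)
  fix i j assume "i < dim_row (I + K)" "j < dim_col (I + K)"
  then have ij: "i < N" "j < N" using assms(4,14-16) by auto
  have "b1 $$ (i, j) = - b2 $$ (i, j) - b3 $$ (i, j)" "c1 $$ (i, j) = - c2 $$ (i, j) - c3 $$ (i, j)"
    using assms(5-16) ij arg_cong[OF assms(2), of "\<lambda>X. X $$ (i, j)"] arg_cong[OF assms(3), of "\<lambda>X. X $$ (i, j)"]
    by (auto simp: eq_neg_iff_add_eq_0 algebra_simps)
  then show "(a1 + b1 + c1 + d1 + (a2 + b2 + c2 + d2) + (a3 + b3 + c3 + d3)) $$ (i, j) = (I + K) $$ (i, j)"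
    using assms(5-16) ij unfolding assms(1)[symmetric] assms(4)[symmetric] by simp
qed (use assms in auto)

text \<open>The transfer function \<open>I \<otimes> A + (I \<otimes> B) (I - Z \<otimes> D)\<^sup>-\<^sup>1 (Z \<otimes> C)\<close> of a colligation with
  \<open>s + d M\<close> rows that is completed to a coisometry by the column \<open>(G\<^sub>1, G\<^sub>2)\<close>. Here \<open>Z \<otimes> C\<close> stands for
  \<open>\<Sum> Z\<^sub>i \<otimes> C\<^sub>i\<close>, which is the row of \<open>Z\<close> tensored with \<open>I\<^sub>M\<close> times \<open>I \<otimes> C\<close>.\<close>

locale coisometric_colligation =
  fixes d s t M g :: nat and A B C D G1 G2 :: "complex mat"
  assumes dims [simp]: "dim_row A = s" "dim_col A = t" "dim_row B = s" "dim_col B = M"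
      "dim_row C = d * M" "dim_col C = t" "dim_row D = d * M" "dim_col D = M"
      "dim_row G1 = s" "dim_col G1 = g" "dim_row G2 = d * M" "dim_col G2 = g"
    and coiso1: "A * adj A + B * adj B + G1 * adj G1 = 1\<^sub>m s"
    and coiso2: "A * adj C + B * adj D + G1 * adj G2 = 0\<^sub>m s (d * M)"
    and coiso3: "C * adj C + D * adj D + G2 * adj G2 = 1\<^sub>m (d * M)"
begin

definition arrow :: "nat \<Rightarrow> complex mat list \<Rightarrow> complex mat" where
  "arrow m Z = kron (row_matrix d m Z) (1\<^sub>m M)"

definition resolvent :: "nat \<Rightarrow> complex mat list \<Rightarrow> complex mat" where
  "resolvent m Z = mat_inv (1\<^sub>m (m * M) - arrow m Z * kron (1\<^sub>m m) D)"

definition output_map :: "nat \<Rightarrow> complex mat list \<Rightarrow> complex mat" where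
  "output_map m Z = kron (1\<^sub>m m) B * resolvent m Z"

definition transfer :: "nat \<Rightarrow> complex mat list \<Rightarrow> complex mat" where
  "transfer m Z = kron (1\<^sub>m m) A + output_map m Z * arrow m Z * kron (1\<^sub>m m) C"

lemma dim_arrow [simp]: "dim_row (arrow m Z) = m * M" "dim_col (arrow m Z) = m * (d * M)"
  by (simp_all add: arrow_def mult.assoc)

text \<open>With r the row of Z and L = (r \<otimes> I) (I \<otimes> D), the matrix c - L
  \<open>adj L\<close> is (c - r \<open>adj r\<close>) \<otimes> I plus the conjugate by r \<otimes>
  I of the ampliated defect I - \<open>D * adj D\<close>. By \<open>coiso3\<close> this defect is
  \<open>C * adj C + G2 * adj G2\<close>, hence positive, and L inherits the margin of the
  row.\<close>

lemma resolvent: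
  assumes Z: "Z \<in> row_ball_level d m"
  shows "resolvent m Z \<in> carrier_mat (m * M) (m * M)"
    "(1\<^sub>m (m * M) - arrow m Z * kron (1\<^sub>m m) D) * resolvent m Z = 1\<^sub>m (m * M)"
    "resolvent m Z * (1\<^sub>m (m * M) - arrow m Z * kron (1\<^sub>m m) D) = 1\<^sub>m (m * M)"
proof -
  let ?r = "row_matrix d m Z" and ?L = "arrow m Z * kron (1\<^sub>m m) D"
  obtain c where c: "0 < c" "c < 1" "psd (scalar_mat c m - ?r * adj ?r)"
    using row_ball_levelD(3)[OF Z] by blast
  have C1: "scalar_mat c m - ?r * adj ?r \<in> carrier_mat m m"
    and C2: "C * adj C + G2 * adj G2 \<in> carrier_mat (d * M) (d * M)"
    and CC: "C * adj C \<in> carrier_mat (d * M) (d * M)" "G2 * adj G2 \<in> carrier_mat (d * M) (d * M)"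
    by (rule carrier_matI; simp)+
  have psd2: "psd (C * adj C + G2 * adj G2)" by (rule psd_add[OF CC psd_gram psd_gram])
  have "psd (kron (scalar_mat c m - ?r * adj ?r) (1\<^sub>m M) +
      arrow m Z * kron (1\<^sub>m m) (C * adj C + G2 * adj G2) * adj (arrow m Z))"
  proof (rule psd_add[OF _ _ psd_kron_one(1)[OF C1 c(3)]])
    show "psd (arrow m Z * kron (1\<^sub>m m) (C * adj C + G2 * adj G2) * adj (arrow m Z))"
      by (rule psd_congruence[OF psd_kron_one(2)[OF C2 psd2]]) simp
  qed (rule carrier_matI; simp)+
  also have "kron (scalar_mat c m - ?r * adj ?r) (1\<^sub>m M) +
      arrow m Z * kron (1\<^sub>m m) (C * adj C + G2 * adj G2) * adj (arrow m Z) =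
    scalar_mat c (m * M) - ?L * adj ?L"
  proof -
    have CG: "C * adj C + G2 * adj G2 = 1\<^sub>m (d * M) - D * adj D"
    proof (rule eq_matI)
      fix i j assume "i < dim_row (1\<^sub>m (d * M) - D * adj D)" "j < dim_col (1\<^sub>m (d * M) - D * adj D)"
      then show "(C * adj C + G2 * adj G2) $$ (i, j) = (1\<^sub>m (d * M) - D * adj D) $$ (i, j)"
        using arg_cong[OF coiso3, of "\<lambda>X. X $$ (i, j)"]
        by (simp add: algebra_simps del: index_mult_mat(1))
    qed auto
    have "?r * adj ?r \<in> carrier_mat m m" by (rule carrier_matI) simp_all
    have "kron (?r * adj ?r) (1\<^sub>m M) = arrow m Z * adj (arrow m Z)"
      by (simp add: arrow_def kron_adj kron_mult mat_units)
    moreover have "?L * adj ?L = arrow m Z * (kron (1\<^sub>m m) (D * adj D) * adj (arrow m Z))"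
    proof -
      have "kron (1\<^sub>m m) D * (kron (1\<^sub>m m) (adj D) * adj (arrow m Z)) =
          kron (1\<^sub>m m) (D * adj D) * adj (arrow m Z)"
        by (rule mult_cong_right) (simp_all add: kron_mult mat_units)
      then show ?thesis by (simp add: adj_mult kron_adj mat_assoc)
    qed
    ultimately show ?thesis
      by (simp add: CG kron_minus kron_smult kron_one mat_algebra)
         (intro eq_matI; simp del: index_mult_mat(1))
  qed
  finally have psdL: "psd (scalar_mat c (m * M) - ?L * adj ?L)" .
  have L: "?L \<in> carrier_mat (m * M) (m * M)" by (rule carrier_matI) simp_all
  obtain J where J: "J \<in> carrier_mat (m * M) (m * M)" "(1\<^sub>m (m * M) - ?L) * J = 1\<^sub>m (m * M)"
    "J * (1\<^sub>m (m * M) - ?L) = 1\<^sub>m (m * M)"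
    using strict_contraction_inverse[OF L c(1,2) psdL] by blast
  have "resolvent m Z = J"
    unfolding resolvent_def by (rule mat_inv_eqI[OF minus_carrier_mat[OF L] J])
  with J show "resolvent m Z \<in> carrier_mat (m * M) (m * M)"
    "(1\<^sub>m (m * M) - ?L) * resolvent m Z = 1\<^sub>m (m * M)"
    "resolvent m Z * (1\<^sub>m (m * M) - ?L) = 1\<^sub>m (m * M)" by simp_all
qed

text \<open>Multiplying out the inverse leaves a linear fixed-point equation without the resolvent.
  Contractivity is read off from it, and interpolation rests on a matrix that solves the same
  equation at X.\<close>

lemma output_map:
  assumes Z: "Z \<in> row_ball_level d m"
  shows "output_map m Z \<in> carrier_mat (m * s) (m * M)"
    "output_map m Z = kron (1\<^sub>m m) B + output_map m Z * arrow m Z * kron (1\<^sub>m m) D"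
proof -
  note res = resolvent[OF Z]
  have [simp]: "dim_row (resolvent m Z) = m * M" "dim_col (resolvent m Z) = m * M" using res(1) by auto
  show "output_map m Z \<in> carrier_mat (m * s) (m * M)" by (rule carrier_matI) (simp_all add: output_map_def)
  have "output_map m Z * (1\<^sub>m (m * M) - arrow m Z * kron (1\<^sub>m m) D) = kron (1\<^sub>m m) B"
    unfolding output_map_def using res(3) by (simp add: mat_assoc mat_units)
  moreover have "output_map m Z * (1\<^sub>m (m * M) - arrow m Z * kron (1\<^sub>m m) D) =
      output_map m Z - output_map m Z * arrow m Z * kron (1\<^sub>m m) D"
    by (simp add: output_map_def mat_algebra)
  ultimately have eq: "output_map m Z - output_map m Z * arrow m Z * kron (1\<^sub>m m) D = kron (1\<^sub>m m) B"
    by simp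
  show "output_map m Z = kron (1\<^sub>m m) B + output_map m Z * arrow m Z * kron (1\<^sub>m m) D"
    unfolding eq[symmetric]
    by (intro eq_matI; simp add: output_map_def del: index_mult_mat(1))
qed

text \<open>With \<open>K = H (Z \<otimes> I)\<close> the coisometry gives \<open>\<Phi> \<Phi>\<^sup>* + H H\<^sup>* \<le> I + K K\<^sup>*\<close>, and \<open>K K\<^sup>* \<le> H H\<^sup>*\<close> as \<open>Z\<close> is a row
  contraction.\<close>

lemma transfer_contractive:
  assumes Z: "Z \<in> row_ball_level d m"
  shows "psd (1\<^sub>m (m * s) - transfer m Z * adj (transfer m Z))"
proof -
  let ?r = "row_matrix d m Z" and ?I = "1\<^sub>m m :: complex mat" and ?\<Phi> = "transfer m Z"
  define H where "H = output_map m Z"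
  define K where "K = H * arrow m Z"
  have [simp]: "dim_row H = m * s" "dim_col H = m * M" using output_map(1)[OF Z] by (auto simp: H_def)
  have [simp]: "dim_row K = m * s" "dim_col K = m * (d * M)" by (simp_all add: K_def)
  \<comment> \<open>The contribution of the completing column. Including it makes the estimate an
    exact identity, \<open>sum\<close> below.\<close>
  define \<Gamma> where "\<Gamma> = kron ?I G1 + K * kron ?I G2"
  have [simp]: "dim_row \<Gamma> = m * s" "dim_col \<Gamma> = m * g" by (simp_all add: \<Gamma>_def)
  have \<Phi>: "?\<Phi> = kron ?I A + K * kron ?I C" by (simp add: transfer_def K_def H_def)
  have H: "H = kron ?I B + K * kron ?I D" using output_map(2)[OF Z] by (simp add: K_def H_def)
  have [simp]: "dim_row ?\<Phi> = m * s" "dim_col ?\<Phi> = m * t" by (simp_all add: \<Phi>)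
  \<comment> \<open>The Gram matrix of one column (E, F) of the colligation compressed by the row
    [I K]; it is applied to the columns (A, C), (B, D) and (G1, G2).\<close>
  have block: "(kron ?I E + K * kron ?I F) * adj (kron ?I E + K * kron ?I F) =
      kron ?I (E * adj E) + kron ?I (E * adj F) * adj K + K * kron ?I (F * adj E) + K * kron ?I (F * adj F) * adj K"
    if [simp]: "dim_row E = s" "dim_col E = u" "dim_row F = d * M" "dim_col F = u" for E F u
  proof -
    have k: "kron ?I X * kron ?I (adj Y) = kron ?I (X * adj Y)" if "dim_col X = dim_col Y" for X Y
      using that by (simp add: kron_mult mat_units)
    have "kron ?I X * (kron ?I (adj Y) * adj K) = kron ?I (X * adj Y) * adj K"
      if "dim_col X = dim_col Y" "dim_row Y = d * M" for X Y
      by (rule mult_cong_right) (use that k in simp_all)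
    then show ?thesis
      by (simp add: mat_algebra kron_adj k) (intro eq_matI; simp add: algebra_simps del: index_mult_mat(1))
  qed
  have sum: "?\<Phi> * adj ?\<Phi> + H * adj H + \<Gamma> * adj \<Gamma> = 1\<^sub>m (m * s) + K * adj K"
  proof -
    have e1: "kron ?I (A * adj A) + kron ?I (B * adj B) + kron ?I (G1 * adj G1) = 1\<^sub>m (m * s)"
      using coiso1 by (simp add: kron_one flip: kron_add)
    have e2: "kron ?I (A * adj C) * adj K + kron ?I (B * adj D) * adj K + kron ?I (G1 * adj G2) * adj K =
        0\<^sub>m (m * s) (m * s)"
    proof -
      have "kron ?I (A * adj C) * adj K + kron ?I (B * adj D) * adj K + kron ?I (G1 * adj G2) * adj K =
          kron ?I (A * adj C + B * adj D + G1 * adj G2) * adj K"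
        by (simp add: kron_add mat_distrib)
      also have "\<dots> = 0\<^sub>m (m * s) (m * s)"
        unfolding coiso2 kron_zero by (intro eq_matI) simp_all
      finally show ?thesis .
    qed
    have e3: "K * kron ?I (C * adj A) + K * kron ?I (D * adj B) + K * kron ?I (G2 * adj G1) =
        0\<^sub>m (m * s) (m * s)"
      using arg_cong[OF e2, of adj] by (simp add: adj_add adj_mult kron_adj)
    have e4: "K * kron ?I (C * adj C) * adj K + K * kron ?I (D * adj D) * adj K + K * kron ?I (G2 * adj G2) * adj K =
        K * adj K"
    proof -
      have "K * kron ?I (C * adj C) * adj K + K * kron ?I (D * adj D) * adj K + K * kron ?I (G2 * adj G2) * adj K =
          K * kron ?I (C * adj C + D * adj D + G2 * adj G2) * adj K"
        by (simp add: kron_add mat_distrib)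
      also have "\<dots> = K * adj K" unfolding coiso3 by (simp add: kron_one mat_units)
      finally show ?thesis .
    qed
    have HH: "H * adj H = (kron ?I B + K * kron ?I D) * adj (kron ?I B + K * kron ?I D)"
      by (simp flip: H)
    show ?thesis
      unfolding HH \<Phi> \<Gamma>_def block[OF dims(1,2,5,6)] block[OF dims(3,4,7,8)] block[OF dims(9-12)]
      by (rule sum_three_blocks[OF e1 e2 e3 e4]) (rule carrier_matI; simp)+
  qed
  obtain c where c: "0 < c" "c < 1" "psd (scalar_mat c m - ?r * adj ?r)"
    using row_ball_levelD(3)[OF Z] by blast
  have "psd ((scalar_mat c m - ?r * adj ?r) + scalar_mat (1 - c) m)"
    using c(2) by (intro psd_add[OF _ _ c(3) psd_smult[OF one_carrier_mat psd_one]]) (auto intro!: carrier_matI)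
  also have "(scalar_mat c m - ?r * adj ?r) + scalar_mat (1 - c) m = 1\<^sub>m m - ?r * adj ?r"
    by (intro eq_matI) (auto simp del: index_mult_mat(1))
  finally have psdr: "psd (1\<^sub>m m - ?r * adj ?r)" .
  have Cr: "1\<^sub>m m - ?r * adj ?r \<in> carrier_mat m m" by (rule carrier_matI) simp_all
  have "psd (H * kron (1\<^sub>m m - ?r * adj ?r) (1\<^sub>m M) * adj H)"
    by (rule psd_congruence[OF psd_kron_one(1)[OF Cr psdr]]) simp
  then have "psd (H * kron (1\<^sub>m m - ?r * adj ?r) (1\<^sub>m M) * adj H + \<Gamma> * adj \<Gamma>)"
    by (intro psd_add[OF _ _ _ psd_gram]) (auto intro!: carrier_matI)
  also have "H * kron (1\<^sub>m m - ?r * adj ?r) (1\<^sub>m M) * adj H = H * adj H - K * adj K"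
  proof -
    have "kron (1\<^sub>m m - ?r * adj ?r) (1\<^sub>m M) = 1\<^sub>m (m * M) - arrow m Z * adj (arrow m Z)"
      by (simp add: arrow_def kron_adj kron_mult mat_units kron_minus kron_one)
    then show ?thesis by (simp add: K_def mat_algebra)
  qed
  also have "H * adj H - K * adj K + \<Gamma> * adj \<Gamma> = 1\<^sub>m (m * s) - ?\<Phi> * adj ?\<Phi>"
  proof (rule eq_matI)
    fix i j assume "i < dim_row (1\<^sub>m (m * s) - ?\<Phi> * adj ?\<Phi>)" "j < dim_col (1\<^sub>m (m * s) - ?\<Phi> * adj ?\<Phi>)"
    then show "(H * adj H - K * adj K + \<Gamma> * adj \<Gamma>) $$ (i, j) = (1\<^sub>m (m * s) - ?\<Phi> * adj ?\<Phi>) $$ (i, j)"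
      using arg_cong[OF sum, of "\<lambda>X. X $$ (i, j)"]
      by (simp add: algebra_simps del: index_mult_mat(1) index_one_mat)
  qed simp_all
  finally show ?thesis .
qed

lemma transfer_carrier:
  assumes Z: "Z \<in> row_ball_level d m"
  shows "transfer m Z \<in> carrier_mat (m * s) (m * t)"
  using output_map(1)[OF Z] by (intro carrier_matI) (simp_all add: transfer_def)

text \<open>Contains both nc axioms: T is S for a similarity and a coordinate inclusion for a direct
  sum. Ampliated constants and \<open>arrow\<close> pass T directly, and the resolvent passes it
  because I - L does.\<close>

lemma transfer_intertwine:
  assumes Z: "Z \<in> row_ball_level d m" and Z': "Z' \<in> row_ball_level d m'" and T: "T \<in> carrier_mat m' m"
    and eq: "\<And>k. k < d \<Longrightarrow> Z' ! k * T = T * Z ! k"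
  shows "transfer m' Z' * kron T (1\<^sub>m t) = kron T (1\<^sub>m s) * transfer m Z"
proof -
  note Zc = row_ball_levelD(1,2)[OF Z] and Zc' = row_ball_levelD(1,2)[OF Z']
  note res = resolvent[OF Z] and res' = resolvent[OF Z']
  have [simp]: "dim_row T = m'" "dim_col T = m" using T by auto
  have [simp]: "dim_row (resolvent m Z) = m * M" "dim_col (resolvent m Z) = m * M"
    "dim_row (resolvent m' Z') = m' * M" "dim_col (resolvent m' Z') = m' * M" using res(1) res'(1) by auto
  have [simp]: "dim_row (output_map m Z) = m * s" "dim_col (output_map m Z) = m * M"
    "dim_row (output_map m' Z') = m' * s" "dim_col (output_map m' Z') = m' * M" by (simp_all add: output_map_def)
  have row: "row_matrix d m' Z' * kron T (1\<^sub>m d) = T * row_matrix d m Z"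
  proof (rule row_matrix_intertwine[OF T])
    fix k assume k: "k < d"
    show "Z ! k \<in> carrier_mat m m" "Z' ! k \<in> carrier_mat m' m'"
      using k Zc Zc' nth_mem[of k Z] nth_mem[of k Z'] by auto
    show "Z' ! k * T = T * Z ! k" by (rule eq[OF k])
  qed
  have arrow: "arrow m' Z' * kron T (1\<^sub>m (d * M)) = kron T (1\<^sub>m M) * arrow m Z"
  proof -
    have "kron T (1\<^sub>m (d * M)) = kron (kron T (1\<^sub>m d)) (1\<^sub>m M)" by (simp add: kron_assoc kron_one)
    then show ?thesis by (simp add: arrow_def kron_mult mat_units row)
  qed
  have const: "kron (1\<^sub>m m') E * kron T (1\<^sub>m (dim_col E)) = kron T (1\<^sub>m (dim_row E)) * kron (1\<^sub>m m) E" for E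
    by (simp add: kron_mult mat_units)
  let ?L = "arrow m Z * kron (1\<^sub>m m) D" and ?L' = "arrow m' Z' * kron (1\<^sub>m m') D" and ?T = "kron T (1\<^sub>m M)"
  have "?L' * ?T = arrow m' Z' * (kron (1\<^sub>m m') D * ?T)" by (simp add: mat_assoc)
  also have "\<dots> = arrow m' Z' * kron T (1\<^sub>m (d * M)) * kron (1\<^sub>m m) D"
    using const[of D] by (simp add: mat_assoc)
  also have "\<dots> = ?T * ?L" unfolding arrow by (simp add: mat_assoc)
  finally have "(1\<^sub>m (m' * M) - ?L') * ?T = ?T * (1\<^sub>m (m * M) - ?L)"
    by (simp add: mat_distrib mat_units)
  \<comment> \<open>The relation (I - L') T = T (I - L) is multiplied by the resolvent of Z' from
    the left and by that of Z from the right; one inverse cancels on each side.\<close>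
  then have "resolvent m' Z' * ((1\<^sub>m (m' * M) - ?L') * ?T) * resolvent m Z =
      resolvent m' Z' * (?T * (1\<^sub>m (m * M) - ?L)) * resolvent m Z" by (rule arg_cong)
  moreover have "resolvent m' Z' * ((1\<^sub>m (m' * M) - ?L') * ?T) * resolvent m Z =
      resolvent m' Z' * (1\<^sub>m (m' * M) - ?L') * (?T * resolvent m Z)"
    by (simp add: mat_assoc)
  moreover have "resolvent m' Z' * (1\<^sub>m (m' * M) - ?L') * (?T * resolvent m Z) = ?T * resolvent m Z"
    unfolding res'(3) by (simp add: mat_units)
  moreover have "resolvent m' Z' * (?T * (1\<^sub>m (m * M) - ?L)) * resolvent m Z =
      resolvent m' Z' * ?T * ((1\<^sub>m (m * M) - ?L) * resolvent m Z)"
    by (simp add: mat_assoc)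
  moreover have "resolvent m' Z' * ?T * ((1\<^sub>m (m * M) - ?L) * resolvent m Z) = resolvent m' Z' * ?T"
    unfolding res(2) by (simp add: mat_units)
  ultimately have res_T: "resolvent m' Z' * ?T = ?T * resolvent m Z" by (simp only:)
  have out: "output_map m' Z' * ?T = kron T (1\<^sub>m s) * output_map m Z"
  proof -
    have "output_map m' Z' * ?T = kron (1\<^sub>m m') B * ?T * resolvent m Z"
      by (simp add: output_map_def mat_assoc res_T)
    also have "kron (1\<^sub>m m') B * ?T = kron T (1\<^sub>m s) * kron (1\<^sub>m m) B" using const[of B] by simp
    finally show ?thesis by (simp add: output_map_def mat_assoc)
  qed
  have "output_map m' Z' * arrow m' Z' * kron (1\<^sub>m m') C * kron T (1\<^sub>m t) =
      output_map m' Z' * (arrow m' Z' * (kron (1\<^sub>m m') C * kron T (1\<^sub>m t)))"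
    by (simp add: mat_assoc)
  also have "\<dots> = output_map m' Z' * (arrow m' Z' * kron T (1\<^sub>m (d * M))) * kron (1\<^sub>m m) C"
    using const[of C] by (simp add: mat_assoc)
  also have "\<dots> = output_map m' Z' * ?T * (arrow m Z * kron (1\<^sub>m m) C)"
    unfolding arrow by (simp add: mat_assoc)
  also have "\<dots> = kron T (1\<^sub>m s) * (output_map m Z * arrow m Z * kron (1\<^sub>m m) C)"
    unfolding out by (simp add: mat_assoc)
  finally show ?thesis
    using const[of A] by (simp add: transfer_def mat_distrib)
qed

end
section \<open>Transfer functions are contractive nc functions\<close>

definition inclusion :: "nat \<Rightarrow> nat \<Rightarrow> nat \<Rightarrow> complex mat" where
  "inclusion offset k n = mat n k (\<lambda>(i, j). if i = j + offset then 1 else 0)"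

lemma dim_inclusion [simp]: "dim_row (inclusion offset k n) = n" "dim_col (inclusion offset k n) = k"
  by (simp_all add: inclusion_def)

lemma inclusion_mult:
  assumes A: "dim_row A = k" and i: "i < n" "j < dim_col A"
  shows "(inclusion offset k n * A) $$ (i, j) =
    (if offset \<le> i \<and> i < offset + k then A $$ (i - offset, j) else 0)"
proof -
  have "(inclusion offset k n * A) $$ (i, j) = (\<Sum>l<k. (if i = l + offset then 1 else 0) * A $$ (l, j))"
    using A i by (subst index_mult_sum) (auto simp: inclusion_def)
  also have "\<dots> = (\<Sum>l<k. if l = i - offset then if offset \<le> i then A $$ (l, j) else 0 else 0)"
    by (intro sum.cong) auto
  finally show ?thesis by auto
qed

lemma inclusion_adj_mult:
  assumes A: "dim_row A = n" and i: "i < k" "j < dim_col A" and le: "offset + k \<le> n"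
  shows "(adj (inclusion offset k n) * A) $$ (i, j) = A $$ (i + offset, j)"
proof -
  have "(adj (inclusion offset k n) * A) $$ (i, j) = (\<Sum>l<n. (if l = i + offset then 1 else 0) * A $$ (l, j))"
    using A i by (subst index_mult_sum) (auto simp: inclusion_def intro!: sum.cong)
  also have "\<dots> = (\<Sum>l<n. if l = i + offset then A $$ (l, j) else 0)"
    by (intro sum.cong) auto
  also have "\<dots> = A $$ (i + offset, j)" using i le by simp
  finally show ?thesis .
qed

lemma inclusion_conj:
  assumes A: "A \<in> carrier_mat k k" and ij: "i < n" "j < n"
  shows "(inclusion offset k n * A * adj (inclusion offset k n)) $$ (i, j) =
    (if offset \<le> i \<and> i < offset + k \<and> offset \<le> j \<and> j < offset + k then A $$ (i - offset, j - offset) else 0)"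
proof -
  let ?J = "inclusion offset k n"
  have [simp]: "dim_row A = k" "dim_col A = k" using A by auto
  have "(?J * A * adj ?J) $$ (i, j) = (?J * (A * adj ?J)) $$ (i, j)" by (simp add: mat_assoc)
  also have "\<dots> = (if offset \<le> i \<and> i < offset + k then (A * adj ?J) $$ (i - offset, j) else 0)"
    using ij by (intro inclusion_mult) auto
  also have "(A * adj ?J) $$ (i - offset, j) = cnj ((?J * adj A) $$ (j, i - offset))"
    if "offset \<le> i" "i < offset + k"
    using that ij index_adj[of "i - offset" "?J * adj A" j] by (simp add: adj_mult)
  then have "(if offset \<le> i \<and> i < offset + k then (A * adj ?J) $$ (i - offset, j) else 0) =
      (if offset \<le> i \<and> i < offset + k then cnj ((?J * adj A) $$ (j, i - offset)) else 0)"
    by simp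
  also have "\<dots> = (if offset \<le> i \<and> i < offset + k \<and> offset \<le> j \<and> j < offset + k then A $$ (i - offset, j - offset) else 0)"
    using ij by (auto simp: inclusion_mult simp del: index_mult_mat(1))
  finally show ?thesis .
qed

text \<open>Written with isometric inclusions, a direct sum becomes a pair of intertwining
  relations, so that respect for direct sums and for similarities has a common source.\<close>

lemma direct_sum_inclusion:
  assumes A: "A \<in> carrier_mat m m" and B: "B \<in> carrier_mat m' m'"
  defines "J \<equiv> inclusion 0 m (m + m')" and "J' \<equiv> inclusion m m' (m + m')"
  shows "direct_sum A B = J * A * adj J + J' * B * adj J'"
proof (rule eq_matI)
  have [simp]: "dim_row A = m" "dim_col A = m" "dim_row B = m'" "dim_col B = m'" using A B by auto
  fix i j assume "i < dim_row (J * A * adj J + J' * B * adj J')" "j < dim_col (J * A * adj J + J' * B * adj J')"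
  then have ij: "i < m + m'" "j < m + m'" by (auto simp: J'_def)
  then show "direct_sum A B $$ (i, j) = (J * A * adj J + J' * B * adj J') $$ (i, j)"
    by (simp add: J_def J'_def inclusion_conj[OF A] inclusion_conj[OF B] direct_sum_def del: index_mult_mat(1))
qed (use A B in \<open>auto simp: direct_sum_def J'_def\<close>)

lemma inclusion_isometry:
  assumes "offset + k \<le> n"
  shows "adj (inclusion offset k n) * inclusion offset k n = 1\<^sub>m k"
proof (rule eq_matI)
  fix i j assume "i < dim_row (1\<^sub>m k)" "j < dim_col (1\<^sub>m k)"
  then have "i < k" "j < k" by auto
  then have "(adj (inclusion offset k n) * inclusion offset k n) $$ (i, j) = inclusion offset k n $$ (i + offset, j)"
    using assms by (intro inclusion_adj_mult) auto
  then show "(adj (inclusion offset k n) * inclusion offset k n) $$ (i, j) = 1\<^sub>m k $$ (i, j)"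
    using assms \<open>i < k\<close> \<open>j < k\<close> by (simp add: inclusion_def del: index_mult_mat(1))
qed auto

lemma inclusion_orthogonal:
  "adj (inclusion 0 m (m + m')) * inclusion m m' (m + m') = 0\<^sub>m m m'"
  "adj (inclusion m m' (m + m')) * inclusion 0 m (m + m') = 0\<^sub>m m' m"
proof -
  show *: "adj (inclusion 0 m (m + m')) * inclusion m m' (m + m') = 0\<^sub>m m m'"
  proof (rule eq_matI)
    fix i j assume "i < dim_row (0\<^sub>m m m' :: complex mat)" "j < dim_col (0\<^sub>m m m' :: complex mat)"
    then have "i < m" "j < m'" by auto
    then have "(adj (inclusion 0 m (m + m')) * inclusion m m' (m + m')) $$ (i, j) = inclusion m m' (m + m') $$ (i + 0, j)"
      by (intro inclusion_adj_mult) auto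
    then show "(adj (inclusion 0 m (m + m')) * inclusion m m' (m + m')) $$ (i, j) = 0\<^sub>m m m' $$ (i, j)"
      using \<open>i < m\<close> \<open>j < m'\<close> by (simp add: inclusion_def del: index_mult_mat(1))
  qed auto
  show "adj (inclusion m m' (m + m')) * inclusion 0 m (m + m') = 0\<^sub>m m' m"
    using arg_cong[OF *, of adj] by (simp add: adj_mult)
qed

lemma inclusion_complete:
  "inclusion 0 m (m + m') * adj (inclusion 0 m (m + m')) +
   inclusion m m' (m + m') * adj (inclusion m m' (m + m')) = 1\<^sub>m (m + m')"
proof -
  have "direct_sum (1\<^sub>m m) (1\<^sub>m m') = 1\<^sub>m (m + m')"
    by (simp add: direct_sum_def)
  then show ?thesis using direct_sum_inclusion[of "1\<^sub>m m" m "1\<^sub>m m'" m'] by (simp add: mat_units)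
qed

lemma direct_sum_mult_inclusion:
  assumes A: "A \<in> carrier_mat m m" and B: "B \<in> carrier_mat m' m'"
  shows "direct_sum A B * inclusion 0 m (m + m') = inclusion 0 m (m + m') * A"
    and "direct_sum A B * inclusion m m' (m + m') = inclusion m m' (m + m') * B"
proof -
  have [simp]: "dim_row A = m" "dim_col A = m" "dim_row B = m'" "dim_col B = m'" using A B by auto
  show "direct_sum A B * inclusion 0 m (m + m') = inclusion 0 m (m + m') * A"
    unfolding direct_sum_inclusion[OF A B]
    by (simp add: mat_algebra inclusion_orthogonal inclusion_isometry)
       (intro eq_matI; simp add: index_mult_sum del: index_mult_mat(1))
  show "direct_sum A B * inclusion m m' (m + m') = inclusion m m' (m + m') * B"
    unfolding direct_sum_inclusion[OF A B]
    by (simp add: mat_algebra inclusion_orthogonal inclusion_isometry)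
       (intro eq_matI; simp add: index_mult_sum del: index_mult_mat(1))
qed

lemma psd_scalar_mono:
  assumes "psd (scalar_mat c n - A)" "A \<in> carrier_mat n n" "c \<le> c'"
  shows "psd (scalar_mat c' n - A)"
proof -
  have "scalar_mat c' n - A =
      (scalar_mat c n - A) + scalar_mat (c' - c) n"
    using assms(2) by (intro eq_matI) (auto simp: algebra_simps)
  moreover have "scalar_mat c n - A \<in> carrier_mat n n" by (rule minus_carrier_mat[OF assms(2)])
  ultimately show ?thesis
    using assms(1,3) by (simp only:) (intro psd_add[of _ n] psd_smult[of _ n] psd_one; simp)
qed

text \<open>The projections onto the two coordinate blocks sum to the identity, so the Gram matrix
  of the row splits into those of X and Y, conjugated by J and J'. The larger of the two margins
  serves for both.\<close>

lemma direct_sum_row_ball: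
  assumes X: "X \<in> row_ball_level d m" and Y: "Y \<in> row_ball_level d m'"
  shows "map2 direct_sum X Y \<in> row_ball_level d (m + m')"
proof -
  note Xc = row_ball_levelD(1,2)[OF X] and Yc = row_ball_levelD(1,2)[OF Y]
  let ?Z = "map2 direct_sum X Y" and ?n = "m + m'"
  define J J' where "J = inclusion 0 m ?n" and "J' = inclusion m m' ?n"
  have [simp]: "dim_row J = ?n" "dim_col J = m" "dim_row J' = ?n" "dim_col J' = m'"
    by (simp_all add: J_def J'_def)
  have JC: "J \<in> carrier_mat ?n m" "J' \<in> carrier_mat ?n m'" by (rule carrier_matI; simp)+
  let ?x = "row_matrix d m X" and ?y = "row_matrix d m' Y" and ?z = "row_matrix d ?n ?Z"
  have Zk: "X ! k \<in> carrier_mat m m" "Y ! k \<in> carrier_mat m' m'" "?Z ! k = direct_sum (X ! k) (Y ! k)"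
    if "k < d" for k using that Xc Yc nth_mem[of k X] nth_mem[of k Y] by auto
  have DC: "direct_sum A B \<in> carrier_mat ?n ?n" if "A \<in> carrier_mat m m" "B \<in> carrier_mat m' m'" for A B
    using that by (auto simp: direct_sum_def)
  have zJ: "?z * kron J (1\<^sub>m d) = J * ?x"
  proof (rule row_matrix_intertwine[OF JC(1)])
    fix k assume k: "k < d"
    show "X ! k \<in> carrier_mat m m" "?Z ! k \<in> carrier_mat ?n ?n" using Zk[OF k] DC by auto
    show "?Z ! k * J = J * X ! k"
      unfolding Zk(3)[OF k] J_def by (rule direct_sum_mult_inclusion(1)[OF Zk(1,2)[OF k]])
  qed
  have zJ': "?z * kron J' (1\<^sub>m d) = J' * ?y"
  proof (rule row_matrix_intertwine[OF JC(2)])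
    fix k assume k: "k < d"
    show "Y ! k \<in> carrier_mat m' m'" "?Z ! k \<in> carrier_mat ?n ?n" using Zk[OF k] DC by auto
    show "?Z ! k * J' = J' * Y ! k"
      unfolding Zk(3)[OF k] J'_def by (rule direct_sum_mult_inclusion(2)[OF Zk(1,2)[OF k]])
  qed
  obtain c1 where c1: "0 < c1" "c1 < 1" "psd (complex_of_real c1 \<cdot>\<^sub>m 1\<^sub>m m - ?x * adj ?x)"
    using row_ball_levelD(3)[OF X] by blast
  obtain c2 where c2: "0 < c2" "c2 < 1" "psd (complex_of_real c2 \<cdot>\<^sub>m 1\<^sub>m m' - ?y * adj ?y)"
    using row_ball_levelD(3)[OF Y] by blast
  define c where "c = max c1 c2"
  have C: "?x * adj ?x \<in> carrier_mat m m" "?y * adj ?y \<in> carrier_mat m' m'" by (rule carrier_matI; simp)+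
  have px: "psd (scalar_mat c m - ?x * adj ?x)"
    by (rule psd_scalar_mono[OF c1(3) C(1)]) (simp add: c_def)
  have py: "psd (scalar_mat c m' - ?y * adj ?y)"
    by (rule psd_scalar_mono[OF c2(3) C(2)]) (simp add: c_def)
  have complete: "J * adj J + J' * adj J' = 1\<^sub>m ?n" unfolding J_def J'_def by (rule inclusion_complete)
  have zz: "?z * adj ?z = J * (?x * adj ?x) * adj J + J' * (?y * adj ?y) * adj J'"
  proof -
    have "?z * adj ?z = ?z * kron (J * adj J + J' * adj J') (1\<^sub>m d) * adj ?z"
      unfolding complete by (simp add: kron_one mat_units)
    also have "\<dots> = ?z * (kron J (1\<^sub>m d) * adj (kron J (1\<^sub>m d))) * adj ?z +
        ?z * (kron J' (1\<^sub>m d) * adj (kron J' (1\<^sub>m d))) * adj ?z"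
      by (simp add: kron_add kron_adj kron_mult mat_units mat_distrib)
    also have "\<dots> = (?z * kron J (1\<^sub>m d)) * adj (?z * kron J (1\<^sub>m d)) +
        (?z * kron J' (1\<^sub>m d)) * adj (?z * kron J' (1\<^sub>m d))"
      by (simp add: adj_mult mat_assoc)
    also have "\<dots> = J * (?x * adj ?x) * adj J + J' * (?y * adj ?y) * adj J'"
      unfolding zJ zJ' by (simp add: adj_mult mat_assoc)
    finally show ?thesis .
  qed
  have "J * (scalar_mat c m - ?x * adj ?x) * adj J + J' * (scalar_mat c m' - ?y * adj ?y) * adj J' =
      complex_of_real c \<cdot>\<^sub>m (J * adj J + J' * adj J') - ?z * adj ?z"
    unfolding zz by (simp add: mat_algebra) (intro eq_matI; simp add: algebra_simps del: index_mult_mat(1))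
  moreover have "psd (J * (scalar_mat c m - ?x * adj ?x) * adj J + J' * (scalar_mat c m' - ?y * adj ?y) * adj J')"
  proof (rule psd_add)
    show "psd (J * (scalar_mat c m - ?x * adj ?x) * adj J)" by (rule psd_congruence[OF px]) simp
    show "psd (J' * (scalar_mat c m' - ?y * adj ?y) * adj J')" by (rule psd_congruence[OF py]) simp
  qed (rule carrier_matI; simp)+
  ultimately have psd: "psd (scalar_mat c ?n - ?z * adj ?z)" by (simp only: complete)
  have "length ?Z = d" using Xc Yc by simp
  moreover have "set ?Z \<subseteq> carrier_mat ?n ?n"
  proof
    fix A assume "A \<in> set ?Z"
    then obtain k where "k < d" "A = ?Z ! k" using Xc Yc by (auto simp: in_set_conv_nth)
    then show "A \<in> carrier_mat ?n ?n" using Zk DC by auto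
  qed
  ultimately show ?thesis
    using psd c1 c2 by (subst row_ball_level_iff) (simp, simp, auto simp: c_def intro!: exI[of _ c])
qed

text \<open>I - A B \<open>adj B\<close> \<open>adj A\<close> = (I - A \<open>adj A\<close>) + A (I
  - B \<open>adj B\<close>) \<open>adj A\<close>.\<close>

lemma contraction_mult:
  assumes A: "A \<in> carrier_mat n m" and B: "B \<in> carrier_mat m k"
    and psd: "psd (1\<^sub>m n - A * adj A)" "psd (1\<^sub>m m - B * adj B)"
  shows "psd (1\<^sub>m n - (A * B) * adj (A * B))"
proof -
  have [simp]: "dim_row A = n" "dim_col A = m" "dim_row B = m" "dim_col B = k" using A B by auto
  have p: "psd (A * (1\<^sub>m m - B * adj B) * adj A)" by (rule psd_congruence[OF psd(2)]) simp
  have "psd ((1\<^sub>m n - A * adj A) + A * (1\<^sub>m m - B * adj B) * adj A)"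
    by (rule psd_add[OF _ _ psd(1) p]) (rule carrier_matI; simp)+
  also have "(1\<^sub>m n - A * adj A) + A * (1\<^sub>m m - B * adj B) * adj A = 1\<^sub>m n - (A * B) * adj (A * B)"
    by (simp add: mat_algebra) (intro eq_matI; simp del: index_mult_mat(1))
  finally show ?thesis .
qed

text \<open>A block is the product of the tensor with a coisometry on the left and the adjoint of a
  coisometry on the right, hence a product of contractions. This bounds each single entry of the
  transfer function.\<close>

lemma tensor_block_contraction:
  assumes F: "\<And>i j. i < s \<Longrightarrow> j < t \<Longrightarrow> F i j \<in> carrier_mat m m" and ij: "i < s" "j < t"
    and psd: "psd (1\<^sub>m (m * s) - tensor_blocks m m s t F * adj (tensor_blocks m m s t F))"
  shows "psd (1\<^sub>m m - F i j * adj (F i j))"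
proof -
  let ?\<Phi> = "tensor_blocks m m s t F"
  \<comment> \<open>\<open>E i s\<close> is I \<otimes> e_i^T: it selects the rows with last digit
    \<open>i\<close>. Its parameters are local, as it is used with \<open>s\<close> for the rows and
    with \<open>t\<close> for the columns.\<close>
  define E where "E i s = mat m (m * s) (\<lambda>(a, p). if p = a * s + i then 1 else (0::complex))" for i s
  have [simp]: "dim_row (E i s) = m" "dim_col (E i s) = m * s" for i s by (simp_all add: E_def)
  have E_mult: "(E i s * A) $$ (a, q) = A $$ (a * s + i, q)"
    if "i < s" "a < m" "q < dim_col A" "dim_row A = m * s" for i s a q A
  proof -
    have "(E i s * A) $$ (a, q) = (\<Sum>p<m * s. (if p = a * s + i then 1 else 0) * A $$ (p, q))"
      using that by (subst index_mult_sum) (auto simp: E_def)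
    also have "\<dots> = (\<Sum>p<m * s. if p = a * s + i then A $$ (p, q) else 0)" by (intro sum.cong) auto
    also have "\<dots> = A $$ (a * s + i, q)" using digits_less[OF that(2,1)] by simp
    finally show ?thesis .
  qed
  have coiso: "E i s * adj (E i s) = 1\<^sub>m m" if i: "i < s" for i s
  proof (rule eq_matI)
    fix a b assume "a < dim_row (1\<^sub>m m)" "b < dim_col (1\<^sub>m m)"
    then have ab: "a < m" "b < m" by auto
    have "(E i s * adj (E i s)) $$ (a, b) = adj (E i s) $$ (a * s + i, b)"
      using ab i by (intro E_mult) auto
    then show "(E i s * adj (E i s)) $$ (a, b) = 1\<^sub>m m $$ (a, b)"
      using ab i digits_less[OF ab(1) i] by (simp add: E_def del: index_mult_mat(1))
  qed auto
  have Fij: "F i j = E i s * (?\<Phi> * adj (E j t))"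
  proof (rule eq_matI)
    fix a b assume "a < dim_row (E i s * (?\<Phi> * adj (E j t)))" "b < dim_col (E i s * (?\<Phi> * adj (E j t)))"
    then have ab: "a < m" "b < m" by auto
    note lt = digits_less[OF ab(1) ij(1)] digits_less[OF ab(2) ij(2)]
    have "(E i s * (?\<Phi> * adj (E j t))) $$ (a, b) = (?\<Phi> * adj (E j t)) $$ (a * s + i, b)"
      using ab ij by (intro E_mult) auto
    also have "\<dots> = cnj ((E j t * adj ?\<Phi>) $$ (b, a * s + i))"
      using index_adj[of "a * s + i" "E j t * adj ?\<Phi>" b] ab lt by (simp add: adj_mult)
    also have "(E j t * adj ?\<Phi>) $$ (b, a * s + i) = adj ?\<Phi> $$ (b * t + j, a * s + i)"
      using ab ij lt by (intro E_mult) auto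
    finally show "F i j $$ (a, b) = (E i s * (?\<Phi> * adj (E j t))) $$ (a, b)"
      using ab ij lt by (simp del: index_mult_mat(1))
  qed (use F[OF ij] in auto)
  have zero: "psd (1\<^sub>m m - 1\<^sub>m m)"
  proof -
    have "1\<^sub>m m - 1\<^sub>m m = (0\<^sub>m m m :: complex mat)" by (intro eq_matI) auto
    then show ?thesis by (simp only: psd_zero)
  qed
  have C: "E i s \<in> carrier_mat m (m * s)" "E j t \<in> carrier_mat m (m * t)" "?\<Phi> \<in> carrier_mat (m * s) (m * t)"
    by (rule carrier_matI; simp)+
  have p1: "psd (1\<^sub>m m - E i s * adj (E i s))" unfolding coiso[OF ij(1)] by (rule zero)
  have "psd (1\<^sub>m m - E j t * adj (E j t))" unfolding coiso[OF ij(2)] by (rule zero)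
  from psd_coisometry[OF this C(2)]
  have p2: "psd (1\<^sub>m (m * t) - adj (E j t) * adj (adj (E j t)))" by simp
  show ?thesis
    unfolding Fij
    by (rule contraction_mult[OF C(1) mult_carrier_mat[OF C(3) adj_carrier[OF C(2)]] p1
          contraction_mult[OF C(3) adj_carrier[OF C(2)] psd p2]])
qed

section \<open>The entries of the transfer function as nc functions\<close>

context coisometric_colligation
begin

text \<open>An nc function receives a tuple without its level. The size is read off the first matrix
  of the tuple, which exists as soon as d \<ge> 1.\<close>

definition entry :: "nat \<Rightarrow> nat \<Rightarrow> complex mat list \<Rightarrow> complex mat" where
  "entry i j Z = (let m = dim_row (hd Z) in mat m m (\<lambda>(a, b). transfer m Z $$ (a * s + i, b * t + j)))"

lemma row_ball_dim:
  assumes "1 \<le> d" "Z \<in> row_ball_level d m"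
  shows "dim_row (hd Z) = m"
proof -
  have "hd Z \<in> set Z" using assms row_ball_levelD(1)[OF assms(2)] by (cases Z) auto
  then show ?thesis using row_ball_levelD(2)[OF assms(2)] by auto
qed

lemma entry_carrier:
  assumes "1 \<le> d" "Z \<in> row_ball_level d m"
  shows "entry i j Z \<in> carrier_mat m m"
  by (simp add: entry_def Let_def row_ball_dim[OF assms])

lemma tensor_blocks_entry:
  assumes "1 \<le> d" "Z \<in> row_ball_level d m"
  shows "tensor_blocks m m s t (\<lambda>i j. entry i j Z) = transfer m Z"
proof (rule eq_matI)
  fix p q assume "p < dim_row (transfer m Z)" "q < dim_col (transfer m Z)"
  then have pq: "p < m * s" "q < m * t" using transfer_carrier[OF assms(2)] by auto
  then show "tensor_blocks m m s t (\<lambda>i j. entry i j Z) $$ (p, q) = transfer m Z $$ (p, q)"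
    using digit_bounds[OF pq(1)] digit_bounds[OF pq(2)] row_ball_dim[OF assms]
    by (simp add: entry_def)
qed (use transfer_carrier[OF assms(2)] in auto)

text \<open>A tensor of blocks determines its blocks, so the intertwining relation of the transfer
  function descends to each entry.\<close>

lemma entry_intertwine:
  assumes d: "1 \<le> d" and Z: "Z \<in> row_ball_level d m" and Z': "Z' \<in> row_ball_level d m'"
    and T: "T \<in> carrier_mat m' m" and eq: "\<And>k. k < d \<Longrightarrow> Z' ! k * T = T * Z ! k" and ij: "i < s" "j < t"
  shows "entry i j Z' * T = T * entry i j Z"
proof -
  have "tensor_blocks m' m s t (\<lambda>i j. entry i j Z' * T) = transfer m' Z' * kron T (1\<^sub>m t)"
    unfolding tensor_blocks_entry[OF d Z', symmetric]
    by (rule tensor_blocks_mult_kron[OF _ T, symmetric]) (rule entry_carrier[OF d Z'])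
  also have "\<dots> = kron T (1\<^sub>m s) * transfer m Z" by (rule transfer_intertwine[OF Z Z' T]) (rule eq)
  also have "\<dots> = tensor_blocks m' m s t (\<lambda>i j. T * entry i j Z)"
    unfolding tensor_blocks_entry[OF d Z, symmetric]
    by (rule kron_mult_tensor_blocks[OF _ T]) (rule entry_carrier[OF d Z])
  finally have *: "tensor_blocks m' m s t (\<lambda>i j. entry i j Z' * T) =
      tensor_blocks m' m s t (\<lambda>i j. T * entry i j Z)" .
  show ?thesis
    by (rule tensor_blocks_inject[OF * mult_carrier_mat[OF entry_carrier[OF d Z'] T]
          mult_carrier_mat[OF T entry_carrier[OF d Z]] ij])
qed

lemma entry_nc:
  assumes d: "1 \<le> d" and ij: "i < s" "j < t"
  shows "nc_function d (entry i j)"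
  unfolding nc_function_def
proof (intro conjI allI ballI impI)
  fix m X assume "X \<in> row_ball_level d m"
  then show "entry i j X \<in> carrier_mat m m" by (rule entry_carrier[OF d])
next
  fix X Y assume "X \<in> row_ball d" "Y \<in> row_ball d"
  then obtain m m' where X: "X \<in> row_ball_level d m" and Y: "Y \<in> row_ball_level d m'"
    by (auto simp: row_ball_def)
  note Xc = row_ball_levelD(1,2)[OF X] and Yc = row_ball_levelD(1,2)[OF Y]
  let ?Z = "map2 direct_sum X Y" and ?n = "m + m'"
  define J J' where "J = inclusion 0 m ?n" and "J' = inclusion m m' ?n"
  have [simp]: "dim_row J = ?n" "dim_col J = m" "dim_row J' = ?n" "dim_col J' = m'"
    by (simp_all add: J_def J'_def)
  have JC: "J \<in> carrier_mat ?n m" "J' \<in> carrier_mat ?n m'" by (rule carrier_matI; simp)+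
  have Z: "?Z \<in> row_ball_level d ?n" by (rule direct_sum_row_ball[OF X Y])
  have Zk: "X ! k \<in> carrier_mat m m" "Y ! k \<in> carrier_mat m' m'" "?Z ! k = direct_sum (X ! k) (Y ! k)"
    if "k < d" for k using that Xc Yc nth_mem[of k X] nth_mem[of k Y] by auto
  let ?f = "entry i j"
  have [simp]: "dim_row (?f ?Z) = ?n" "dim_col (?f ?Z) = ?n" using entry_carrier[OF d Z, of i j] by auto
  have [simp]: "dim_row (?f X) = m" "dim_col (?f X) = m" using entry_carrier[OF d X, of i j] by auto
  have [simp]: "dim_row (?f Y) = m'" "dim_col (?f Y) = m'" using entry_carrier[OF d Y, of i j] by auto
  have fJ: "?f ?Z * J = J * ?f X"
  proof (rule entry_intertwine[OF d X Z JC(1) _ ij])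
    fix k assume k: "k < d"
    show "?Z ! k * J = J * X ! k"
      unfolding Zk(3)[OF k] J_def by (rule direct_sum_mult_inclusion(1)[OF Zk(1,2)[OF k]])
  qed
  have fJ': "?f ?Z * J' = J' * ?f Y"
  proof (rule entry_intertwine[OF d Y Z JC(2) _ ij])
    fix k assume k: "k < d"
    show "?Z ! k * J' = J' * Y ! k"
      unfolding Zk(3)[OF k] J'_def by (rule direct_sum_mult_inclusion(2)[OF Zk(1,2)[OF k]])
  qed
  \<comment> \<open>J and J' split the identity, so the value at the direct sum is determined by its
    products with J and J'.\<close>
  have "?f ?Z = ?f ?Z * (J * adj J + J' * adj J')"
    unfolding J_def J'_def inclusion_complete by (simp add: mat_units)
  also have "\<dots> = (?f ?Z * J) * adj J + (?f ?Z * J') * adj J'"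
    by (simp add: mat_distrib mat_assoc)
  also have "\<dots> = direct_sum (?f X) (?f Y)"
    unfolding fJ fJ'
    unfolding direct_sum_inclusion[OF entry_carrier[OF d X] entry_carrier[OF d Y]] J_def J'_def ..
  finally show "?f ?Z = direct_sum (?f X) (?f Y)" .
next
  fix m :: nat and X S assume X: "X \<in> row_ball_level d m" and S: "S \<in> carrier_mat m m"
    and inv: "invertible_mat S" and ball: "map (\<lambda>A. mat_inv S * A * S) X \<in> row_ball d"
  note Xc = row_ball_levelD(1,2)[OF X]
  have [simp]: "dim_row S = m" "dim_col S = m" using S by auto
  obtain T where T: "S * T = 1\<^sub>m m" "T * S = 1\<^sub>m (dim_row T)"
    using inv by (auto simp: invertible_mat_def inverts_mat_def)
  have "dim_col T = m" "dim_row T = m"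
    using arg_cong[OF T(1), of dim_col] arg_cong[OF T(2), of dim_col] by simp_all
  then have Tc: "T \<in> carrier_mat m m" and T2: "T * S = 1\<^sub>m m" and [simp]: "dim_row T = m" "dim_col T = m"
    using T(2) by auto
  have invS: "mat_inv S = T" by (rule mat_inv_eqI[OF S Tc T(1) T2])
  let ?Z = "map (\<lambda>A. T * A * S) X"
  obtain m' where Z': "?Z \<in> row_ball_level d m'" using ball by (auto simp: row_ball_def invS)
  \<comment> \<open>Membership in \<open>row_ball\<close> gives only some level \<open>m'\<close>;
    the size of the first matrix forces \<open>m' = m\<close>.\<close>
  have "dim_row (hd ?Z) = m" using Xc d by (cases X) auto
  then have Z: "?Z \<in> row_ball_level d m" using Z' row_ball_dim[OF d Z'] by simp
  have [simp]: "dim_row (entry i j ?Z) = m" using entry_carrier[OF d Z, of i j] by auto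
  have [simp]: "dim_row (entry i j X) = m" "dim_col (entry i j X) = m" using entry_carrier[OF d X, of i j] by auto
  have "entry i j X * S = S * entry i j ?Z"
  proof (rule entry_intertwine[OF d Z X S _ ij])
    fix k assume k: "k < d"
    have "X ! k \<in> carrier_mat m m" using k Xc nth_mem[of k X] by auto
    then have [simp]: "dim_row (X ! k) = m" "dim_col (X ! k) = m" by auto
    have "S * (T * (X ! k * S)) = X ! k * S"
      using mult_cong_right[OF T(1), of "X ! k * S"] by (simp add: mat_units)
    then show "X ! k * S = S * ?Z ! k" using k Xc by (simp add: mat_assoc)
  qed
  then have "T * (entry i j X * S) = T * (S * entry i j ?Z)" by simp
  also have "\<dots> = entry i j ?Z" using mult_cong_right[OF T2, of "entry i j ?Z"] by (simp add: mat_units)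
  finally show "entry i j (map (\<lambda>A. mat_inv S * A * S) X) = mat_inv S * entry i j X * S"
    unfolding invS by (simp add: mat_assoc)
qed

lemma entry_H_infinity:
  assumes d: "1 \<le> d" and ij: "i < s" "j < t"
  shows "entry i j \<in> H_infinity d"
proof -
  have "op_norm (entry i j Z) \<le> 1" if ball: "Z \<in> row_ball d" for Z
  proof -
    obtain m where Z: "Z \<in> row_ball_level d m" using ball by (auto simp: row_ball_def)
    have "psd (1\<^sub>m m - entry i j Z * adj (entry i j Z))"
      by (rule tensor_block_contraction[of s t "\<lambda>i j. entry i j Z", OF entry_carrier[OF d Z] ij])
         (simp only: tensor_blocks_entry[OF d Z] transfer_contractive[OF Z])
    then show ?thesis using op_norm_le_one_iff[OF entry_carrier[OF d Z]] by blast
  qed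
  then have "(SUP X\<in>row_ball d. ereal (op_norm (entry i j X))) \<le> 1" by (intro SUP_least) auto
  also have "(1::ereal) < \<infinity>" by simp
  finally show ?thesis using entry_nc[OF assms] by (simp add: H_infinity_def)
qed

lemma entry_norm:
  assumes d: "1 \<le> d"
  shows "H_infinity_norm d (mat s t (\<lambda>(i, j). entry i j)) \<le> 1"
  unfolding H_infinity_norm_def
proof (intro SUP_least)
  fix m Z assume Z: "Z \<in> row_ball_level d m"
  let ?F = "map_mat (\<lambda>f. f Z) (mat s t (\<lambda>(i, j). entry i j))"
  have "tensor_blocks m m s t (\<lambda>i j. ?F $$ (i, j)) = transfer m Z"
    unfolding tensor_blocks_entry[OF d Z, symmetric] by (rule tensor_blocks_cong) simp
  then have "op_norm (block_matrix m ?F) \<le> 1"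
    using block_matrix_norm_iff[of ?F s t m] transfer_contractive[OF Z] entry_carrier[OF d Z] by simp
  then show "ereal (op_norm (block_matrix m ?F)) \<le> 1" by simp
qed

end
section \<open>Sufficiency\<close>

text \<open>\<open>equal_gram_factor\<close> is applied to the rows [U R] and [W Q], assembled with
  coordinate inclusions; the factor V and its defect G are then cut into blocks by the same
  inclusions. G keeps all its s + p columns, whence the sizes of G1 and G2.\<close>

lemma equal_gram_colligation:
  assumes c: "U \<in> carrier_mat N s" "R \<in> carrier_mat N p" "W \<in> carrier_mat N t" "Q \<in> carrier_mat N q"
    and gram: "U * adj U + R * adj R = W * adj W + Q * adj Q"
  obtains A B C D G1 G2 where "A \<in> carrier_mat s t" "B \<in> carrier_mat s q" "C \<in> carrier_mat p t"
    "D \<in> carrier_mat p q" "G1 \<in> carrier_mat s (s + p)" "G2 \<in> carrier_mat p (s + p)"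
    "A * adj A + B * adj B + G1 * adj G1 = 1\<^sub>m s"
    "A * adj C + B * adj D + G1 * adj G2 = 0\<^sub>m s p"
    "C * adj C + D * adj D + G2 * adj G2 = 1\<^sub>m p"
    "W = U * A + R * C" "Q = U * B + R * D"
proof -
  define I0 I1 K0 K1 where
    "I0 = inclusion 0 s (s + p)" and "I1 = inclusion s p (s + p)" and
    "K0 = inclusion 0 t (t + q)" and "K1 = inclusion t q (t + q)"
  note defs = I0_def I1_def K0_def K1_def
  have [simp]: "dim_row U = N" "dim_col U = s" "dim_row R = N" "dim_col R = p"
    "dim_row W = N" "dim_col W = t" "dim_row Q = N" "dim_col Q = q" using c by auto
  have [simp]: "dim_row I0 = s + p" "dim_col I0 = s" "dim_row I1 = s + p" "dim_col I1 = p"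
    "dim_row K0 = t + q" "dim_col K0 = t" "dim_row K1 = t + q" "dim_col K1 = q"
    by (simp_all add: defs)
  have iso: "adj I0 * I0 = 1\<^sub>m s" "adj I1 * I1 = 1\<^sub>m p" "adj K0 * K0 = 1\<^sub>m t" "adj K1 * K1 = 1\<^sub>m q"
    unfolding defs by (simp_all add: inclusion_isometry)
  have orth: "adj I0 * I1 = 0\<^sub>m s p" "adj I1 * I0 = 0\<^sub>m p s" "adj K0 * K1 = 0\<^sub>m t q" "adj K1 * K0 = 0\<^sub>m q t"
    unfolding defs by (simp_all add: inclusion_orthogonal)
  have K: "K0 * adj K0 + K1 * adj K1 = 1\<^sub>m (t + q)"
    unfolding defs by (simp_all add: inclusion_complete)
  have zero_left: "0\<^sub>m a b * X = 0\<^sub>m a (dim_col X)" if "dim_row X = b" for a b and X :: "complex mat"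
    using that by (intro eq_matI) auto
  have zero_right: "X * 0\<^sub>m a b = 0\<^sub>m (dim_row X) b" if "dim_col X = a" for a b and X :: "complex mat"
    using that by (intro eq_matI) auto
  define U' W' where "U' = U * adj I0 + R * adj I1" and "W' = W * adj K0 + Q * adj K1"
  have C': "U' \<in> carrier_mat N (s + p)" "W' \<in> carrier_mat N (t + q)"
    by (rule carrier_matI; simp add: U'_def W'_def)+
  have add0: "X + 0\<^sub>m a b = X" "0\<^sub>m a b + X = X" if "dim_row X = a" "dim_col X = b" for a b and X :: "complex mat"
    using that by (intro eq_matI; auto)+
  have "U' * adj U' = U * adj U + R * adj R"
    by (simp add: U'_def mat_algebra mult_cong_right[OF iso(1)] mult_cong_right[OF iso(2)]
        mult_cong_right[OF orth(1)] mult_cong_right[OF orth(2)] zero_left zero_right add0)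
  moreover have "W' * adj W' = W * adj W + Q * adj Q"
    by (simp add: W'_def mat_algebra mult_cong_right[OF iso(3)] mult_cong_right[OF iso(4)]
        mult_cong_right[OF orth(3)] mult_cong_right[OF orth(4)] zero_left zero_right add0)
  ultimately have "U' * adj U' = W' * adj W'" using gram by simp
  from equal_gram_factor[OF C' this]
  obtain V G where V: "V \<in> carrier_mat (s + p) (t + q)" and G: "G \<in> carrier_mat (s + p) (s + p)"
    and WV: "W' = U' * V" and VG: "V * adj V + G * adj G = 1\<^sub>m (s + p)" by blast
  have [simp]: "dim_row V = s + p" "dim_col V = t + q" "dim_row G = s + p" "dim_col G = s + p"
    using V G by auto
  \<comment> \<open>The coisometry [V G] tested between X and Y. With X and Y among
    \<open>I0\<close> and \<open>I1\<close> this gives all three equations of the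
    colligation.\<close>
  have coiso: "(adj X * V * K0) * adj (adj Y * V * K0) + (adj X * V * K1) * adj (adj Y * V * K1) +
      (adj X * G) * adj (adj Y * G) = adj X * Y"
    if [simp]: "dim_row X = s + p" "dim_row Y = s + p" for X Y
  proof -
    have "(adj X * V * K0) * adj (adj Y * V * K0) + (adj X * V * K1) * adj (adj Y * V * K1) =
        adj X * (V * (K0 * adj K0 + K1 * adj K1) * adj V) * Y"
      by (simp add: mat_algebra)
    also have "V * (K0 * adj K0 + K1 * adj K1) * adj V = V * adj V" unfolding K by (simp add: mat_units)
    finally have "(adj X * V * K0) * adj (adj Y * V * K0) + (adj X * V * K1) * adj (adj Y * V * K1) +
        (adj X * G) * adj (adj Y * G) = adj X * (V * adj V + G * adj G) * Y"
      by (simp add: mat_algebra)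
    then show ?thesis unfolding VG by (simp add: mat_units)
  qed
  have "W = W' * K0"
    by (simp add: W'_def mat_algebra iso orth zero_right add0)
  then have W: "W = U * (adj I0 * V * K0) + R * (adj I1 * V * K0)"
    by (simp add: WV U'_def mat_algebra)
  have "Q = W' * K1"
    by (simp add: W'_def mat_algebra iso orth zero_right add0)
  then have Q: "Q = U * (adj I0 * V * K1) + R * (adj I1 * V * K1)"
    by (simp add: WV U'_def mat_algebra)
  show thesis
  proof (rule that[of "adj I0 * V * K0" "adj I0 * V * K1" "adj I1 * V * K0" "adj I1 * V * K1" "adj I0 * G" "adj I1 * G"])
    show "adj I0 * V * K0 * adj (adj I0 * V * K0) + adj I0 * V * K1 * adj (adj I0 * V * K1) +
        adj I0 * G * adj (adj I0 * G) = 1\<^sub>m s" using coiso[of I0 I0] iso by simp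
    show "adj I0 * V * K0 * adj (adj I1 * V * K0) + adj I0 * V * K1 * adj (adj I1 * V * K1) +
        adj I0 * G * adj (adj I1 * G) = 0\<^sub>m s p" using coiso[of I0 I1] orth by simp
    show "adj I1 * V * K0 * adj (adj I1 * V * K0) + adj I1 * V * K1 * adj (adj I1 * V * K1) +
        adj I1 * G * adj (adj I1 * G) = 1\<^sub>m p" using coiso[of I1 I1] iso by simp
    show "W = U * (adj I0 * V * K0) + R * (adj I1 * V * K0)" by (rule W)
    show "Q = U * (adj I0 * V * K1) + R * (adj I1 * V * K1)" by (rule Q)
  qed (rule carrier_matI; simp)+
qed

text \<open>Moves the first tensor factor from the rows to the columns: a matrix with rows in
  \<open>\<complex>\<^sup>n \<otimes> \<complex>\<^sup>y\<close> and columns in \<open>\<complex>\<^sup>q\<close> becomes one with rows in \<open>\<complex>\<^sup>y\<close> and columns in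
  \<open>\<complex>\<^sup>n \<otimes> \<complex>\<^sup>q\<close>. It turns \<open>\<Sum> (X\<^sub>i\<^sup>T \<otimes> I) Q C\<^sub>i\<close> into the reshaped \<open>Q\<close> times
  \<open>\<Sum> X\<^sub>i \<otimes> C\<^sub>i\<close>.\<close>

definition reshape :: "nat \<Rightarrow> nat \<Rightarrow> complex mat \<Rightarrow> complex mat" where
  "reshape n y Q = mat y (n * dim_col Q) (\<lambda>(x, c). Q $$ ((c div dim_col Q) * y + x, c mod dim_col Q))"

lemma dim_reshape [simp]: "dim_row (reshape n y Q) = y" "dim_col (reshape n y Q) = n * dim_col Q"
  by (simp_all add: reshape_def)

lemma index_reshape [simp]:
  "x < y \<Longrightarrow> c < n * dim_col Q \<Longrightarrow>
    reshape n y Q $$ (x, c) = Q $$ ((c div dim_col Q) * y + x, c mod dim_col Q)"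
  by (simp add: reshape_def)

lemma reshape_add:
  assumes "A \<in> carrier_mat (n * y) q" "B \<in> carrier_mat (n * y) q"
  shows "reshape n y (A + B) = reshape n y A + reshape n y B"
proof (rule eq_matI)
  fix x c assume "x < dim_row (reshape n y A + reshape n y B)" "c < dim_col (reshape n y A + reshape n y B)"
  then have x: "x < y" and c: "c < n * q" using assms by auto
  then show "reshape n y (A + B) $$ (x, c) = (reshape n y A + reshape n y B) $$ (x, c)"
    using assms digit_bounds[OF c] digits_less[OF digit_bounds(1)[OF c] x] by auto
qed (use assms in auto)

lemma reshape_mult_right:
  assumes U: "U \<in> carrier_mat (n * y) q" and C: "C \<in> carrier_mat q r"
  shows "reshape n y (U * C) = reshape n y U * kron (1\<^sub>m n) C"
proof (rule eq_matI)
  have [simp]: "dim_row U = n * y" "dim_col U = q" "dim_row C = q" "dim_col C = r" using U C by auto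
  fix x c assume "x < dim_row (reshape n y U * kron (1\<^sub>m n) C)" "c < dim_col (reshape n y U * kron (1\<^sub>m n) C)"
  then have x: "x < y" and c: "c < n * r" by auto
  note b = digit_bounds[OF c] and lt = digits_less[OF digit_bounds(1)[OF c] x]
  have "(reshape n y U * kron (1\<^sub>m n) C) $$ (x, c) =
      (\<Sum>k<n * q. U $$ ((k div q) * y + x, k mod q) * ((if k div q = c div r then 1 else 0) * C $$ (k mod q, c mod r)))"
    using x c b by (subst index_mult_sum) (auto simp: digit_bounds)
  also have "\<dots> = (\<Sum>i<n. \<Sum>j<q. U $$ (i * y + x, j) * ((if i = c div r then 1 else 0) * C $$ (j, c mod r)))"
    by (rule sum_digits)
  also have "\<dots> = (\<Sum>i<n. (if c div r = i then 1 else 0) * (\<Sum>j<q. U $$ (i * y + x, j) * C $$ (j, c mod r)))"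
    by (intro sum.cong) (auto simp: sum_distrib_left)
  also have "\<dots> = (\<Sum>j<q. U $$ ((c div r) * y + x, j) * C $$ (j, c mod r))"
    using b by (simp add: sum_delta_mult)
  also have "\<dots> = (U * C) $$ ((c div r) * y + x, c mod r)" using lt b by (subst index_mult_sum) auto
  finally show "reshape n y (U * C) $$ (x, c) = (reshape n y U * kron (1\<^sub>m n) C) $$ (x, c)"
    using x c by simp
qed (use U C in auto)

lemma reshape_mult_left:
  assumes U: "U \<in> carrier_mat (n * y) q" and Q: "Q \<in> carrier_mat z y"
  shows "reshape n z (kron (1\<^sub>m n) Q * U) = Q * reshape n y U"
proof (rule eq_matI)
  have [simp]: "dim_row U = n * y" "dim_col U = q" "dim_row Q = z" "dim_col Q = y" using U Q by auto
  fix x c assume "x < dim_row (Q * reshape n y U)" "c < dim_col (Q * reshape n y U)"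
  then have x: "x < z" and c: "c < n * q" by auto
  note b = digit_bounds[OF c] and lt = digits_less[OF digit_bounds(1)[OF c] x]
  have "(kron (1\<^sub>m n) Q * U) $$ ((c div q) * z + x, c mod q) =
      (\<Sum>k<n * y. ((if c div q = k div y then 1 else 0) * Q $$ (x, k mod y)) * U $$ (k div y * y + k mod y, c mod q))"
    using lt b x by (subst index_mult_sum) (auto simp: digit_bounds)
  also have "\<dots> = (\<Sum>i<n. \<Sum>j<y. ((if c div q = i then 1 else 0) * Q $$ (x, j)) * U $$ (i * y + j, c mod q))"
    by (rule sum_digits)
  also have "\<dots> = (\<Sum>i<n. (if c div q = i then 1 else 0) * (\<Sum>j<y. Q $$ (x, j) * U $$ (i * y + j, c mod q)))"
    by (simp add: sum_distrib_left mult.assoc)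
  also have "\<dots> = (\<Sum>j<y. Q $$ (x, j) * U $$ ((c div q) * y + j, c mod q))"
    using b by (simp add: sum_delta_mult)
  also have "\<dots> = (Q * reshape n y U) $$ (x, c)" using x c b by (subst index_mult_sum) auto
  finally show "reshape n z (kron (1\<^sub>m n) Q * U) $$ (x, c) = (Q * reshape n y U) $$ (x, c)"
    using x c by simp
qed (use U Q in auto)

text \<open>Moving the first factor of vec I to the columns unstacks it into the identity matrix.
  Hence \<open>U\<close> drops out of the lurking isometry equation and leaves the terms I \<otimes>
  A and I \<otimes> B.\<close>

lemma reshape_vec_identity: "reshape n (n * s) (kron (vec_identity n) (1\<^sub>m s)) = 1\<^sub>m (n * s)"
proof (rule eq_matI)
  fix x c assume "x < dim_row (1\<^sub>m (n * s))" "c < dim_col (1\<^sub>m (n * s))"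
  then have x: "x < n * s" and c: "c < n * s" by auto
  note b = digit_bounds[OF x] digit_bounds[OF c]
  have s: "s > 0" using b by auto
  have lt: "c div s * (n * s) + x < n * (n * s)" by (rule digits_less[OF b(3) x])
  have "c div s * (n * s) + x = (c div s * n + x div s) * s + x mod s" by (simp add: algebra_simps)
  then have d: "(c div s * (n * s) + x) div s = c div s * n + x div s" "(c div s * (n * s) + x) mod s = x mod s"
    using b(2) by simp_all
  have "reshape n (n * s) (kron (vec_identity n) (1\<^sub>m s)) $$ (x, c) =
      (if c div s = x div s then 1 else 0) * (if x mod s = c mod s then 1 else 0)"
    using x c lt b s d digits_less[OF b(3) b(1)] by (simp add: vec_identity_def mult.assoc)
  also have "\<dots> = (if x = c then 1 else 0)"
  proof -
    have "x = c \<longleftrightarrow> c div s = x div s \<and> x mod s = c mod s" by (metis div_mult_mod_eq)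
    then show ?thesis by simp
  qed
  finally show "reshape n (n * s) (kron (vec_identity n) (1\<^sub>m s)) $$ (x, c) = 1\<^sub>m (n * s) $$ (x, c)"
    using x c by simp
qed auto

text \<open>The factor on which X_i^T acts from the left becomes part of the column index, so X_i
  acts there from the right and untransposed. This is why the second Stein equation, the one with
  transposes, leads to the transfer function at X itself.\<close>

lemma reshape_row:
  assumes X: "\<And>i. i < d \<Longrightarrow> X ! i \<in> carrier_mat n n" "length X = d" and Q: "Q \<in> carrier_mat (n * y) M"
  shows "reshape n y (kron (row_matrix_swapped d n (map transpose_mat X)) (1\<^sub>m y) * kron (1\<^sub>m d) Q) =
    reshape n y Q * kron (row_matrix d n X) (1\<^sub>m M)"
proof (rule eq_matI)
  let ?S = "kron (row_matrix_swapped d n (map transpose_mat X)) (1\<^sub>m y) * kron (1\<^sub>m d) Q"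
    and ?R = "reshape n y Q * kron (row_matrix d n X) (1\<^sub>m M)"
  have [simp]: "dim_row Q = n * y" "dim_col Q = M" using Q by auto
  fix x c assume "x < dim_row ?R" "c < dim_col ?R"
  then have x: "x < y" and c: "c < n * d * M" by auto
  have c': "c < n * (d * M)" using c by (simp add: mult.assoc)
  \<comment> \<open>Three digits, \<open>c = (k * d + i) * M + \<nu>\<close>: \<open>k\<close>
    belongs to C^n, \<open>i\<close> numbers the matrices of the tuple, and \<open>\<nu>\<close>
    belongs to C^M. Before reshaping, \<open>k\<close> is part of the row index and the column index
    is \<open>M * i + \<nu>\<close>.\<close>
  define k i \<nu> where "k = c div M div d" and "i = c div M mod d" and "\<nu> = c mod M"
  note cM = digit_bounds[OF c]
  have b: "k < n" "i < d" "\<nu> < M" unfolding k_def i_def \<nu>_def using cM digit_bounds[OF cM(1)] by auto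
  have cdiv: "c div (d * M) = k" unfolding k_def by (metis div_mult2_eq mult.commute)
  have "c mod (d * M) = M * (c div M mod d) + c mod M" using mod_mult2_eq[of c M d] by (simp only: mult.commute)
  then have cmod: "c mod (d * M) = M * i + \<nu>" by (simp add: i_def \<nu>_def)
  have Xi: "dim_row (X ! i) = n" "dim_col (X ! i) = n" using X(1)[OF b(2)] by auto
  have lt: "k * y + x < n * y" by (rule digits_less[OF b(1) x])
  have lt2: "M * i + \<nu> < d * M" using digits_less[OF b(2,3)] by (simp add: mult.commute)
  have kx: "(k * y + x) div y = k" "(k * y + x) mod y = x" using x by auto
  have i\<nu>: "(M * i + \<nu>) div M = i" "(M * i + \<nu>) mod M = \<nu>" using b(3) by auto
  have S: "?S $$ (k * y + x, M * i + \<nu>) = (\<Sum>l<n. (X ! i) $$ (l, k) * Q $$ (l * y + x, \<nu>))"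
  proof -
    have "?S $$ (k * y + x, M * i + \<nu>) =
        (\<Sum>r<d * (n * y). (row_matrix_swapped d n (map transpose_mat X) $$ (k, r div y) * (if x = r mod y then 1 else 0)) *
          ((if r div (n * y) = i then 1 else 0) * Q $$ (r mod (n * y), \<nu>)))"
      using lt lt2 x kx i\<nu> b by (subst index_mult_sum) (auto simp: digit_bounds mult.assoc intro!: sum.cong)
    also have "\<dots> = (\<Sum>r<d * (n * y). (map transpose_mat X ! (r div (n * y))) $$ (k, r mod (n * y) div y) *
          (if x = r mod (n * y) mod y then 1 else 0) * ((if r div (n * y) = i then 1 else 0) * Q $$ (r mod (n * y), \<nu>)))"
    proof (rule sum.cong[OF refl])
      fix r assume "r \<in> {..<d * (n * y)}"
      then have r: "r < d * (n * y)" by simp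
      then have r': "r < d * n * y" by (simp add: mult.assoc)
      have m: "r mod (n * y) = y * (r div y mod n) + r mod y" using mod_mult2_eq[of r y n] by (simp only: mult.commute)
      have dv: "r div (n * y) = r div y div n" by (metis div_mult2_eq mult.commute)
      have "r mod (n * y) div y = r div y mod n" "r mod (n * y) mod y = r mod y"
        using digit_bounds(2)[OF r'] by (simp_all add: m)
      then show "row_matrix_swapped d n (map transpose_mat X) $$ (k, r div y) * (if x = r mod y then 1 else 0) *
          ((if r div (n * y) = i then 1 else 0) * Q $$ (r mod (n * y), \<nu>)) =
        (map transpose_mat X ! (r div (n * y))) $$ (k, r mod (n * y) div y) *
          (if x = r mod (n * y) mod y then 1 else 0) * ((if r div (n * y) = i then 1 else 0) * Q $$ (r mod (n * y), \<nu>))"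
        using digit_bounds(1)[OF r'] b(1) by (simp add: dv)
    qed
    also have "\<dots> = (\<Sum>j<d. \<Sum>p<n * y. (map transpose_mat X ! j) $$ (k, p div y) *
          (if x = p mod y then 1 else 0) * ((if j = i then 1 else 0) * Q $$ (p, \<nu>)))"
      by (rule sum_digits)
    also have "\<dots> = (\<Sum>j<d. (if i = j then 1 else 0) * (\<Sum>p<n * y. (if x = p mod y then 1 else 0) *
          ((map transpose_mat X ! j) $$ (k, p div y) * Q $$ (p div y * y + p mod y, \<nu>))))"
      by (intro sum.cong) (auto simp: sum_distrib_left mult_ac intro!: sum.cong)
    also have "\<dots> = (\<Sum>p<n * y. (if x = p mod y then 1 else 0) *
          ((map transpose_mat X ! i) $$ (k, p div y) * Q $$ (p div y * y + p mod y, \<nu>)))"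
      using b by (simp add: sum_delta_mult)
    also have "\<dots> = (\<Sum>l<n. \<Sum>z<y. (if x = z then 1 else 0) * ((map transpose_mat X ! i) $$ (k, l) * Q $$ (l * y + z, \<nu>)))"
      by (rule sum_digits)
    also have "\<dots> = (\<Sum>l<n. (X ! i) $$ (l, k) * Q $$ (l * y + x, \<nu>))"
      using x b X(2) Xi by (simp add: sum_delta_mult)
    finally show ?thesis .
  qed
  have "?R $$ (x, c) = (\<Sum>r<n * M. Q $$ ((r div M) * y + x, r mod M) * ((X ! i) $$ (r div M, k) * (if r mod M = \<nu> then 1 else 0)))"
    using x c b cM by (subst index_mult_sum) (auto simp: digit_bounds k_def i_def \<nu>_def intro!: sum.cong)
  also have "\<dots> = (\<Sum>l<n. \<Sum>z<M. Q $$ (l * y + x, z) * ((X ! i) $$ (l, k) * (if z = \<nu> then 1 else 0)))"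
    by (rule sum_digits)
  also have "\<dots> = (\<Sum>l<n. \<Sum>z<M. (if \<nu> = z then 1 else 0) * (Q $$ (l * y + x, z) * (X ! i) $$ (l, k)))"
    by (intro sum.cong) auto
  also have "\<dots> = (\<Sum>l<n. (X ! i) $$ (l, k) * Q $$ (l * y + x, \<nu>))"
    using b by (simp add: sum_delta_mult mult.commute)
  finally have "?R $$ (x, c) = ?S $$ (k * y + x, M * i + \<nu>)" using S by simp
  then show "reshape n y ?S $$ (x, c) = ?R $$ (x, c)" using x c' by (simp add: cdiv cmod del: index_mult_mat(1))
qed (use Q in \<open>auto simp: mult.assoc\<close>)

lemma interpolant_of_pick_psd:
  assumes d: "1 \<le> d" and X: "X \<in> row_ball_level d n"
    and Y: "\<And>i j. i < s \<Longrightarrow> j < t \<Longrightarrow> Y i j \<in> carrier_mat n n"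
  defines "\<Phi> \<equiv> tensor_blocks n n s t Y"
  assumes psd: "psd (kron (pick_matrix n X) (1\<^sub>m s) -
    kron (1\<^sub>m n) \<Phi> * kron (pick_matrix n X) (1\<^sub>m t) * kron (1\<^sub>m n) (adj \<Phi>))"
  shows "\<exists>F. F \<in> carrier_mat s t \<and> (\<forall>i<s. \<forall>j<t. F $$ (i, j) \<in> H_infinity d) \<and>
    H_infinity_norm d F \<le> 1 \<and> (\<forall>i<s. \<forall>j<t. (F $$ (i, j)) X = Y i j)"
proof -
  note Xc = row_ball_levelD(1,2)[OF X]
  have Xi: "X ! i \<in> carrier_mat n n" if "i < d" for i using Xc nth_mem[of i X] that by auto
  let ?P = "pick_matrix n X" and ?W = "kron (1\<^sub>m n) \<Phi>" and ?v = "vec_identity n" and ?y = "n * s"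
  let ?x = "row_matrix_swapped d n (map transpose_mat X)"
  \<comment> \<open>The dimension of the state space is the size of the matrix in the Pick
    inequality, so that its factor Q is square.\<close>
  define M where "M = n * (n * s)"
  have P: "?P \<in> carrier_mat (n * n) (n * n)" by (rule pick_matrix_carrier)
  have [simp]: "dim_row ?P = n * n" "dim_col ?P = n * n" using P by auto
  have [simp]: "dim_row \<Phi> = n * s" "dim_col \<Phi> = n * t" by (simp_all add: \<Phi>_def)
  have \<Phi>c: "\<Phi> \<in> carrier_mat (n * s) (n * t)" by (rule carrier_matI) simp_all
  define E where "E = kron ?P (1\<^sub>m s) - ?W * kron ?P (1\<^sub>m t) * adj ?W"
  have E: "E \<in> carrier_mat M M" by (rule carrier_matI) (simp_all add: E_def M_def)
  have psdE: "psd E" using psd by (simp add: E_def kron_adj)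
  obtain Q where Q: "Q \<in> carrier_mat M M" and EQ: "E = Q * adj Q" by (rule psd_factor[OF E psdE])
  have [simp]: "dim_row Q = M" "dim_col Q = M" using Q by auto
  define U where "U = kron ?v (1\<^sub>m s)"
  define W where "W = ?W * kron ?v (1\<^sub>m t)"
  define R where "R = kron ?x (1\<^sub>m ?y) * kron (1\<^sub>m d) Q"
  have UC: "U \<in> carrier_mat M s" by (rule carrier_matI) (simp_all add: U_def M_def mult.assoc)
  have WC: "W \<in> carrier_mat M t" by (rule carrier_matI) (simp_all add: W_def M_def)
  have RC: "R \<in> carrier_mat M (d * M)" by (rule carrier_matI) (simp_all add: R_def M_def)
  have [simp]: "dim_row U = M" "dim_col U = s" "dim_row W = M" "dim_col W = t" "dim_row R = M" "dim_col R = d * M"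
    using UC WC RC by auto
  have stein: "kron ?x (1\<^sub>m n) * kron (1\<^sub>m d) ?P * adj (kron ?x (1\<^sub>m n)) = ?P - ?v * adj ?v"
  proof (rule eq_matI)
    fix i j assume "i < dim_row (?P - ?v * adj ?v)" "j < dim_col (?P - ?v * adj ?v)"
    then show "(kron ?x (1\<^sub>m n) * kron (1\<^sub>m d) ?P * adj (kron ?x (1\<^sub>m n))) $$ (i, j) = (?P - ?v * adj ?v) $$ (i, j)"
      using arg_cong[OF pick_matrix_stein(2)[OF X], of "\<lambda>A. A $$ (i, j)"]
      by (simp add: algebra_simps del: index_mult_mat(1) index_adj index_kron)
  qed simp_all
  have stein_kron: "kron ?x (1\<^sub>m (n * u)) * kron (1\<^sub>m d) (kron ?P (1\<^sub>m u)) * adj (kron ?x (1\<^sub>m (n * u))) =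
      kron (?P - ?v * adj ?v) (1\<^sub>m u)" for u
  proof -
    have "kron ?x (1\<^sub>m (n * u)) = kron (kron ?x (1\<^sub>m n)) (1\<^sub>m u)" by (simp add: kron_assoc kron_one)
    then show ?thesis unfolding stein[symmetric]
      by (simp add: kron_assoc[symmetric] kron_adj kron_mult mat_units mult.assoc)
  qed
  \<comment> \<open>The row acts on the first factor C^n and \<open>?W\<close> on the remaining
    ones, so they commute up to the size of the identity, which is n s before \<open>?W\<close> and
    n t after it.\<close>
  have comm: "kron ?x (1\<^sub>m ?y) * kron (1\<^sub>m d) ?W = ?W * kron ?x (1\<^sub>m (n * t))"
  proof -
    have "kron (1\<^sub>m d) ?W = kron (1\<^sub>m (d * n)) \<Phi>" by (simp add: kron_one flip: kron_assoc)
    then show ?thesis by (simp add: kron_mult mat_units)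
  qed
  \<comment> \<open>Conjugating E with the row of the X_i^T \<otimes> I replaces P by P - v
    \<open>adj v\<close> in both terms, by the second Stein equation and, in the second term,
    \<open>comm\<close>. The missing multiples of v \<open>adj v\<close> are the Gram matrices of U
    and W.\<close>
  have RR: "R * adj R = kron (?P - ?v * adj ?v) (1\<^sub>m s) - ?W * kron (?P - ?v * adj ?v) (1\<^sub>m t) * adj ?W"
  proof -
    let ?X = "kron ?x (1\<^sub>m ?y)" and ?X' = "kron ?x (1\<^sub>m (n * t))"
    have "R * adj R = ?X * (kron (1\<^sub>m d) Q * adj (kron (1\<^sub>m d) Q)) * adj ?X"
      by (simp add: R_def adj_mult mat_assoc M_def)
    also have "kron (1\<^sub>m d) Q * adj (kron (1\<^sub>m d) Q) = kron (1\<^sub>m d) E"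
      by (simp add: kron_adj kron_mult mat_units EQ)
    also have "kron (1\<^sub>m d) E = kron (1\<^sub>m d) (kron ?P (1\<^sub>m s)) -
        kron (1\<^sub>m d) ?W * kron (1\<^sub>m d) (kron ?P (1\<^sub>m t)) * adj (kron (1\<^sub>m d) ?W)"
      by (simp add: E_def kron_minus kron_adj kron_mult mat_units mult.assoc)
    also have "?X * (kron (1\<^sub>m d) (kron ?P (1\<^sub>m s)) -
        kron (1\<^sub>m d) ?W * kron (1\<^sub>m d) (kron ?P (1\<^sub>m t)) * adj (kron (1\<^sub>m d) ?W)) * adj ?X =
      ?X * kron (1\<^sub>m d) (kron ?P (1\<^sub>m s)) * adj ?X -
        (?X * kron (1\<^sub>m d) ?W) * kron (1\<^sub>m d) (kron ?P (1\<^sub>m t)) * adj (?X * kron (1\<^sub>m d) ?W)"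
      by (simp add: mat_algebra mult.assoc)
    also have "\<dots> = kron (?P - ?v * adj ?v) (1\<^sub>m s) -
        ?W * (?X' * kron (1\<^sub>m d) (kron ?P (1\<^sub>m t)) * adj ?X') * adj ?W"
      unfolding comm stein_kron[of s] by (simp add: adj_mult mat_assoc mult.assoc)
    finally show ?thesis unfolding stein_kron[of t] .
  qed
  have gram: "U * adj U + R * adj R = W * adj W + Q * adj Q"
  proof -
    have UU: "U * adj U = kron (?v * adj ?v) (1\<^sub>m s)" by (simp add: U_def kron_adj kron_mult mat_units)
    have "W * adj W = ?W * (kron ?v (1\<^sub>m t) * adj (kron ?v (1\<^sub>m t))) * adj ?W"
      by (simp add: W_def adj_mult mat_assoc mult.assoc)
    also have "kron ?v (1\<^sub>m t) * adj (kron ?v (1\<^sub>m t)) = kron (?v * adj ?v) (1\<^sub>m t)"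
      by (simp add: kron_adj kron_mult mat_units)
    finally have WW: "W * adj W = ?W * kron (?v * adj ?v) (1\<^sub>m t) * adj ?W" .
    show ?thesis
      unfolding UU WW RR EQ[symmetric] E_def
      by (simp add: kron_minus mat_algebra mult.assoc)
         (intro eq_matI; simp add: mult.assoc del: index_mult_mat(1) index_kron)
  qed
  obtain A B C D G1 G2 where c: "A \<in> carrier_mat s t" "B \<in> carrier_mat s M" "C \<in> carrier_mat (d * M) t"
    "D \<in> carrier_mat (d * M) M" "G1 \<in> carrier_mat s (s + d * M)" "G2 \<in> carrier_mat (d * M) (s + d * M)"
    and coiso: "A * adj A + B * adj B + G1 * adj G1 = 1\<^sub>m s"
    "A * adj C + B * adj D + G1 * adj G2 = 0\<^sub>m s (d * M)"
    "C * adj C + D * adj D + G2 * adj G2 = 1\<^sub>m (d * M)"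
    and eqs: "W = U * A + R * C" "Q = U * B + R * D"
    by (rule equal_gram_colligation[OF UC RC WC Q gram])
  interpret coisometric_colligation d s t M "s + d * M" A B C D G1 G2
    by unfold_locales (use c coiso in auto)
  define H where "H = reshape n ?y Q"
  have [simp]: "dim_row H = n * s" "dim_col H = n * M" by (simp_all add: H_def)
  have UC': "U \<in> carrier_mat (n * ?y) s" and RC': "R \<in> carrier_mat (n * ?y) (d * M)"
    and QC': "Q \<in> carrier_mat (n * ?y) M" using UC RC Q by (simp_all add: M_def)
  have U1: "reshape n ?y U = 1\<^sub>m ?y" unfolding U_def by (rule reshape_vec_identity)
  have R1: "reshape n ?y R = H * arrow n X"
    unfolding R_def H_def arrow_def by (rule reshape_row[OF Xi Xc(1) QC'])
  have shape: "reshape n ?y (U * K + R * L) = kron (1\<^sub>m n) K + H * arrow n X * kron (1\<^sub>m n) L"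
    if KL: "K \<in> carrier_mat s r" "L \<in> carrier_mat (d * M) r" for K L r
  proof -
    have [simp]: "dim_row K = s" using KL by auto
    have "reshape n ?y (U * K + R * L) = reshape n ?y (U * K) + reshape n ?y (R * L)"
      by (rule reshape_add[OF mult_carrier_mat[OF UC' KL(1)] mult_carrier_mat[OF RC' KL(2)]])
    then show ?thesis
      unfolding reshape_mult_right[OF UC' KL(1)] reshape_mult_right[OF RC' KL(2)] U1 R1
      by (simp add: mat_units)
  qed
  have H_eq: "H = kron (1\<^sub>m n) B + H * arrow n X * kron (1\<^sub>m n) D"
    using shape[OF c(2,4)] unfolding eqs(2)[symmetric] H_def[symmetric] .
  have W_eq: "\<Phi> = kron (1\<^sub>m n) A + H * arrow n X * kron (1\<^sub>m n) C"
  proof -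
    have "reshape n ?y W = \<Phi> * reshape n (n * t) (kron ?v (1\<^sub>m t))"
      unfolding W_def by (rule reshape_mult_left[OF _ \<Phi>c]) (rule carrier_matI; simp add: mult.assoc)
    then have "reshape n ?y W = \<Phi>" by (simp add: reshape_vec_identity mat_units)
    then show ?thesis using shape[OF c(1,3)] unfolding eqs(1)[symmetric] by simp
  qed
  \<comment> \<open>By \<open>H_eq\<close>, H (I - L) = I \<otimes> B, and multiplication by the
    resolvent from the right identifies H.\<close>
  have "output_map n X = H"
  proof -
    let ?L = "arrow n X * kron (1\<^sub>m n) D"
    note res = resolvent[OF X]
    have [simp]: "dim_row (resolvent n X) = n * M" "dim_col (resolvent n X) = n * M" using res(1) by auto
    have "H * (1\<^sub>m (n * M) - ?L) = H - H * arrow n X * kron (1\<^sub>m n) D" by (simp add: mat_algebra)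
    also have "\<dots> = kron (1\<^sub>m n) B"
    proof (rule eq_matI)
      fix i j assume ij: "i < dim_row (kron (1\<^sub>m n) B)" "j < dim_col (kron (1\<^sub>m n) B)"
      have "H $$ (i, j) = (kron (1\<^sub>m n) B + H * arrow n X * kron (1\<^sub>m n) D) $$ (i, j)" using H_eq by (rule arg_cong)
      then show "(H - H * arrow n X * kron (1\<^sub>m n) D) $$ (i, j) = kron (1\<^sub>m n) B $$ (i, j)"
        using ij by (simp del: index_mult_mat(1) index_kron)
    qed simp_all
    finally have "H * (1\<^sub>m (n * M) - ?L) * resolvent n X = output_map n X" by (simp only: output_map_def)
    moreover have "H * (1\<^sub>m (n * M) - ?L) * resolvent n X = H * ((1\<^sub>m (n * M) - ?L) * resolvent n X)"
      by (simp add: mat_assoc)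
    moreover have "H * ((1\<^sub>m (n * M) - ?L) * resolvent n X) = H" unfolding res(2) by (simp add: mat_units)
    ultimately show ?thesis by (simp only:)
  qed
  then have "transfer n X = \<Phi>" unfolding transfer_def by (simp only: W_eq[symmetric])
  then have blocks: "tensor_blocks n n s t (\<lambda>i j. entry i j X) = tensor_blocks n n s t Y"
    by (simp only: tensor_blocks_entry[OF d X] \<Phi>_def)
  have "entry i j X = Y i j" if "i < s" "j < t" for i j
    by (rule tensor_blocks_inject[OF blocks entry_carrier[OF d X] Y[OF that] that])
  then show ?thesis
    using entry_norm[OF d] entry_H_infinity[OF d] by (intro exI[of _ "mat s t (\<lambda>(i, j). entry i j)"]) simp
qed

theorem theorem3p5:
  fixes d n s t :: nat and X :: "complex mat list" and Y :: "complex mat mat"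
  assumes "1 \<le> d" and "1 \<le> n" and "1 \<le> s" and "1 \<le> t"
    and "X \<in> row_ball_level d n"
    and "Y \<in> carrier_mat s t"
    and "\<forall>i<s. \<forall>j<t. Y $$ (i, j) \<in> carrier_mat n n"
  shows "(\<exists>F :: (complex mat list \<Rightarrow> complex mat) mat.
            F \<in> carrier_mat s t \<and>
            (\<forall>i<s. \<forall>j<t. F $$ (i, j) \<in> H_infinity d) \<and>
            H_infinity_norm d F \<le> 1 \<and>
            (\<forall>i<s. \<forall>j<t. (F $$ (i, j)) X = Y $$ (i, j)))
         \<longleftrightarrow>
         psd (kron (pick_matrix n X) (1\<^sub>m s) -
              kron (1\<^sub>m n) (block_tensor n Y) *
              kron (pick_matrix n X) (1\<^sub>m t) *
              kron (1\<^sub>m n) (mat_adjoint (block_tensor n Y)))"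
    (is "?interpolates \<longleftrightarrow> ?positive")
proof -
  have Y: "Y $$ (i, j) \<in> carrier_mat n n" if "i < s" "j < t" for i j using assms(7) that by blast
  have tensor: "block_tensor n Y = tensor_blocks n n s t (\<lambda>i j. Y $$ (i, j))"
    by (rule block_tensor_eq[OF assms(6)]) (rule Y)
  show ?thesis
  proof
    assume ?interpolates
    then obtain F where F: "F \<in> carrier_mat s t" "\<forall>i<s. \<forall>j<t. F $$ (i, j) \<in> H_infinity d"
      "H_infinity_norm d F \<le> 1" "\<forall>i<s. \<forall>j<t. (F $$ (i, j)) X = Y $$ (i, j)" by blast
    have nc: "nc_function d (F $$ (i, j))" if "i < s" "j < t" for i j
      using F(2) that by (auto simp: H_infinity_def)
    have "tensor_blocks n n s t (\<lambda>i j. (F $$ (i, j)) X) = block_tensor n Y"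
      unfolding tensor using F(4) by (intro tensor_blocks_cong) blast
    then show ?positive
      using pick_psd_of_interpolant[OF assms(2,5) F(1) nc F(3)] by (simp only:)
  next
    assume ?positive
    then show ?interpolates
      unfolding tensor by (intro interpolant_of_pick_psd[OF assms(1,5) Y])
  qed
qed

end
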